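(* Let $\phi:H\to\mathbb{R}$ be a continuously Fréchet-differentiable mapping whose derivative $\phi':H\to H$ (derivative identified with its Riesz representative) is Lipschitz continuous. Let $X$ be the mild solution of $dX(t)+AX(t)\,dt=f(t)\,dt+G(t)\,dL(t)$, $X(0)=x_0\in H$, on $[0,T]$, and for $h\in(0,1]$ let $X_h$ be its Galerkin approximation in $V_h$, as defined in the context. Then there exists a constant $C(T)>0$, independent of $h$, such that for all $h\in(0,1]$ $$\bigl|\mathbb{E}\left[\phi(X_h(T))-\phi(X(T))\right]\bigr|\le C(T)\,(1+|\ln(h)|)\,h^2 .$$
   Context: Let $0<T<\infty$ and let $(U,\langle\cdot,\cdot\rangle_U)$, $(H,\langle\cdot,\cdot\rangle_H)$ be real separable Hilbert spaces; $L(U;H)$ denotes the bounded linear operators from $U$ to $H$ with the operator norm. Noise. $L=(L(t),t\in[0,T])$ is a $U$-valued Lévy process on a complete filtered probability space $(\Omega,\mathcal{F},(\mathcal{F}_t)_{t\in[0,T]},\mathbb{P})$ satisfying the usual conditions, with $L(t)-L(s)$ independent of $\mathcal{F}_s$ for $s<t$. $L$ is càdlàg, square integrable, of mean zero, and has vanishing Gaussian part; its Lévy measure $\nu$ satisfies $\int_U\|u\|_U^2\,\nu(du)<\infty$. With $\Delta L(t)=L(t)-L(t-)$, let $p=\sum_{0<s\le T}\mathbf{1}_{\{\Delta L(s)\ne0\}}\delta_{(s,\Delta L(s))}$ be the jump measure, a Poisson random measure on $[0,T]\times U$ with intensity $\lambda\otimes\nu$ ($\lambda$ Lebesgue measure),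 and $q=p-\lambda\otimes\nu$. It is assumed that $\mathcal{F}$ and $(\mathcal{F}_t)$ are generated by $q$ (augmented by null sets). Equation. $A:\mathcal{D}(A)\subset H\to H$ is linear, densely defined, self-adjoint, positive definite and has a compact inverse; $f:[0,T]\to H$ and $G:[0,T]\to L(U;H)$ are measurable and bounded; $x_0\in H$. Let $(S(t))_{t\ge0}$ be the analytic contraction semigroup generated by $-A$. The mild solution is $$X(t)=S(t)x_0+\int_0^tS(t-s)f(s)\,ds+\int_0^tS(t-s)G(s)\,dL(s),$$ where the last integral is the usual Hilbert-space stochastic integral with respect to the square integrable martingale $L$. Fractional spaces. Let $(e_k)$ be an orthonormal basis of $H$ with $Ae_k=\lambda_ke_k$, $0<\lambda_1\le\lambda_2\le\dots\to\infty$. For $s\ge0$, $\dot H^s=\mathcal{D}(A^{s/2})=\{x\in H:\|x\|_s^2:=\sum_k\lambda_k^s\langle x,e_k\rangle_H^2<\infty\}$, a Hilbert space with norm $\|x\|_s=\|A^{s/2}x\|_H$ and inner product $\langle x,y\rangle_{\dot H^s}=\langle A^{s/2}x,A^{s/2}y\rangle_H$. Galerkin approximation. $(V_h)_{h\in(0,1]}$ is a family of finite-dimensional subspaces of $\dot H^1$, endowed with the norm of $H$. $P_h:H\to V_h$ and $R_h:\dot H^1\to V_h$ are the orthogonal projections with respect to the inner products of $H$ and $\dot H^1$, respectively. It is assumed that there is a constant $C$ such that $$\|R_hx-x\|_H\le Ch^\beta\|x\|_\beta\qquad\text{for all }x\in\dot H^\beta,\ \beta\in\{1,2\},\ h\in(0,1].$$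 $A_h:V_h\to V_h$ is defined by $\langle A_hx,y\rangle_H=\langle x,y\rangle_{\dot H^1}$ for all $x,y\in V_h$, and $S_h(t)=e^{-tA_h}$. The approximation is $$X_h(t)=S_h(t)P_hx_0+\int_0^tS_h(t-s)P_hf(s)\,ds+\int_0^tS_h(t-s)P_hG(s)\,dL(s).$$ *)

theory Defs
  imports "HOL-Probability.Probability"
begin

text \<open>
  Real separable Hilbert spaces are types of sort
  \<open>{real_inner, banach, second_countable_topology}\<close>.  Functions of time have type
  \<open>real \<Rightarrow> _\<close>; only their values on \<open>[0, T]\<close> (or on \<open>[0, \<infinity>)\<close> for semigroups) are constrained.
\<close>

section \<open>The operator and its semigroup\<close>

text \<open>
  An unbounded operator is a function together with its domain.  The third clause of
  \<open>self_adjoint_on\<close> says that the graph of the adjoint is the graph of the operator, so it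
  includes equality of the two domains.
\<close>

definition linear_on_dom :: "'h::real_vector set \<Rightarrow> ('h \<Rightarrow> 'h) \<Rightarrow> bool" where
  "linear_on_dom D A \<longleftrightarrow> subspace D \<and>
     (\<forall>x\<in>D. \<forall>y\<in>D. A (x + y) = A x + A y) \<and> (\<forall>c. \<forall>x\<in>D. A (c *\<^sub>R x) = c *\<^sub>R A x)"

definition self_adjoint_on :: "'h::real_inner set \<Rightarrow> ('h \<Rightarrow> 'h) \<Rightarrow> bool" where
  "self_adjoint_on D A \<longleftrightarrow> linear_on_dom D A \<and> closure D = UNIV \<and>
     (\<forall>y z. y \<in> D \<and> z = A y \<longleftrightarrow> (\<forall>x\<in>D. inner (A x) y = inner x z))"

definition positive_definite_on :: "'h::real_inner set \<Rightarrow> ('h \<Rightarrow> 'h) \<Rightarrow> bool" where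
  "positive_definite_on D A \<longleftrightarrow> (\<forall>x\<in>D. x \<noteq> 0 \<longrightarrow> inner (A x) x > 0)"

definition has_compact_inverse :: "'h::real_normed_vector set \<Rightarrow> ('h \<Rightarrow> 'h) \<Rightarrow> bool" where
  "has_compact_inverse D A \<longleftrightarrow> bij_betw A D UNIV \<and>
     (\<forall>B. bounded B \<longrightarrow> compact (closure (inv_into D A ` B)))"

text \<open>
  The last clause says that the infinitesimal generator of \<open>S\<close>, domain included, is \<open>-A\<close>;
  this determines \<open>S\<close> on \<open>[0, \<infinity>)\<close>.  For self-adjoint positive definite \<open>A\<close> analyticity of
  \<open>S\<close> is a consequence and is therefore not listed as a requirement.
\<close>

definition contraction_semigroup_of ::
    "'h::real_normed_vector set \<Rightarrow> ('h \<Rightarrow> 'h) \<Rightarrow> (real \<Rightarrow> 'h \<Rightarrow>\<^sub>L 'h) \<Rightarrow> bool" where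
  "contraction_semigroup_of D A S \<longleftrightarrow>
     S 0 = id_blinfun \<and>
     (\<forall>s\<ge>0. \<forall>t\<ge>0. S (s + t) = S s o\<^sub>L S t) \<and>
     (\<forall>x. continuous_on {0..} (\<lambda>t. blinfun_apply (S t) x)) \<and>
     (\<forall>t\<ge>0. norm (S t) \<le> 1) \<and>
     (\<forall>x y. x \<in> D \<and> y = - A x \<longleftrightarrow>
        ((\<lambda>t. (blinfun_apply (S t) x - x) /\<^sub>R t) \<longlongrightarrow> y) (at_right 0))"

section \<open>Fractional spaces\<close>

definition eigenbasis ::
    "'h::real_inner set \<Rightarrow> ('h \<Rightarrow> 'h) \<Rightarrow> (nat \<Rightarrow> 'h) \<Rightarrow> (nat \<Rightarrow> real) \<Rightarrow> bool" where
  "eigenbasis D A e lam \<longleftrightarrow>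
     (\<forall>i j. inner (e i) (e j) = (if i = j then 1 else 0)) \<and>
     closure (span (range e)) = UNIV \<and>
     (\<forall>k. e k \<in> D \<and> A (e k) = lam k *\<^sub>R e k) \<and>
     0 < lam 0 \<and> incseq lam \<and> filterlim lam at_top sequentially"

definition frac_power ::
    "(nat \<Rightarrow> 'h::real_inner) \<Rightarrow> (nat \<Rightarrow> real) \<Rightarrow> real \<Rightarrow> 'h \<Rightarrow> 'h" where
  "frac_power e lam r x = (\<Sum>k. (lam k powr r * inner x (e k)) *\<^sub>R e k)"

definition hdot :: "(nat \<Rightarrow> 'h::real_inner) \<Rightarrow> (nat \<Rightarrow> real) \<Rightarrow> real \<Rightarrow> 'h set" where
  "hdot e lam s = {x. summable (\<lambda>k. lam k powr s * (inner x (e k))\<^sup>2)}"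

definition hdot_inner ::
    "(nat \<Rightarrow> 'h::real_inner) \<Rightarrow> (nat \<Rightarrow> real) \<Rightarrow> real \<Rightarrow> 'h \<Rightarrow> 'h \<Rightarrow> real" where
  "hdot_inner e lam s x y = inner (frac_power e lam (s / 2) x) (frac_power e lam (s / 2) y)"

definition hdot_norm ::
    "(nat \<Rightarrow> 'h::real_inner) \<Rightarrow> (nat \<Rightarrow> real) \<Rightarrow> real \<Rightarrow> 'h \<Rightarrow> real" where
  "hdot_norm e lam s x = norm (frac_power e lam (s / 2) x)"

section \<open>Galerkin spaces, projections and the discrete semigroup\<close>

definition finite_dim_subspace :: "'h::real_vector set \<Rightarrow> bool" where
  "finite_dim_subspace V \<longleftrightarrow> (\<exists>B. finite B \<and> V = span B)"

definition orth_proj :: "'h::real_inner set \<Rightarrow> 'h \<Rightarrow> 'h" where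
  "orth_proj V x = (THE y. y \<in> V \<and> (\<forall>z\<in>V. inner (x - y) z = 0))"

definition ritz_proj ::
    "(nat \<Rightarrow> 'h::real_inner) \<Rightarrow> (nat \<Rightarrow> real) \<Rightarrow> 'h set \<Rightarrow> 'h \<Rightarrow> 'h" where
  "ritz_proj e lam V x = (THE y. y \<in> V \<and> (\<forall>z\<in>V. hdot_inner e lam 1 (x - y) z = 0))"

definition discrete_op ::
    "(nat \<Rightarrow> 'h::real_inner) \<Rightarrow> (nat \<Rightarrow> real) \<Rightarrow> 'h set \<Rightarrow> 'h \<Rightarrow> 'h" where
  "discrete_op e lam V x = (THE y. y \<in> V \<and> (\<forall>z\<in>V. inner y z = hdot_inner e lam 1 x z))"

text \<open>The operator exponential on \<open>V\<close>; meaningful for \<open>x \<in> V\<close> only.\<close>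

definition discrete_semigroup ::
    "(nat \<Rightarrow> 'h::real_inner) \<Rightarrow> (nat \<Rightarrow> real) \<Rightarrow> 'h set \<Rightarrow> real \<Rightarrow> 'h \<Rightarrow> 'h" where
  "discrete_semigroup e lam V t x =
     (\<Sum>n. ((- t) ^ n / fact n) *\<^sub>R (discrete_op e lam V ^^ n) x)"

section \<open>Filtrations and Levy processes on \<open>[0, T]\<close>\<close>

definition usual_filtration :: "'w measure \<Rightarrow> real \<Rightarrow> (real \<Rightarrow> 'w measure) \<Rightarrow> bool" where
  "usual_filtration M T F \<longleftrightarrow>
     (\<forall>t\<in>{0..T}. subalgebra M (F t)) \<and>
     (\<forall>s\<in>{0..T}. \<forall>t\<in>{s..T}. sets (F s) \<subseteq> sets (F t)) \<and>
     null_sets M \<subseteq> sets (F 0) \<and>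
     (\<forall>t\<in>{0..<T}. sets (F t) = (\<Inter>s\<in>{t<..T}. sets (F s)))"

definition cadlag_on :: "real \<Rightarrow> (real \<Rightarrow> 'u::topological_space) \<Rightarrow> bool" where
  "cadlag_on T x \<longleftrightarrow>
     (\<forall>t\<in>{0..<T}. (x \<longlongrightarrow> x t) (at_right t)) \<and> (\<forall>t\<in>{0<..T}. \<exists>l. (x \<longlongrightarrow> l) (at_left t))"

definition levy_process ::
    "'w measure \<Rightarrow> real \<Rightarrow> (real \<Rightarrow> 'w measure) \<Rightarrow>
     (real \<Rightarrow> 'w \<Rightarrow> 'u::{real_inner, banach, second_countable_topology}) \<Rightarrow> bool" where
  "levy_process M T F L \<longleftrightarrow>
     (\<forall>t\<in>{0..T}. L t \<in> borel_measurable (F t)) \<and>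
     (AE \<omega> in M. L 0 \<omega> = 0) \<and>
     (\<forall>s\<in>{0..T}. \<forall>t\<in>{s<..T}. prob_space.indep_set M (sets (F s))
        {(\<lambda>\<omega>. L t \<omega> - L s \<omega>) -` B \<inter> space M | B. B \<in> sets borel}) \<and>
     (\<forall>s\<in>{0..T}. \<forall>t\<in>{s..T}.
        distr M borel (\<lambda>\<omega>. L t \<omega> - L s \<omega>) = distr M borel (\<lambda>\<omega>. L (t - s) \<omega> - L 0 \<omega>)) \<and>
     (\<forall>t\<in>{0..T}. \<forall>\<epsilon>>0.
        ((\<lambda>s. measure M {\<omega>\<in>space M. \<epsilon> < dist (L s \<omega>) (L t \<omega>)}) \<longlongrightarrow> 0) (at t within {0..T})) \<and>
     (\<forall>\<omega>\<in>space M. cadlag_on T (\<lambda>t. L t \<omega>))"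

definition square_integrable_centred ::
    "'w measure \<Rightarrow> real \<Rightarrow>
     (real \<Rightarrow> 'w \<Rightarrow> 'u::{real_inner, banach, second_countable_topology}) \<Rightarrow> bool" where
  "square_integrable_centred M T L \<longleftrightarrow>
     (\<forall>t\<in>{0..T}. integrable M (\<lambda>\<omega>. (norm (L t \<omega>))\<^sup>2) \<and> (\<integral>\<omega>. L t \<omega> \<partial>M) = 0)"

definition levy_measure :: "'u::{real_inner, second_countable_topology} measure \<Rightarrow> bool" where
  "levy_measure \<nu> \<longleftrightarrow> sets \<nu> = sets borel \<and> emeasure \<nu> {0} = 0 \<and>
     (\<integral>\<^sup>+u. ennreal (min 1 ((norm u)\<^sup>2)) \<partial>\<nu>) < \<infinity>"

text \<open>
  Levy-Khintchine characteristics (drift \<open>b\<close>, Gaussian covariance \<open>C\<close>, Levy measure \<open>\<nu>\<close>).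
  The Gaussian part vanishes iff \<open>C = 0\<close>.
\<close>

definition levy_characteristics ::
    "'w measure \<Rightarrow> real \<Rightarrow>
     (real \<Rightarrow> 'w \<Rightarrow> 'u::{real_inner, banach, second_countable_topology}) \<Rightarrow>
     'u \<Rightarrow> ('u \<Rightarrow>\<^sub>L 'u) \<Rightarrow> 'u measure \<Rightarrow> bool" where
  "levy_characteristics M T L b C \<nu> \<longleftrightarrow> levy_measure \<nu> \<and>
     (\<forall>t\<in>{0..T}. \<forall>x. (\<integral>\<omega>. iexp (inner x (L t \<omega>)) \<partial>M) =
        exp (complex_of_real t *
          (\<i> * complex_of_real (inner b x)
           - complex_of_real (inner (blinfun_apply C x) x / 2)
           + (\<integral>u. (iexp (inner x u) - 1
                 - \<i> * complex_of_real (inner x u * indicator (cball 0 1) u)) \<partial>\<nu>))))"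

section \<open>The jump measure and the filtration generated by it\<close>

definition jump :: "(real \<Rightarrow> 'w \<Rightarrow> 'u::real_normed_vector) \<Rightarrow> real \<Rightarrow> 'w \<Rightarrow> 'u" where
  "jump L t \<omega> = L t \<omega> - Lim (at_left t) (\<lambda>s. L s \<omega>)"

definition jump_intensity ::
    "real \<Rightarrow> 'u::real_normed_vector measure \<Rightarrow> (real \<times> 'u) measure" where
  "jump_intensity T \<nu> = restrict_space lborel {0..T} \<Otimes>\<^sub>M \<nu>"

text \<open>
  The sum of the unit masses at \<open>(s, jump L s \<omega>)\<close> over the jump times \<open>s\<close>, written as an image
  of the counting measure; \<open>\<nu>\<close> enters only through the \<open>\<sigma>\<close>-algebra on \<open>[0, T] \<times> U\<close>.
\<close>

definition jump_measure ::
    "real \<Rightarrow> 'u measure \<Rightarrow> (real \<Rightarrow> 'w \<Rightarrow> 'u::real_normed_vector) \<Rightarrow> 'w \<Rightarrow> (real \<times> 'u) measure"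
  where
  "jump_measure T \<nu> L \<omega> =
     distr (count_space {s\<in>{0<..T}. jump L s \<omega> \<noteq> 0}) (jump_intensity T \<nu>) (\<lambda>s. (s, jump L s \<omega>))"

definition poisson_random_measure ::
    "'w measure \<Rightarrow> ('w \<Rightarrow> 'a measure) \<Rightarrow> 'a measure \<Rightarrow> bool" where
  "poisson_random_measure M p \<mu> \<longleftrightarrow>
     (\<forall>\<omega>\<in>space M. sets (p \<omega>) = sets \<mu>) \<and>
     (\<forall>B\<in>sets \<mu>. (\<lambda>\<omega>. emeasure (p \<omega>) B) \<in> borel_measurable M) \<and>
     (\<forall>B\<in>sets \<mu>. emeasure \<mu> B < \<infinity> \<longrightarrow>
        (\<forall>k. measure M {\<omega>\<in>space M. emeasure (p \<omega>) B = of_nat k} =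
             measure \<mu> B ^ k / fact k * exp (- measure \<mu> B))) \<and>
     (\<forall>B\<in>sets \<mu>. emeasure \<mu> B = \<infinity> \<longrightarrow> (AE \<omega> in M. emeasure (p \<omega>) B = \<infinity>)) \<and>
     (\<forall>(B :: nat \<Rightarrow> 'a set) n. disjoint_family_on B {..<n} \<and> B ` {..<n} \<subseteq> sets \<mu> \<longrightarrow>
        prob_space.indep_vars M (\<lambda>_. borel) (\<lambda>i \<omega>. emeasure (p \<omega>) (B i)) {..<n})"

text \<open>\<open>q = p - \<lambda> \<otimes> \<nu>\<close>, used only on sets of finite intensity, where \<open>p\<close> is a.s. finite.\<close>

definition compensated_jump_measure ::
    "real \<Rightarrow> 'u measure \<Rightarrow> (real \<Rightarrow> 'w \<Rightarrow> 'u::real_normed_vector) \<Rightarrow> 'w \<Rightarrow> (real \<times> 'u) set \<Rightarrow> real"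
  where
  "compensated_jump_measure T \<nu> L \<omega> B =
     measure (jump_measure T \<nu> L \<omega>) B - measure (jump_intensity T \<nu>) B"

definition jump_generated_sets ::
    "'w measure \<Rightarrow> real \<Rightarrow> 'u measure \<Rightarrow> (real \<Rightarrow> 'w \<Rightarrow> 'u::real_normed_vector) \<Rightarrow>
     real \<Rightarrow> 'w set set" where
  "jump_generated_sets M T \<nu> L t = sigma_sets (space M)
     ({(\<lambda>\<omega>. compensated_jump_measure T \<nu> L \<omega> B) -` Y \<inter> space M | B Y.
         B \<in> sets (jump_intensity T \<nu>) \<and> B \<subseteq> {0..t} \<times> UNIV \<and>
         emeasure (jump_intensity T \<nu>) B < \<infinity> \<and> Y \<in> sets borel}
      \<union> null_sets M)"

definition pure_jump_levy_noise ::
    "'w measure \<Rightarrow> real \<Rightarrow> (real \<Rightarrow> 'w measure) \<Rightarrow>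
     (real \<Rightarrow> 'w \<Rightarrow> 'u::{real_inner, banach, second_countable_topology}) \<Rightarrow> 'u measure \<Rightarrow> bool" where
  "pure_jump_levy_noise M T F L \<nu> \<longleftrightarrow>
     prob_space M \<and> complete_measure M \<and> usual_filtration M T F \<and>
     levy_process M T F L \<and> square_integrable_centred M T L \<and>
     (\<exists>b. levy_characteristics M T L b 0 \<nu>) \<and>
     (\<integral>\<^sup>+u. ennreal ((norm u)\<^sup>2) \<partial>\<nu>) < \<infinity> \<and>
     poisson_random_measure M (jump_measure T \<nu> L) (jump_intensity T \<nu>) \<and>
     (\<forall>t\<in>{0..T}. sets (F t) = jump_generated_sets M T \<nu> L t) \<and>
     sets M = jump_generated_sets M T \<nu> L T"

section \<open>The stochastic integral of deterministic integrands\<close>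

definition covariance_operator ::
    "'w measure \<Rightarrow> real \<Rightarrow> (real \<Rightarrow> 'w \<Rightarrow> 'u::real_inner) \<Rightarrow> ('u \<Rightarrow>\<^sub>L 'u) \<Rightarrow> bool" where
  "covariance_operator M T L Q \<longleftrightarrow>
     (\<forall>t\<in>{0..T}. \<forall>x y. (\<integral>\<omega>. inner (L t \<omega>) x * inner (L t \<omega>) y \<partial>M) = t * inner (blinfun_apply Q x) y)"

definition operator_sqrt :: "('u::real_inner \<Rightarrow>\<^sub>L 'u) \<Rightarrow> ('u \<Rightarrow>\<^sub>L 'u) \<Rightarrow> bool" where
  "operator_sqrt Q R \<longleftrightarrow> R o\<^sub>L R = Q \<and>
     (\<forall>x y. inner (blinfun_apply R x) y = inner x (blinfun_apply R y)) \<and>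
     (\<forall>x. 0 \<le> inner (blinfun_apply R x) x)"

text \<open>
  Squared Hilbert-Schmidt norm.  By Bessel's inequality, for a bounded linear operator the
  supremum over finite orthonormal sets is the sum over any orthonormal basis.
\<close>

definition hs_norm_sq :: "('u::real_inner \<Rightarrow> 'h::real_normed_vector) \<Rightarrow> ennreal" where
  "hs_norm_sq B = (SUP E\<in>{E. finite E \<and> (\<forall>x\<in>E. norm x = 1) \<and> pairwise orthogonal E}.
     \<Sum>x\<in>E. ennreal ((norm (B x))\<^sup>2))"

text \<open>
  An elementary integrand is a list of triples \<open>(a, b, \<Phi>)\<close>, standing for the sum of the operator
  valued step functions \<open>\<Phi> 1\<^bsub>(a, b]\<^esub>\<close>.
\<close>

definition elementary_on ::
    "real \<Rightarrow> (real \<times> real \<times> ('u::real_normed_vector \<Rightarrow>\<^sub>L 'h::real_normed_vector)) list \<Rightarrow> bool" where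
  "elementary_on t xs \<longleftrightarrow> (\<forall>(a, b, \<Phi>)\<in>set xs. 0 \<le> a \<and> a \<le> b \<and> b \<le> t)"

definition elementary_integrand ::
    "(real \<times> real \<times> ('u::real_normed_vector \<Rightarrow>\<^sub>L 'h::real_normed_vector)) list \<Rightarrow> real \<Rightarrow> 'u \<Rightarrow> 'h" where
  "elementary_integrand xs s u =
     (\<Sum>(a, b, \<Phi>)\<leftarrow>xs. (indicator {a<..b} s :: real) *\<^sub>R blinfun_apply \<Phi> u)"

definition elementary_integral ::
    "(real \<Rightarrow> 'w \<Rightarrow> 'u::real_normed_vector) \<Rightarrow>
     (real \<times> real \<times> ('u \<Rightarrow>\<^sub>L 'h::real_normed_vector)) list \<Rightarrow> 'w \<Rightarrow> 'h" where
  "elementary_integral L xs \<omega> = (\<Sum>(a, b, \<Phi>)\<leftarrow>xs. blinfun_apply \<Phi> (L b \<omega> - L a \<omega>))"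

text \<open>
  \<open>I\<close> is (a version of) the integral of \<open>\<Phi>\<close> with respect to \<open>L\<close> over \<open>(0, t]\<close>: the extension of
  the elementary integral by the Ito isometry, whose integrand norm is the norm of
  \<open>L\<^sup>2([0, t])\<close> with values in the Hilbert-Schmidt norm of \<open>\<Phi> Q\<^sup>1\<^sup>/\<^sup>2\<close>, \<open>Q\<close> being the covariance
  operator of \<open>L\<close>.  Only deterministic integrands occur in the equation, and these are limits
  of deterministic elementary integrands.  Measurability of \<open>\<Phi>\<close> is demanded because
  \<open>nn_integral\<close> is a lower integral on non-measurable functions.
\<close>

definition stochastic_integral ::
    "'w measure \<Rightarrow> real \<Rightarrow> (real \<Rightarrow> 'w \<Rightarrow> 'u::{real_inner, banach, second_countable_topology}) \<Rightarrow>
     real \<Rightarrow> (real \<Rightarrow> 'u \<Rightarrow> 'h::{real_inner, banach, second_countable_topology}) \<Rightarrow>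
     ('w \<Rightarrow> 'h) \<Rightarrow> bool" where
  "stochastic_integral M T L t \<Phi> I \<longleftrightarrow>
     I \<in> borel_measurable M \<and>
     (\<forall>s\<in>{0..t}. bounded_linear (\<Phi> s)) \<and>
     (\<forall>u. (\<lambda>s. \<Phi> s u) \<in> borel_measurable (restrict_space borel {0..t})) \<and>
     (\<exists>Q R xs. covariance_operator M T L Q \<and> operator_sqrt Q R \<and>
        (\<forall>n::nat. elementary_on t (xs n)) \<and>
        (\<lambda>n. \<integral>\<^sup>+s\<in>{0..t}. hs_norm_sq (\<lambda>u. elementary_integrand (xs n) s (blinfun_apply R u)
                                           - \<Phi> s (blinfun_apply R u)) \<partial>lborel) \<longlonglongrightarrow> 0 \<and>
        (\<lambda>n. \<integral>\<^sup>+\<omega>. ennreal ((norm (elementary_integral L (xs n) \<omega> - I \<omega>))\<^sup>2) \<partial>M) \<longlonglongrightarrow> 0)"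

section \<open>Mild solution and Galerkin approximation\<close>

text \<open>
  The variation of constants formula with solution operators \<open>K\<close>, to be used with
  \<open>K t = S t\<close> and with \<open>K t = S\<^sub>h t \<circ> P\<^sub>h\<close>.
\<close>

definition variation_of_constants ::
    "'w measure \<Rightarrow> real \<Rightarrow> (real \<Rightarrow> 'w \<Rightarrow> 'u::{real_inner, banach, second_countable_topology}) \<Rightarrow>
     (real \<Rightarrow> 'h \<Rightarrow> 'h::{real_inner, banach, second_countable_topology}) \<Rightarrow>
     'h \<Rightarrow> (real \<Rightarrow> 'h) \<Rightarrow> (real \<Rightarrow> 'u \<Rightarrow>\<^sub>L 'h) \<Rightarrow> (real \<Rightarrow> 'w \<Rightarrow> 'h) \<Rightarrow> bool" where
  "variation_of_constants M T L K x0 f G X \<longleftrightarrow>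
     (\<forall>t\<in>{0..T}. \<exists>I.
        stochastic_integral M T L t (\<lambda>s u. K (t - s) (blinfun_apply (G s) u)) I \<and>
        (AE \<omega> in M. X t \<omega> =
           K t x0 + set_lebesgue_integral lborel {0..t} (\<lambda>s. K (t - s) (f s)) + I \<omega>))"

definition mild_solution ::
    "'w measure \<Rightarrow> real \<Rightarrow> (real \<Rightarrow> 'w \<Rightarrow> 'u::{real_inner, banach, second_countable_topology}) \<Rightarrow>
     (real \<Rightarrow> 'h \<Rightarrow>\<^sub>L 'h::{real_inner, banach, second_countable_topology}) \<Rightarrow>
     'h \<Rightarrow> (real \<Rightarrow> 'h) \<Rightarrow> (real \<Rightarrow> 'u \<Rightarrow>\<^sub>L 'h) \<Rightarrow> (real \<Rightarrow> 'w \<Rightarrow> 'h) \<Rightarrow> bool" where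
  "mild_solution M T L S x0 f G X \<longleftrightarrow>
     variation_of_constants M T L (\<lambda>t. blinfun_apply (S t)) x0 f G X"

definition galerkin_approximation ::
    "'w measure \<Rightarrow> real \<Rightarrow> (real \<Rightarrow> 'w \<Rightarrow> 'u::{real_inner, banach, second_countable_topology}) \<Rightarrow>
     (nat \<Rightarrow> 'h::{real_inner, banach, second_countable_topology}) \<Rightarrow> (nat \<Rightarrow> real) \<Rightarrow> 'h set \<Rightarrow>
     'h \<Rightarrow> (real \<Rightarrow> 'h) \<Rightarrow> (real \<Rightarrow> 'u \<Rightarrow>\<^sub>L 'h) \<Rightarrow> (real \<Rightarrow> 'w \<Rightarrow> 'h) \<Rightarrow> bool" where
  "galerkin_approximation M T L e lam V x0 f G X \<longleftrightarrow>
     variation_of_constants M T L (\<lambda>t x. discrete_semigroup e lam V t (orth_proj V x)) x0 f G X"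

end

theory Submission
  imports Defs
begin

text \<open>
  Write \<open>X(T) = x + I\<close> and \<open>X\<^sub>h(T) = y + J\<close> with deterministic \<open>x\<close>, \<open>y\<close> and stochastic integrals
  \<open>I\<close>, \<open>J\<close> of \<open>\<Phi>(s) = S(T - s) G(s)\<close> and \<open>\<Psi>(s) = S\<^sub>h(T - s) P\<^sub>h G(s)\<close>.  By the mean value theorem
  along the segment from \<open>X(T)\<close> to \<open>X\<^sub>h(T)\<close>, the weak error is the expectation of
  \<open>\<langle>\<phi>'(Z), X\<^sub>h(T) - X(T)\<rangle>\<close> for some point \<open>Z\<close> on the segment (one \<open>\<rho>\<close> for all \<open>\<omega>\<close>).  The part
  \<open>\<langle>\<phi>'(Z), y - x\<rangle>\<close> is of the order of the deterministic error.  The part \<open>\<langle>\<phi>'(Z), J - I\<rangle>\<close> is where the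
  weak order exceeds the strong one: an increment of the integral \<open>J - I\<close> is centred and independent of
  everything in \<open>Z\<close> except for the increment of \<open>Z\<close> over the same time interval, and \<open>\<phi>'\<close> reacts to the
  latter only in a Lipschitz way.  Hence only products of simultaneous increments survive, and
  \<open>|E \<langle>\<phi>'(Z), J - I\<rangle>|\<close> is at most a constant times the integral over \<open>[0, T]\<close> of the product of the
  sizes of \<open>\<Phi>(s)\<close>, \<open>\<Psi>(s)\<close> on the one hand and of \<open>\<Psi>(s) - \<Phi>(s)\<close> on the other.  The difference
  therefore enters to the first power and not, as in the isometry, squared.  This argument replaces
  the duality formula of Malliavin calculus.  It is carried out for finite sums in
  \<open>pairing_of_independent_sums\<close>, by conditioning on all but the last increment, transferred to
  elementary integrals in \<open>elementary_pairing\<close>, and to the limits in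
  \<open>stochastic_integral_pairing\<close>.  The bookkeeping uses \<open>mean_square B\<close>, the second moment of the
  image of the noise under \<open>B\<close> per unit of time.

  The other ingredient is the bound \<open>C h\<^sup>2 / t\<close> for \<open>S\<^sub>h(t) P\<^sub>h - S(t)\<close> in operator norm
  (\<open>galerkin_semigroup_error\<close>).  Both semigroups are functions of operators with an orthonormal
  eigensystem, and the assumption on the Ritz projection says that the inverses of these operators differ
  by at most \<open>C h\<^sup>2\<close>.  The scalar function \<open>s \<mapsto> \<langle>S\<^sub>h(t - s) v, S(s) x\<rangle>\<close> has the derivative
  \<open>\<langle>a', W b'\<rangle>\<close>, where \<open>a\<close>, \<open>b\<close> are the two factors and \<open>W\<close> is the difference of the inverses.  Moving
  one derivative away from the singular endpoint on each half of \<open>[0, t]\<close> bounds its increment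
  (\<open>nonsmooth_data_pairing\<close>).

  Together with the trivial bound 2 the difference is at most a constant times
  \<open>h\<^sup>2 / (h\<^sup>2 + t)\<close>, whose integral over \<open>[0, T]\<close> is of order \<open>(1 + |ln h|) h\<^sup>2\<close>.
\<close>

section \<open>Orthonormal systems in Hilbert spaces\<close>

definition orthonormal_family :: "('i \<Rightarrow> 'h::real_inner) \<Rightarrow> 'i set \<Rightarrow> bool" where
  "orthonormal_family f J \<longleftrightarrow> (\<forall>i\<in>J. \<forall>j\<in>J. inner (f i) (f j) = (if i = j then 1 else 0))"

text \<open>
  For orthonormal \<open>f\<close> this is the functional calculus of the operator with eigenvectors \<open>f j\<close>: the operator
  with eigenvalues \<open>g j\<close> on the span and zero on its complement.  Constant \<open>g = 1\<close> gives the orthogonal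
  projection.  Projections, inverses and semigroups on both levels are written in this form.
\<close>

definition fourier_sum :: "('i \<Rightarrow> 'h::real_inner) \<Rightarrow> 'i set \<Rightarrow> ('i \<Rightarrow> real) \<Rightarrow> 'h \<Rightarrow> 'h" where
  "fourier_sum f J g x = (\<Sum>j\<in>J. (g j * inner x (f j)) *\<^sub>R f j)"

lemma inner_orthonormal_sum:
  assumes "finite J" "orthonormal_family f J"
  shows "inner (\<Sum>j\<in>J. c j *\<^sub>R f j) (\<Sum>j\<in>J. d j *\<^sub>R f j) = (\<Sum>j\<in>J. c j * d j)"
proof -
  have "inner (\<Sum>j\<in>J. c j *\<^sub>R f j) (\<Sum>j\<in>J. d j *\<^sub>R f j) =
      (\<Sum>i\<in>J. \<Sum>j\<in>J. c i * d j * inner (f i) (f j))"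
    unfolding inner_sum_left unfolding inner_sum_right by (simp add: mult_ac)
  also have "\<dots> = (\<Sum>i\<in>J. \<Sum>j\<in>J. if i = j then c i * d j else 0)"
    using assms(2) by (intro sum.cong) (auto simp: orthonormal_family_def)
  also have "\<dots> = (\<Sum>j\<in>J. c j * d j)"
    using assms(1) by simp
  finally show ?thesis .
qed

lemma norm_orthonormal_sum:
  assumes "finite J" "orthonormal_family f J"
  shows "(norm (\<Sum>j\<in>J. c j *\<^sub>R f j))\<^sup>2 = (\<Sum>j\<in>J. (c j)\<^sup>2)"
  unfolding power2_norm_eq_inner inner_orthonormal_sum[OF assms] by (simp add: power2_eq_square)

lemma inner_orthonormal_sum_member:
  assumes "finite J" "orthonormal_family f J" "k \<in> J"
  shows "inner (\<Sum>j\<in>J. c j *\<^sub>R f j) (f k) = c k"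
proof -
  have "inner (\<Sum>j\<in>J. c j *\<^sub>R f j) (f k) = (\<Sum>j\<in>J. if j = k then c j else 0)"
    unfolding inner_sum_left using assms(2,3)
    by (intro sum.cong) (auto simp: orthonormal_family_def)
  then show ?thesis using assms by simp
qed

lemma inner_fourier_sum_member:
  assumes "finite J" "orthonormal_family f J" "k \<in> J"
  shows "inner (fourier_sum f J g x) (f k) = g k * inner x (f k)"
  unfolding fourier_sum_def by (rule inner_orthonormal_sum_member[OF assms])

lemma bounded_linear_fourier_sum: "bounded_linear (fourier_sum f J g)"
  unfolding fourier_sum_def[abs_def]
  by (intro bounded_linear_sum bounded_linear_scaleR_const bounded_linear_const_mult
        bounded_linear_inner_left)

lemmas linear_fourier_sum = bounded_linear.linear[OF bounded_linear_fourier_sum]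

lemma fourier_sum_symmetric: "inner (fourier_sum f J g x) y = inner x (fourier_sum f J g y)"
  unfolding fourier_sum_def inner_sum_left inner_sum_right
  by (intro sum.cong refl) (simp add: inner_commute)

lemma inner_fourier_sum:
  "inner (fourier_sum f J g x) y = (\<Sum>j\<in>J. g j * inner x (f j) * inner y (f j))"
  unfolding fourier_sum_def inner_sum_left
  by (intro sum.cong refl) (simp add: inner_commute)

lemma fourier_sum_compose:
  assumes "finite J" "orthonormal_family f J"
  shows "fourier_sum f J g (fourier_sum f J g' x) = fourier_sum f J (\<lambda>j. g j * g' j) x"
  unfolding fourier_sum_def[of f J g] fourier_sum_def[of f J "\<lambda>j. g j * g' j"]
  by (intro sum.cong) (simp_all add: inner_fourier_sum_member[OF assms] algebra_simps)

lemma fourier_sum_in_span: "fourier_sum f J g x \<in> span (f ` J)"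
  unfolding fourier_sum_def by (intro span_sum span_scale span_base) auto

lemma fourier_sum_span:
  assumes "finite J" "orthonormal_family f J" "x \<in> span (f ` J)"
  shows "fourier_sum f J (\<lambda>_. 1) x = x"
  using assms(3)
proof (induction rule: span_induct_alt)
  case base
  then show ?case by (simp add: fourier_sum_def)
next
  case (step c y z)
  then obtain k where k: "k \<in> J" "y = f k" by auto
  have "fourier_sum f J (\<lambda>_. 1) y = (\<Sum>j\<in>J. if j = k then f k else 0)"
    unfolding fourier_sum_def k using assms(2) k(1)
    by (intro sum.cong) (auto simp: orthonormal_family_def)
  then have "fourier_sum f J (\<lambda>_. 1) y = y"
    using k assms(1) by simp
  then show ?case
    using step by (simp add: linear_add[OF linear_fourier_sum] linear_scale[OF linear_fourier_sum])
qed

lemma bessel_inequality: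
  assumes "finite J" "orthonormal_family f J"
  shows "(\<Sum>j\<in>J. (inner x (f j))\<^sup>2) \<le> (norm x)\<^sup>2"
proof -
  let ?y = "\<Sum>j\<in>J. inner x (f j) *\<^sub>R f j"
  have "inner x ?y = (\<Sum>j\<in>J. (inner x (f j))\<^sup>2)"
    by (simp add: inner_sum_right power2_eq_square)
  moreover have "inner ?y ?y = (\<Sum>j\<in>J. (inner x (f j))\<^sup>2)"
    using norm_orthonormal_sum[OF assms, of "\<lambda>j. inner x (f j)"] by (simp add: power2_norm_eq_inner)
  moreover have "0 \<le> inner (x - ?y) (x - ?y)" by simp
  ultimately show ?thesis
    by (simp add: inner_diff_left inner_diff_right inner_commute power2_norm_eq_inner)
qed

lemma norm_fourier_sum_le:
  assumes "finite J" "orthonormal_family f J" "\<And>j. j \<in> J \<Longrightarrow> \<bar>g j\<bar> \<le> C" "0 \<le> C"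
  shows "norm (fourier_sum f J g x) \<le> C * norm x"
proof (rule power2_le_imp_le)
  have "(norm (fourier_sum f J g x))\<^sup>2 = (\<Sum>j\<in>J. (g j)\<^sup>2 * (inner x (f j))\<^sup>2)"
    unfolding fourier_sum_def norm_orthonormal_sum[OF assms(1,2)] by (simp add: power_mult_distrib)
  also have "\<dots> \<le> (\<Sum>j\<in>J. C\<^sup>2 * (inner x (f j))\<^sup>2)"
    using assms(3,4) by (intro sum_mono mult_right_mono) (auto simp: abs_le_square_iff[symmetric])
  also have "\<dots> \<le> C\<^sup>2 * (norm x)\<^sup>2"
    unfolding sum_distrib_left[symmetric] by (intro mult_left_mono bessel_inequality assms) auto
  finally show "(norm (fourier_sum f J g x))\<^sup>2 \<le> (C * norm x)\<^sup>2"
    by (simp add: power_mult_distrib)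
qed (use assms in auto)

text \<open>
  Square-summable coefficients make the partial sums Cauchy by Pythagoras.
\<close>

lemma orthonormal_series_summable:
  fixes e :: "nat \<Rightarrow> 'h::{real_inner, banach}"
  assumes "orthonormal_family e UNIV" "summable (\<lambda>k. (c k)\<^sup>2)"
  shows "summable (\<lambda>k. c k *\<^sub>R e k)"
  unfolding summable_Cauchy
proof (intro allI impI)
  fix r :: real assume "0 < r"
  then have "0 < r\<^sup>2" by simp
  then obtain N where N: "\<And>m n. m \<ge> N \<Longrightarrow> norm (sum (\<lambda>k. (c k)\<^sup>2) {m..<n}) < r\<^sup>2"
    using assms(2) unfolding summable_Cauchy by blast
  have "norm (\<Sum>k=m..<n. c k *\<^sub>R e k) < r" if "m \<ge> N" for m n
  proof (rule power2_less_imp_less)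
    have "orthonormal_family e {m..<n}" using assms(1) by (simp add: orthonormal_family_def)
    then have "(norm (\<Sum>k=m..<n. c k *\<^sub>R e k))\<^sup>2 = (\<Sum>k=m..<n. (c k)\<^sup>2)"
      by (intro norm_orthonormal_sum) auto
    also have "\<dots> < r\<^sup>2" using N[OF that, of n] by simp
    finally show "(norm (\<Sum>k=m..<n. c k *\<^sub>R e k))\<^sup>2 < r\<^sup>2" .
  qed (use \<open>0 < r\<close> in simp)
  then show "\<exists>N. \<forall>m\<ge>N. \<forall>n. norm (\<Sum>k=m..<n. c k *\<^sub>R e k) < r" by blast
qed

locale hilbert_basis =
  fixes e :: "nat \<Rightarrow> 'h::{real_inner, banach}"
  assumes orthonormal: "orthonormal_family e UNIV"
    and dense: "closure (span (range e)) = UNIV"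
begin

lemma orthonormal_on: "orthonormal_family e J"
  using orthonormal by (simp add: orthonormal_family_def)

abbreviation truncation :: "nat \<Rightarrow> 'h \<Rightarrow> 'h" where
  "truncation n \<equiv> fourier_sum e {..<n} (\<lambda>_. 1)"

lemma truncation_eventually_id:
  assumes "x \<in> span (range e)"
  shows "\<exists>N. \<forall>n\<ge>N. truncation n x = x"
  using assms
proof (induction rule: span_induct_alt)
  case base
  then show ?case by (simp add: fourier_sum_def)
next
  case (step c y z)
  then obtain N where N: "\<forall>n\<ge>N. truncation n z = z" by blast
  from step obtain k where k: "y = e k" by auto
  have "truncation n y = y" if "n \<ge> Suc k" for n
    unfolding k using that
    by (intro fourier_sum_span orthonormal_on span_base) auto
  with N have "\<forall>n\<ge>max N (Suc k). truncation n (c *\<^sub>R y + z) = c *\<^sub>R y + z"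
    by (simp add: linear_add[OF linear_fourier_sum] linear_scale[OF linear_fourier_sum])
  then show ?case by blast
qed

text \<open>
  Truncations are contractions and eventually the identity on a dense subspace.
\<close>

lemma truncation_tendsto: "(\<lambda>n. truncation n x) \<longlonglongrightarrow> x"
proof (rule LIMSEQ_I)
  fix r :: real assume "0 < r"
  obtain y where y: "y \<in> span (range e)" "dist y x < r / 3"
    using dense closure_approachable[of x "span (range e)"] \<open>0 < r\<close>
    by (metis UNIV_I divide_pos_pos zero_less_numeral)
  obtain N where N: "\<forall>n\<ge>N. truncation n y = y" using truncation_eventually_id[OF y(1)] by blast
  have "norm (truncation n x - x) < r" if "n \<ge> N" for n
  proof -
    have "truncation n x - x = truncation n (x - y) + (y - x)"
      using N that by (simp add: linear_diff[OF linear_fourier_sum])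
    then have "norm (truncation n x - x) \<le> norm (truncation n (x - y)) + norm (y - x)"
      by (metis norm_triangle_ineq)
    also have "\<dots> \<le> 1 * norm (x - y) + norm (y - x)"
      by (intro add_right_mono norm_fourier_sum_le orthonormal_on) auto
    also have "\<dots> < r" using y(2) \<open>0 < r\<close> by (simp add: dist_norm norm_minus_commute)
    finally show ?thesis .
  qed
  then show "\<exists>N. \<forall>n\<ge>N. norm (truncation n x - x) < r" by blast
qed

lemma parseval: "(\<lambda>k. (inner x (e k))\<^sup>2) sums (norm x)\<^sup>2"
proof -
  have "(\<lambda>n. (norm (truncation n x))\<^sup>2) \<longlonglongrightarrow> (norm x)\<^sup>2"
    by (intro tendsto_intros truncation_tendsto)
  then show ?thesis
    unfolding sums_def fourier_sum_def by (simp add: norm_orthonormal_sum[OF _ orthonormal_on])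
qed

lemma eq_0_if_coefficients_0:
  assumes "\<And>k. inner x (e k) = 0"
  shows "x = 0"
  using parseval[of x] assms by (simp add: sums_iff)

end

text \<open>
  The representing vector is the minimizer of \<open>(norm u)\<^sup>2 / 2 - g u\<close>.  A minimizing sequence is Cauchy by the
  parallelogram law, and the first-order condition at the minimum is the representation.
\<close>

lemma riesz_representation:
  fixes g :: "'u::{real_inner, banach} \<Rightarrow> real"
  assumes "bounded_linear g"
  shows "\<exists>b. \<forall>u. g u = inner u b"
proof -
  interpret bounded_linear g by fact
  obtain K where K: "\<And>u. norm (g u) \<le> norm u * K" "0 < K" using pos_bounded by blast
  define J where "J u = (norm u)\<^sup>2 / 2 - g u" for u
  have J_lower: "- (K\<^sup>2 / 2) \<le> J u" for u
  proof -
    have "g u \<le> norm u * K" using K(1)[of u] by simp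
    moreover have "0 \<le> (norm u - K)\<^sup>2" by simp
    ultimately show ?thesis unfolding J_def by (simp add: power2_eq_square algebra_simps)
  qed
  \<comment> \<open>\<open>J\<close> is bounded below, so minimizing sequences exist.\<close>
  define m where "m = Inf (range J)"
  have bdd: "bdd_below (range J)" using J_lower by (meson bdd_below.I2)
  have m_le: "m \<le> J u" for u unfolding m_def using bdd by (intro cInf_lower) auto
  define a where "a n = 1 / real (Suc n)" for n
  have a_pos: "0 < a n" for n by (simp add: a_def)
  have "\<exists>u. J u < m + a n" for n
    using cInf_lessD[of "range J" "m + a n"] a_pos[of n] unfolding m_def by auto
  then obtain v where v: "\<And>n. J (v n) < m + a n" by metis
  have parallelogram: "(norm (x - y))\<^sup>2 = 4 * (J x + J y - 2 * J ((1/2) *\<^sub>R (x + y)))" for x y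
    unfolding J_def scale add
    by (simp add: power2_norm_eq_inner inner_diff_left inner_diff_right inner_add_left
        inner_add_right inner_commute field_simps)
  have dist_v: "(norm (v i - v j))\<^sup>2 \<le> 4 * (a i + a j)" for i j
    unfolding parallelogram using v[of i] v[of j] m_le[of "(1/2) *\<^sub>R (v i + v j)"] by simp
  have "Cauchy v"
  proof (rule metric_CauchyI)
    fix r :: real assume "0 < r"
    obtain N where N: "a N < r\<^sup>2 / 8"
      using nat_approx_posE[of "r\<^sup>2 / 8"] \<open>0 < r\<close> unfolding a_def
      by (metis divide_pos_pos zero_less_numeral zero_less_power)
    have "dist (v i) (v j) < r" if "i \<ge> N" "j \<ge> N" for i j
    proof -
      have "a i \<le> a N" "a j \<le> a N"
        using that by (auto simp: a_def intro!: divide_left_mono)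
      then have "4 * (a i + a j) < r\<^sup>2" using N by argo
      then have "(norm (v i - v j))\<^sup>2 < r\<^sup>2" by (rule le_less_trans[OF dist_v])
      then show ?thesis
        unfolding dist_norm by (rule power2_less_imp_less) (use \<open>0 < r\<close> in simp)
    qed
    then show "\<exists>N. \<forall>m\<ge>N. \<forall>n\<ge>N. dist (v m) (v n) < r" by blast
  qed
  then obtain b where b: "v \<longlonglongrightarrow> b" by (meson Cauchy_convergent_iff convergent_def)
  have "(\<lambda>n. J (v n)) \<longlonglongrightarrow> J b"
    unfolding J_def by (intro tendsto_intros b tendsto) auto
  moreover have "(\<lambda>n. m + a n) \<longlonglongrightarrow> m + 0"
    unfolding a_def by (intro tendsto_add tendsto_const LIMSEQ_Suc[OF lim_1_over_n])
  ultimately have "J b \<le> m + 0"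
    by (rule LIMSEQ_le) (use v in \<open>auto intro: less_imp_le\<close>)
  then have min: "J b \<le> J u" for u using m_le[of u] by simp
  have "g u = inner u b" for u
  proof (cases "u = 0")
    case False
    define t where "t = (g u - inner u b) / (norm u)\<^sup>2"
    have nz: "(norm u)\<^sup>2 \<noteq> 0" using False by simp
    have "J (b + t *\<^sub>R u) - J b = t\<^sup>2 * (norm u)\<^sup>2 / 2 - t * (g u - inner u b)"
      unfolding J_def scale add power2_norm_eq_inner
      by (simp add: inner_add_left inner_add_right inner_commute power2_eq_square algebra_simps)
    also have "\<dots> = - ((g u - inner u b)\<^sup>2 / (2 * (norm u)\<^sup>2))"
      unfolding t_def using nz by (simp add: field_simps power2_eq_square)
    finally have "(g u - inner u b)\<^sup>2 / (2 * (norm u)\<^sup>2) \<le> 0" using min[of "b + t *\<^sub>R u"] by simp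
    moreover have "0 < 2 * (norm u)\<^sup>2" using False by simp
    ultimately have "(g u - inner u b)\<^sup>2 \<le> 0" by (simp add: divide_le_0_iff)
    then show ?thesis by simp
  qed (simp add: zero)
  then show ?thesis by blast
qed

section \<open>Diagonalization of a quadratic form on a finite-dimensional space\<close>

lemma orthonormal_basis_exists:
  fixes B :: "'h::real_inner set"
  assumes "finite B"
  shows "\<exists>E. finite E \<and> card E \<le> card B \<and> span E = span B \<and> orthonormal_family (\<lambda>x. x) E"
proof -
  obtain C where C: "finite C" "card C \<le> card B" "span C = span B" "pairwise orthogonal C"
    using basis_orthogonal[OF assms] by blast
  define E where "E = (\<lambda>c. c /\<^sub>R norm c) ` (C - {0})"
  have "card E \<le> card C"
    unfolding E_def using C(1) by (meson Diff_subset card_image_le card_mono finite_Diff order_trans)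
  moreover have "span E = span C"
  proof
    show "span E \<subseteq> span C"
      unfolding E_def by (rule span_minimal) (auto intro: span_scale span_base)
    have "c \<in> span E" if "c \<in> C" for c
    proof (cases "c = 0")
      case False
      then have "c /\<^sub>R norm c \<in> span E" using that by (auto simp: E_def intro: span_base)
      then have "norm c *\<^sub>R (c /\<^sub>R norm c) \<in> span E" by (rule span_scale)
      then show ?thesis using False by simp
    qed (simp add: span_zero)
    then show "span C \<subseteq> span E" by (intro span_minimal) auto
  qed
  moreover have "orthonormal_family (\<lambda>x. x) E"
    unfolding orthonormal_family_def
  proof (intro ballI)
    fix x y assume "x \<in> E" "y \<in> E"
    then obtain c d where cd: "c \<in> C" "c \<noteq> 0" "x = c /\<^sub>R norm c" "d \<in> C" "d \<noteq> 0" "y = d /\<^sub>R norm d"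
      unfolding E_def by blast
    show "inner x y = (if x = y then 1 else 0)"
    proof (cases "c = d")
      case True
      then show ?thesis using cd by (simp add: dot_square_norm power2_eq_square)
    next
      case False
      then have "inner x y = 0" using C(4) cd by (simp add: pairwise_def orthogonal_def)
      moreover have "x \<noteq> 0" using cd by simp
      ultimately show ?thesis by auto
    qed
  qed
  moreover have "finite E" unfolding E_def using C(1) by simp
  ultimately have "finite E \<and> card E \<le> card B \<and> span E = span B \<and> orthonormal_family (\<lambda>x. x) E"
    using C(2,3) by simp
  then show ?thesis by (rule exI)
qed

text \<open>
  In an infinite-dimensional space bounded closed sets need not be compact; inside a finite-dimensional
  subspace compactness is inherited from the coefficient cube.
\<close>

lemma compact_unit_cube:
  fixes E :: "'h::real_normed_vector set"
  assumes "finite E"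
  shows "compact {\<Sum>x\<in>E. c x *\<^sub>R x | c. \<forall>x\<in>E. \<bar>c x\<bar> \<le> (1::real)}"
  using assms
proof (induction E rule: finite_induct)
  case empty
  then show ?case by simp
next
  case (insert b E)
  let ?S = "\<lambda>E. {\<Sum>x\<in>E. c x *\<^sub>R x | c. \<forall>x\<in>E. \<bar>c x\<bar> \<le> (1::real)}"
  have "?S (insert b E) = (\<lambda>(x, t). t *\<^sub>R b + x) ` (?S E \<times> {-1..1})" (is "?L = ?R")
  proof (intro set_eqI iffI)
    fix y assume "y \<in> ?L"
    then obtain c where c: "y = (\<Sum>x\<in>insert b E. c x *\<^sub>R x)" "\<forall>x\<in>insert b E. \<bar>c x\<bar> \<le> 1" by blast
    then have "y = c b *\<^sub>R b + (\<Sum>x\<in>E. c x *\<^sub>R x)" using insert by simp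
    then have "y = (\<lambda>(x, t). t *\<^sub>R b + x) (\<Sum>x\<in>E. c x *\<^sub>R x, c b)" by simp
    moreover have "(\<Sum>x\<in>E. c x *\<^sub>R x, c b) \<in> ?S E \<times> {-1..1}"
      using c(2) by (auto simp: abs_le_iff)
    ultimately show "y \<in> ?R" by (rule image_eqI)
  next
    fix y assume "y \<in> ?R"
    then obtain c t where c: "y = t *\<^sub>R b + (\<Sum>x\<in>E. c x *\<^sub>R x)" "\<forall>x\<in>E. \<bar>c x\<bar> \<le> 1" "-1 \<le> t" "t \<le> 1"
      by auto
    have "(\<Sum>x\<in>E. (c(b := t)) x *\<^sub>R x) = (\<Sum>x\<in>E. c x *\<^sub>R x)"
      using insert.hyps by (intro sum.cong) auto
    then have "y = (\<Sum>x\<in>insert b E. (c(b := t)) x *\<^sub>R x)"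
      using insert.hyps c(1) by (simp del: fun_upd_apply) simp
    moreover have "\<forall>x\<in>insert b E. \<bar>(c(b := t)) x\<bar> \<le> 1" using c by auto
    ultimately show "y \<in> ?L" by blast
  qed
  moreover have "compact ?R"
    by (intro compact_continuous_image compact_Times insert.IH)
      (auto simp: case_prod_beta intro!: continuous_intros)
  ultimately show ?case by simp
qed

text \<open>
  The spectral theorem for a symmetric form on a subspace.  A maximizer \<open>g\<close> of the form on the unit sphere
  is \<open>a\<close>-orthogonal to every vector of the subspace that is orthogonal to \<open>g\<close>.  Projecting a spanning set
  onto the complement of \<open>g\<close> and dropping one vector from it gives a smaller spanning set, to which the
  induction hypothesis applies.
\<close>

lemma finite_dim_diagonalization:
  fixes a :: "'h::real_inner \<Rightarrow> 'h \<Rightarrow> real"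
  assumes "finite B"
    and "\<And>x y z. x \<in> span B \<Longrightarrow> y \<in> span B \<Longrightarrow> z \<in> span B \<Longrightarrow> a (x + y) z = a x z + a y z"
    and "\<And>c x z. x \<in> span B \<Longrightarrow> z \<in> span B \<Longrightarrow> a (c *\<^sub>R x) z = c * a x z"
    and "\<And>x z. x \<in> span B \<Longrightarrow> z \<in> span B \<Longrightarrow> a x z = a z x"
  shows "\<exists>G. finite G \<and> span G = span B \<and> orthonormal_family (\<lambda>x. x) G \<and>
    (\<forall>g\<in>G. \<forall>h\<in>G. g \<noteq> h \<longrightarrow> a g h = 0)"
  using assms
proof (induction "card B" arbitrary: B rule: less_induct)
  case less
  obtain E where E: "finite E" "card E \<le> card B" "span E = span B" "orthonormal_family (\<lambda>x. x) E"
    using orthonormal_basis_exists[OF less.prems(1)] by blast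
  note add = less.prems(2)[folded E(3)] and scale = less.prems(3)[folded E(3)]
    and sym = less.prems(4)[folded E(3)]
  have add_right: "a z (x + y) = a z x + a z y"
    if "x \<in> span E" "y \<in> span E" "z \<in> span E" for x y z
    using add[OF that] sym that by (simp add: span_add)
  have scale_right: "a z (c *\<^sub>R x) = c * a z x" if "x \<in> span E" "z \<in> span E" for c x z
    using scale[OF that] sym that by (simp add: span_scale)
  show ?case
  proof (cases "E = {}")
    case True
    then show ?thesis using E(3) by (intro exI[of _ "{}"]) (auto simp: orthonormal_family_def)
  next
    case False
    let ?U = "{x \<in> span E. norm x = 1}"
    have coord: "(\<Sum>v\<in>E. inner x v *\<^sub>R v) = x" if "x \<in> span E" for x
      using fourier_sum_span[OF E(1,4), of x] that by (simp add: fourier_sum_def)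
    have a_sum: "a (\<Sum>v\<in>F. c v *\<^sub>R v) z = (\<Sum>v\<in>F. c v * a v z)"
      if "F \<subseteq> E" "z \<in> span E" for F c z
      using finite_subset[OF that(1) E(1)] that(1)
    proof (induction F rule: finite_induct)
      case empty
      show ?case using scale[of 0 z 0] that by (simp add: span_zero)
    next
      case (insert v F)
      then show ?case using that by (simp add: add scale span_sum span_scale span_base subset_iff)
    qed
    have q_expand: "a x x = (\<Sum>v\<in>E. inner x v * (\<Sum>w\<in>E. inner x w * a w v))" if "x \<in> span E" for x
    proof -
      have "a x x = (\<Sum>v\<in>E. inner x v * a v x)"
        using a_sum[of E x "\<lambda>v. inner x v"] that by (simp add: coord)
      also have "\<dots> = (\<Sum>v\<in>E. inner x v * a x v)"
        by (intro sum.cong) (auto simp: sym span_base that)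
      also have "\<dots> = (\<Sum>v\<in>E. inner x v * (\<Sum>w\<in>E. inner x w * a w v))"
        using a_sum[of E _ "\<lambda>v. inner x v"] that by (intro sum.cong) (auto simp: coord span_base)
      finally show ?thesis .
    qed
    have cont: "continuous_on ?U (\<lambda>x. a x x)"
      by (subst continuous_on_cong[OF refl q_expand]) (auto intro!: continuous_intros)
    have "?U = {\<Sum>x\<in>E. c x *\<^sub>R x | c. \<forall>x\<in>E. \<bar>c x\<bar> \<le> 1} \<inter> sphere 0 1" (is "_ = ?S \<inter> _")
    proof (intro set_eqI iffI)
      fix x assume x: "x \<in> ?U"
      have "\<bar>inner x v\<bar> \<le> 1" if "v \<in> E" for v
        using Cauchy_Schwarz_ineq2[of x v] x that E(4)
        by (auto simp: orthonormal_family_def norm_eq_sqrt_inner)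
      then show "x \<in> ?S \<inter> sphere 0 1" using x coord[of x] by (auto intro!: exI[of _ "\<lambda>v. inner x v"])
    next
      fix x assume "x \<in> ?S \<inter> sphere 0 1"
      then show "x \<in> ?U" by (auto intro!: span_sum span_scale intro: span_base)
    qed
    moreover have closed_unit_sphere: "closed (sphere (0::'h) 1)"
    proof -
      have "sphere (0::'h) 1 = {x. norm x = 1}" by auto
      then show ?thesis by (simp add: closed_Collect_eq continuous_on_norm_id)
    qed
    ultimately have "compact ?U"
      using compact_Int_closed[OF compact_unit_cube[OF E(1)], of "sphere 0 1"] closed_unit_sphere
      by (simp only:)
    moreover have "?U \<noteq> {}"
    proof -
      obtain v where "v \<in> E" using False by blast
      then have "inner v v = 1" using E(4) unfolding orthonormal_family_def by fastforce
      then have "v \<in> ?U" using \<open>v \<in> E\<close> by (auto simp: norm_eq_1 intro: span_base)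
      then show ?thesis by blast
    qed
    ultimately obtain g where g: "g \<in> ?U" "\<And>x. x \<in> ?U \<Longrightarrow> a x x \<le> a g g"
      using continuous_attains_sup[OF _ _ cont] by blast
    have gs: "g \<in> span E" "norm g = 1" "inner g g = 1"
      using g(1) by (auto simp: norm_eq_1)
    have quadratic: "a x x \<le> a g g * (norm x)\<^sup>2" if "x \<in> span E" for x
    proof (cases "x = 0")
      case True
      then show ?thesis using scale[of 0 0 0] by (simp add: span_zero)
    next
      case False
      have "a (x /\<^sub>R norm x) (x /\<^sub>R norm x) \<le> a g g"
        using False that by (intro g(2)) (auto intro: span_scale)
      then have "a x x / (norm x)\<^sup>2 \<le> a g g"
        using that by (simp add: scale scale_right span_scale power2_eq_square divide_inverse mult_ac)
      then show ?thesis using False by (simp add: pos_divide_le_eq)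
    qed
    \<comment> \<open>First-order condition: \<open>t\<close> is of the order of \<open>a g z\<close>, so the linear term would beat the quadratic one.\<close>
    have crit: "a g z = 0" if z: "z \<in> span E" "inner g z = 0" for z
    proof -
      define c where "c = a g g * (norm z)\<^sup>2 - a z z"
      have c: "0 \<le> c" unfolding c_def using quadratic[OF z(1)] by simp
      define t where "t = a g z / (c + 1)"
      have tz: "t *\<^sub>R z \<in> span E" using z by (simp add: span_scale)
      have eq1: "a (g + t *\<^sub>R z) (g + t *\<^sub>R z) = a g g + 2 * t * a g z + t\<^sup>2 * a z z"
        using gs z tz sym[of z g]
        by (simp add: add add_right scale scale_right span_add power2_eq_square algebra_simps)
      have eq2: "(norm (g + t *\<^sub>R z))\<^sup>2 = 1 + t\<^sup>2 * (norm z)\<^sup>2"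
        unfolding power2_norm_eq_inner using gs(3) z(2)
        by (simp add: inner_add_left inner_add_right inner_commute power2_eq_square)
      have "a (g + t *\<^sub>R z) (g + t *\<^sub>R z) \<le> a g g * (norm (g + t *\<^sub>R z))\<^sup>2"
        by (intro quadratic span_add gs tz)
      then have "a g g + 2 * t * a g z + t\<^sup>2 * a z z \<le> a g g * (1 + t\<^sup>2 * (norm z)\<^sup>2)"
        unfolding eq1 eq2 .
      then have "2 * t * a g z \<le> t\<^sup>2 * c" unfolding c_def by (simp add: algebra_simps)
      moreover have "t * (c + 1) = a g z" unfolding t_def using c by simp
      ultimately have "2 * t * (t * (c + 1)) \<le> t\<^sup>2 * c" by simp
      then have "t\<^sup>2 * (c + 2) \<le> 0" by (simp add: power2_eq_square algebra_simps)
      then have "t = 0" using c by (simp add: mult_le_0_iff)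
      then show ?thesis using \<open>t * (c + 1) = a g z\<close> by simp
    qed
    \<comment> \<open>Exchange step: \<open>b\<close> can be recovered from \<open>g\<close> and the other basis vectors.\<close>
    obtain b where b: "b \<in> E" "inner g b \<noteq> 0"
      using coord[OF gs(1)] gs(2) by (metis (no_types, lifting) norm_zero scaleR_eq_0_iff sum.neutral zero_neq_one)
    define P where "P x = x - inner x g *\<^sub>R g" for x
    have P_span: "P x \<in> span E" if "x \<in> span E" for x
      unfolding P_def using that gs by (intro span_diff span_scale)
    have P_orth: "inner g (P x) = 0" for x
      unfolding P_def by (simp add: inner_diff_right gs(3) inner_commute[of g x])
    let ?B' = "P ` (E - {b})"
    have B'_sub: "span ?B' \<subseteq> span E"
      using P_span span_base by (intro span_minimal subspace_span) blast
    have card: "card ?B' < card B"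
    proof -
      have "card ?B' \<le> card (E - {b})" using E(1) by (intro card_image_le) auto
      also have "\<dots> < card E" using E(1) b(1) by (rule card_Diff1_less)
      finally show ?thesis using E(2) by simp
    qed
    have "\<exists>G. finite G \<and> span G = span ?B' \<and> orthonormal_family (\<lambda>x. x) G \<and>
        (\<forall>g\<in>G. \<forall>h\<in>G. g \<noteq> h \<longrightarrow> a g h = 0)"
    proof (rule less.hyps[OF card])
      note sub = subsetD[OF B'_sub]
      show "finite ?B'" using E(1) by simp
      show "a (x + y) z = a x z + a y z" if "x \<in> span ?B'" "y \<in> span ?B'" "z \<in> span ?B'" for x y z
        by (rule add[OF sub sub sub, OF that])
      show "a (c *\<^sub>R x) z = c * a x z" if "x \<in> span ?B'" "z \<in> span ?B'" for c x z
        by (rule scale[OF sub sub, OF that])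
      show "a x z = a z x" if "x \<in> span ?B'" "z \<in> span ?B'" for x z
        by (rule sym[OF sub sub, OF that])
    qed
    then obtain G where G: "finite G" "span G = span ?B'" "orthonormal_family (\<lambda>x. x) G"
      "\<forall>g\<in>G. \<forall>h\<in>G. g \<noteq> h \<longrightarrow> a g h = 0" by blast
    have G_E: "x \<in> span E" if "x \<in> G" for x
      using that G(2) B'_sub span_base by blast
    have "span ?B' \<subseteq> {x. inner g x = 0}"
      by (intro span_minimal subspace_hyperplane) (auto simp: P_orth)
    then have G_orth: "inner g x = 0" if "x \<in> G" for x
      using that G(2) span_base by blast
    have "span (insert g G) = span E"
    proof
      show "span (insert g G) \<subseteq> span E"
        using G_E gs by (intro span_minimal) auto
      have rest: "x \<in> span (insert g G)" if "x \<in> E - {b}" for x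
      proof -
        have "P x \<in> span G" unfolding G(2) using that by (intro span_base) auto
        then have "P x \<in> span (insert g G)" by (rule subsetD[OF span_mono[OF subset_insertI]])
        then have "P x + inner x g *\<^sub>R g \<in> span (insert g G)"
          by (intro span_add span_scale span_base[OF insertI1])
        then show ?thesis by (simp add: P_def)
      qed
      have "g = inner g b *\<^sub>R b + (\<Sum>v\<in>E - {b}. inner g v *\<^sub>R v)"
        by (rule trans[OF coord[OF gs(1), symmetric] sum.remove[OF E(1) b(1)]])
      then have "g - (\<Sum>v\<in>E - {b}. inner g v *\<^sub>R v) = inner g b *\<^sub>R b"
        by (rule diff_eq_eq[THEN iffD2])
      then have "b = (1 / inner g b) *\<^sub>R (g - (\<Sum>v\<in>E - {b}. inner g v *\<^sub>R v))"
        using b(2) by (simp only:) simp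
      moreover have "(1 / inner g b) *\<^sub>R (g - (\<Sum>v\<in>E - {b}. inner g v *\<^sub>R v)) \<in> span (insert g G)"
        by (intro span_scale span_diff span_sum rest span_base insertI1)
      ultimately have "b \<in> span (insert g G)" by simp
      then show "span E \<subseteq> span (insert g G)"
        using rest by (intro span_minimal) auto
    qed
    moreover have "orthonormal_family (\<lambda>x. x) (insert g G)"
    proof -
      have "g \<notin> G" using G_orth[of g] gs(3) by auto
      moreover have "inner x g = 0" if "x \<in> G" for x using G_orth[OF that] by (simp add: inner_commute)
      ultimately show ?thesis using G(3) G_orth gs(3)
        unfolding orthonormal_family_def by (metis insert_iff)
    qed
    moreover have "\<forall>x\<in>insert g G. \<forall>y\<in>insert g G. x \<noteq> y \<longrightarrow> a x y = 0"
    proof -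
      have "a g y = 0" "a y g = 0" if "y \<in> G" for y
        using crit[OF G_E[OF that] G_orth[OF that]] sym[OF G_E[OF that] gs(1)] by auto
      then show ?thesis using G(4) by (metis insert_iff)
    qed
    moreover have "finite (insert g G)" using G(1) by simp
    ultimately have "finite (insert g G) \<and> span (insert g G) = span B \<and>
        orthonormal_family (\<lambda>x. x) (insert g G) \<and>
        (\<forall>x\<in>insert g G. \<forall>y\<in>insert g G. x \<noteq> y \<longrightarrow> a x y = 0)"
      unfolding E(3) by (intro conjI)
    then show ?thesis by (rule exI)
  qed
qed

section \<open>The error estimate for nonsmooth data in spectral form\<close>

lemma fourier_sum_has_vector_derivative:
  assumes "finite J"
    and "\<And>j. j \<in> J \<Longrightarrow> ((\<lambda>s. g s j) has_real_derivative g' j) (at s)"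
  shows "((\<lambda>s. fourier_sum f J (g s) x) has_vector_derivative fourier_sum f J g' x) (at s)"
  unfolding fourier_sum_def
proof (rule has_vector_derivative_sum)
  fix j assume "j \<in> J"
  have "((\<lambda>s. (g s j * inner x (f j)) *\<^sub>R f j) has_vector_derivative
      ((g' j * inner x (f j)) *\<^sub>R f j)) (at s)"
    using has_vector_derivative_scaleR[OF DERIV_cmult_right[OF assms(2)[OF \<open>j \<in> J\<close>], of "inner x (f j)"]
        has_vector_derivative_const, of "f j"]
    by (simp add: mult.commute)
  then show "((\<lambda>s. (g s j * inner x (f j)) *\<^sub>R f j) has_vector_derivative
      (g' j * inner x (f j)) *\<^sub>R f j) (at s)" .
qed

text \<open>
  These are the smoothing bounds \<open>A e\<^sup>-\<^sup>t\<^sup>A \<le> 1 / t\<close> and \<open>A\<^sup>2 e\<^sup>-\<^sup>t\<^sup>A \<le> 1 / t\<^sup>2\<close> on a single eigenvalue.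
\<close>

lemma mult_exp_minus_le:
  fixes y :: real
  assumes "0 < t" "0 \<le> y"
  shows "y * exp (- (t * y)) \<le> 1 / t" and "y\<^sup>2 * exp (- (t * y)) \<le> 1 / t\<^sup>2"
proof -
  have ge: "1 + z + z\<^sup>2 / 2 \<le> exp z" if "0 \<le> z" for z :: real
    using exp_lower_Taylor_quadratic[OF that] .
  have "t * y \<le> exp (t * y)" using exp_ge_add_one_self[of "t * y"] by linarith
  then show "y * exp (- (t * y)) \<le> 1 / t"
    using assms by (simp add: exp_minus field_simps)
  have "2 * z \<le> exp z" if "0 \<le> z" for z :: real
  proof -
    have "0 \<le> (z - 1)\<^sup>2" by simp
    then show ?thesis using ge[OF that] by (simp add: power2_eq_square algebra_simps)
  qed
  from this[of "t * y / 2"] have "t * y \<le> exp (t * y / 2)" using assms by simp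
  then have "(t * y)\<^sup>2 \<le> (exp (t * y / 2))\<^sup>2" using assms by (intro power_mono) auto
  also have "\<dots> = exp (t * y)" by (simp add: power2_eq_square exp_add[symmetric])
  finally have "t\<^sup>2 * y\<^sup>2 \<le> exp (t * y)" by (simp add: power_mult_distrib)
  then show "y\<^sup>2 * exp (- (t * y)) \<le> 1 / t\<^sup>2"
    using assms by (simp add: exp_minus field_simps)
qed

lemma abs_diff_le_of_derivative_bound:
  fixes \<Phi> :: "real \<Rightarrow> real"
  assumes "a < b" "\<And>s. (\<Phi> has_real_derivative \<Phi>' s) (at s)"
    and "\<And>s. a \<le> s \<Longrightarrow> s \<le> b \<Longrightarrow> \<bar>\<Phi>' s\<bar> \<le> c"
  shows "\<bar>\<Phi> b - \<Phi> a\<bar> \<le> (b - a) * c"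
proof -
  obtain z where z: "z > a" "z < b" "\<Phi> b - \<Phi> a = (b - a) * \<Phi>' z"
    using MVT2[OF assms(1), of \<Phi> \<Phi>'] assms(2) by blast
  show ?thesis
    unfolding z(3) abs_mult using z assms(1) by (intro mult_mono assms(3)) auto
qed

text \<open>
  Let \<open>W\<close> be the difference of the two inverse operators, \<open>a(s) = e\<^bsup>-(t-s)B\<^esup> v\<close> and \<open>b(s) = e\<^bsup>-sA\<^esup> x\<close>.  The left
  side is the increment of \<open>\<langle>a, b\<rangle>\<close> over \<open>[0, t]\<close>, and \<open>\<langle>a, b\<rangle>' = \<langle>a', W b'\<rangle>\<close>.  Here \<open>a'\<close> is of size
  \<open>1 / (t - s)\<close> and \<open>b'\<close> of size \<open>1 / s\<close>, so that neither factor may keep its derivative near its own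
  singular endpoint: on the left half the derivative is moved from \<open>b\<close> to \<open>a\<close>, on the right half from
  \<open>a\<close> to \<open>b\<close>.  Boundary terms and remaining second derivatives are all of size \<open>\<delta> / t\<close>.
\<close>

lemma nonsmooth_data_pairing:
  fixes f :: "'i \<Rightarrow> 'h::real_inner" and e :: "'k \<Rightarrow> 'h"
  assumes J: "finite J" "orthonormal_family f J" "\<And>j. j \<in> J \<Longrightarrow> 0 < \<mu> j"
    and K: "finite K" "orthonormal_family e K" "\<And>k. k \<in> K \<Longrightarrow> 0 < lam k"
    and close: "\<And>z. z \<in> span (e ` K) \<Longrightarrow>
      norm (fourier_sum f J (\<lambda>j. 1 / \<mu> j) z - fourier_sum e K (\<lambda>k. 1 / lam k) z) \<le> \<delta> * norm z"
    and "0 \<le> \<delta>" "0 < t"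
  shows "\<bar>inner (fourier_sum f J (\<lambda>_. 1) v) (fourier_sum e K (\<lambda>k. exp (- (t * lam k))) x)
      - inner (fourier_sum f J (\<lambda>j. exp (- (t * \<mu> j))) v) (fourier_sum e K (\<lambda>_. 1) x)\<bar>
    \<le> 12 * \<delta> / t * norm v * norm x"
proof -
  define W where "W z = fourier_sum f J (\<lambda>j. 1 / \<mu> j) z - fourier_sum e K (\<lambda>k. 1 / lam k) z" for z
  \<comment> \<open>The index \<open>m\<close> counts derivatives in \<open>s\<close>.\<close>
  define a where "a m s = fourier_sum f J (\<lambda>j. \<mu> j ^ m * exp (- ((t - s) * \<mu> j))) v" for m :: nat and s
  define b where "b m s = fourier_sum e K (\<lambda>k. (- lam k) ^ m * exp (- (s * lam k))) x" for m :: nat and s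
  have W_lin: "bounded_linear W"
    unfolding W_def[abs_def] by (intro bounded_linear_sub bounded_linear_fourier_sum)
  have a_deriv: "(a m has_vector_derivative a (Suc m) s) (at s)" for m s
    unfolding a_def[abs_def]
    by (rule fourier_sum_has_vector_derivative[OF J(1)]) (auto intro!: derivative_eq_intros)
  have b_deriv: "(b m has_vector_derivative b (Suc m) s) (at s)" for m s
    unfolding b_def[abs_def]
    by (rule fourier_sum_has_vector_derivative[OF K(1)]) (auto intro!: derivative_eq_intros)
  have Wb_deriv: "((\<lambda>s. W (b m s)) has_vector_derivative W (b (Suc m) s)) (at s)" for m s
    by (rule bounded_linear.has_vector_derivative[OF W_lin b_deriv])
  have product: "((\<lambda>s. inner (p s) (q s)) has_real_derivative inner (p s) q' + inner p' (q s)) (at s)"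
    if "(p has_vector_derivative p') (at s)" "(q has_vector_derivative q') (at s)"
    for p q :: "real \<Rightarrow> 'h" and p' q' s
    using bounded_bilinear.has_vector_derivative[OF bounded_bilinear_inner that]
    by (simp add: has_real_derivative_iff_has_vector_derivative)
  have key: "inner (a 0 s) (b 1 s) + inner (a 1 s) (b 0 s) = inner (a 1 s) (W (b 1 s))" for s
  proof -
    have "fourier_sum f J (\<lambda>j. 1 / \<mu> j) (a 1 s) = a 0 s"
      unfolding a_def fourier_sum_compose[OF J(1,2)] unfolding fourier_sum_def
      by (intro sum.cong) (auto dest: J(3))
    moreover have "fourier_sum e K (\<lambda>k. 1 / lam k) (b 1 s) = - b 0 s"
      unfolding b_def fourier_sum_compose[OF K(1,2)] unfolding fourier_sum_def sum_negf[symmetric]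
      by (intro sum.cong) (auto dest: K(3))
    ultimately show ?thesis
      unfolding W_def inner_diff_right by (simp add: fourier_sum_symmetric[symmetric])
  qed
  have b_span: "b m s \<in> span (e ` K)" for m s unfolding b_def by (rule fourier_sum_in_span)
  have a_bound: "norm (a m s) \<le> C * norm v"
    if "\<And>y. 0 < y \<Longrightarrow> y ^ m * exp (- ((t - s) * y)) \<le> C" "0 \<le> C" for m s C
    unfolding a_def
  proof (rule norm_fourier_sum_le[OF J(1,2) _ that(2)])
    fix j assume "j \<in> J"
    then have "0 < \<mu> j" by (rule J(3))
    then show "\<bar>\<mu> j ^ m * exp (- ((t - s) * \<mu> j))\<bar> \<le> C"
      using that(1) by (simp add: abs_mult power_abs)
  qed
  have Wb_bound: "norm (W (b m s)) \<le> \<delta> * (C * norm x)"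
    if "\<And>y. 0 < y \<Longrightarrow> y ^ m * exp (- (s * y)) \<le> C" "0 \<le> C" for m s C
  proof -
    have "norm (b m s) \<le> C * norm x"
      unfolding b_def
    proof (rule norm_fourier_sum_le[OF K(1,2) _ that(2)])
      fix k assume "k \<in> K"
      then have "0 < lam k" by (rule K(3))
      then show "\<bar>(- lam k) ^ m * exp (- (s * lam k))\<bar> \<le> C"
        using that(1) by (simp add: abs_mult power_abs)
    qed
    then have "\<delta> * norm (b m s) \<le> \<delta> * (C * norm x)" using \<open>0 \<le> \<delta>\<close> by (rule mult_left_mono)
    then show ?thesis using close[OF b_span[of m s]] unfolding W_def by linarith
  qed
  have pair: "\<bar>inner (a m s) (W (b l s))\<bar> \<le> C * D * (\<delta> * norm v * norm x)"
    if "\<And>y. 0 < y \<Longrightarrow> y ^ m * exp (- ((t - s) * y)) \<le> C"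
      "\<And>y. 0 < y \<Longrightarrow> y ^ l * exp (- (s * y)) \<le> D" "0 \<le> C" "0 \<le> D" for m l s C D
  proof -
    have "\<bar>inner (a m s) (W (b l s))\<bar> \<le> norm (a m s) * norm (W (b l s))"
      by (rule Cauchy_Schwarz_ineq2)
    also have "\<dots> \<le> (C * norm v) * (\<delta> * (D * norm x))"
      using that \<open>0 \<le> \<delta>\<close> by (intro mult_mono a_bound Wb_bound) auto
    finally show ?thesis by (simp add: mult_ac)
  qed
  let ?n = "\<delta> * norm v * norm x"
  have n0: "0 \<le> ?n" using \<open>0 \<le> \<delta>\<close> by simp
  have e0: "y ^ 0 * exp (- (s * y)) \<le> 1" if "0 < y" "0 \<le> s" for y s :: real
    using that by simp
  have e1: "y ^ 1 * exp (- (s * y)) \<le> 2 / t" if "0 < y" "t / 2 \<le> s" for y s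
  proof -
    have "0 < s" using that \<open>0 < t\<close> by linarith
    then have "y ^ 1 * exp (- (s * y)) \<le> 1 / s" using mult_exp_minus_le(1)[of s y] that by simp
    also have "\<dots> \<le> 2 / t" using that \<open>0 < t\<close> \<open>0 < s\<close> by (simp add: field_simps)
    finally show ?thesis .
  qed
  have e2: "y ^ 2 * exp (- (s * y)) \<le> 4 / t\<^sup>2" if "0 < y" "t / 2 \<le> s" for y s
  proof -
    have "0 < s" using that \<open>0 < t\<close> by linarith
    then have "y ^ 2 * exp (- (s * y)) \<le> 1 / s\<^sup>2" using mult_exp_minus_le(2)[of s y] that by simp
    also have "\<dots> \<le> 1 / (t / 2)\<^sup>2"
      using that \<open>0 < t\<close> by (intro divide_left_mono power_mono) auto
    finally show ?thesis by (simp add: power_divide)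
  qed
  \<comment> \<open>Corrected by a boundary term, the pairing has a derivative that is harmless on one half of the interval.\<close>
  define \<Phi> where "\<Phi> s = inner (a 0 s) (b 0 s) - inner (a 1 s) (W (b 0 s))" for s
  define \<Psi> where "\<Psi> s = inner (a 0 s) (b 0 s) - inner (a 0 s) (W (b 1 s))" for s
  have \<Phi>_deriv: "(\<Phi> has_real_derivative - inner (a 2 s) (W (b 0 s))) (at s)" for s
    unfolding \<Phi>_def[abs_def]
    using DERIV_diff[OF product[OF a_deriv[of 0 s] b_deriv[of 0 s]] product[OF a_deriv[of 1 s] Wb_deriv[of 0 s]]]
      key[of s] by (simp add: numeral_2_eq_2)
  have \<Psi>_deriv: "(\<Psi> has_real_derivative - inner (a 0 s) (W (b 2 s))) (at s)" for s
    unfolding \<Psi>_def[abs_def]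
    using DERIV_diff[OF product[OF a_deriv[of 0 s] b_deriv[of 0 s]] product[OF a_deriv[of 0 s] Wb_deriv[of 1 s]]]
      key[of s] by (simp add: numeral_2_eq_2)
  have "\<bar>\<Phi> (t / 2) - \<Phi> 0\<bar> \<le> (t / 2 - 0) * (4 / t\<^sup>2 * 1 * ?n)"
  proof (rule abs_diff_le_of_derivative_bound[OF _ \<Phi>_deriv])
    fix s assume s: "0 \<le> s" "s \<le> t / 2"
    show "\<bar>- inner (a 2 s) (W (b 0 s))\<bar> \<le> 4 / t\<^sup>2 * 1 * ?n"
      unfolding abs_minus_cancel using s \<open>0 < t\<close> by (intro pair e0 e2) auto
  qed (use \<open>0 < t\<close> in simp)
  then have 1: "\<bar>\<Phi> (t / 2) - \<Phi> 0\<bar> \<le> 2 / t * ?n"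
    using \<open>0 < t\<close> by (simp add: power2_eq_square)
  have "\<bar>\<Psi> t - \<Psi> (t / 2)\<bar> \<le> (t - t / 2) * (1 * (4 / t\<^sup>2) * ?n)"
  proof (rule abs_diff_le_of_derivative_bound[OF _ \<Psi>_deriv])
    fix s assume s: "t / 2 \<le> s" "s \<le> t"
    show "\<bar>- inner (a 0 s) (W (b 2 s))\<bar> \<le> 1 * (4 / t\<^sup>2) * ?n"
      unfolding abs_minus_cancel using s \<open>0 < t\<close> by (intro pair e0 e2) auto
  qed (use \<open>0 < t\<close> in simp)
  then have 2: "\<bar>\<Psi> t - \<Psi> (t / 2)\<bar> \<le> 2 / t * ?n"
    using \<open>0 < t\<close> by (simp add: power2_eq_square)
  have 3: "\<bar>inner (a 1 s) (W (b 0 s))\<bar> \<le> 2 / t * 1 * ?n" if "s = 0 \<or> s = t / 2" for s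
    using that \<open>0 < t\<close> by (intro pair e0 e1) auto
  have 4: "\<bar>inner (a 0 s) (W (b 1 s))\<bar> \<le> 1 * (2 / t) * ?n" if "s = t \<or> s = t / 2" for s
    using that \<open>0 < t\<close> by (intro pair e0 e1) auto
  have "\<bar>inner (a 0 t) (b 0 t) - inner (a 0 0) (b 0 0)\<bar> \<le> 6 * (2 / t * ?n)"
    using 1 2 3[of 0] 3[of "t / 2"] 4[of t] 4[of "t / 2"] unfolding \<Phi>_def \<Psi>_def by simp
  then show ?thesis unfolding a_def b_def by (simp add: algebra_simps)
qed

section \<open>Semigroup and fractional powers on the eigenbasis\<close>

text \<open>
  The semigroup law splits \<open>S t\<close> into \<open>n\<close> steps of length \<open>t / n\<close>.  By definition of the generator one step differs
  from multiplication by \<open>exp (- t l / n)\<close> by \<open>o(1 / n)\<close> on \<open>y\<close>, and contractivity makes the errors of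
  the steps add up to \<open>o(1)\<close>.
\<close>

lemma semigroup_eigenvector:
  assumes S: "contraction_semigroup_of D A S" and y: "y \<in> D" "A y = l *\<^sub>R y" and "0 \<le> l" "0 \<le> t"
  shows "blinfun_apply (S t) y = exp (- (t * l)) *\<^sub>R y"
proof (cases "t = 0")
  case True
  then show ?thesis using S by (simp add: contraction_semigroup_of_def)
next
  case False
  with \<open>0 \<le> t\<close> have "0 < t" by simp
  have S0: "S 0 = id_blinfun"
    and S_add: "\<And>s t. 0 \<le> s \<Longrightarrow> 0 \<le> t \<Longrightarrow> S (s + t) = S s o\<^sub>L S t"
    and S_le: "\<And>t. 0 \<le> t \<Longrightarrow> norm (S t) \<le> 1"
    and gen: "((\<lambda>t. (blinfun_apply (S t) y - y) /\<^sub>R t) \<longlongrightarrow> - A y) (at_right 0)"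
    using S y unfolding contraction_semigroup_of_def by blast+
  have S_norm: "norm (blinfun_apply (S s) z) \<le> norm z" if "0 \<le> s" for s z
    using norm_blinfun[of "S s" z] mult_right_mono[OF S_le[OF that] norm_ge_zero[of z]] by simp
  define d where "d \<tau> = blinfun_apply (S \<tau>) y - exp (- (\<tau> * l)) *\<^sub>R y" for \<tau>
  have steps: "norm (d (real m * \<tau>)) \<le> real m * norm (d \<tau>)" if "0 \<le> \<tau>" for m \<tau>
  proof (induction m)
    case 0
    show ?case by (simp add: d_def S0)
  next
    case (Suc m)
    have "d (real (Suc m) * \<tau>) = blinfun_apply (S (real m * \<tau>)) (d \<tau>) + exp (- (\<tau> * l)) *\<^sub>R d (real m * \<tau>)"
      using that S_add[of "real m * \<tau>" \<tau>]
      by (simp add: d_def algebra_simps blinfun.diff_right blinfun.scaleR_right exp_add[symmetric] exp_diff exp_minus field_simps)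
    then have "norm (d (real (Suc m) * \<tau>)) \<le> norm (blinfun_apply (S (real m * \<tau>)) (d \<tau>))
        + norm (exp (- (\<tau> * l)) *\<^sub>R d (real m * \<tau>))"
      by (metis norm_triangle_ineq)
    also have "\<dots> \<le> norm (d \<tau>) + 1 * norm (d (real m * \<tau>))"
      unfolding norm_scaleR using that \<open>0 \<le> l\<close>
      by (intro add_mono mult_right_mono S_norm) auto
    finally show ?case using Suc by (simp add: algebra_simps)
  qed
  have "((\<lambda>\<tau>. (exp (- (\<tau> * l)) - 1) / \<tau>) \<longlongrightarrow> - l) (at_right 0)"
  proof -
    have "((\<lambda>\<tau>. exp (- (\<tau> * l))) has_real_derivative - l) (at_right 0)"
      by (auto intro!: derivative_eq_intros)
    then show ?thesis by (simp add: has_field_derivative_iff)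
  qed
  then have "((\<lambda>\<tau>. (blinfun_apply (S \<tau>) y - y) /\<^sub>R \<tau> - ((exp (- (\<tau> * l)) - 1) / \<tau>) *\<^sub>R y)
      \<longlongrightarrow> - A y - (- l) *\<^sub>R y) (at_right 0)"
    by (intro tendsto_diff gen tendsto_scaleR tendsto_const)
  then have lim: "((\<lambda>\<tau>. d \<tau> /\<^sub>R \<tau>) \<longlongrightarrow> 0) (at_right 0)"
    by (simp add: y(2) d_def divide_inverse algebra_simps)
  have "filterlim (\<lambda>n. t / real (Suc n)) (at_right 0) sequentially"
    unfolding filterlim_at using \<open>0 < t\<close> LIMSEQ_Suc[OF lim_const_over_n[of t]]
    by (auto simp del: of_nat_Suc)
  then have "(\<lambda>n. norm (d (t / real (Suc n)) /\<^sub>R (t / real (Suc n)))) \<longlonglongrightarrow> 0"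
    by (intro tendsto_norm_zero) (rule filterlim_compose[OF lim])
  then have "(\<lambda>n. t * norm (d (t / real (Suc n)) /\<^sub>R (t / real (Suc n)))) \<longlonglongrightarrow> t * 0"
    by (intro tendsto_mult tendsto_const)
  moreover have "norm (d t) \<le> t * norm (d (t / real (Suc n)) /\<^sub>R (t / real (Suc n)))" for n
    using steps[of "t / real (Suc n)" "Suc n"] \<open>0 < t\<close> by (simp del: of_nat_Suc)
  ultimately have "norm (d t) \<le> t * 0"
    by (intro LIMSEQ_le_const) auto
  then show ?thesis by (simp add: d_def)
qed

locale spectral_operator = hilbert_basis e for e :: "nat \<Rightarrow> 'h::{real_inner, banach}" +
  fixes lam :: "nat \<Rightarrow> real"
  assumes lam_pos: "0 < lam k"
begin

text \<open>
  The series defining \<open>frac_power\<close> has a meaningful value only if it converges, which membership in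
  \<open>hdot\<close> guarantees.
\<close>

lemma inner_frac_power:
  assumes "x \<in> hdot e lam (2 * r)"
  shows "inner (frac_power e lam r x) (e k) = lam k powr r * inner x (e k)"
proof -
  let ?c = "\<lambda>k. lam k powr r * inner x (e k)"
  have "lam k powr (2 * r) * (inner x (e k))\<^sup>2 = (?c k)\<^sup>2" for k
  proof -
    have "lam k powr (2 * r) = (lam k powr r)\<^sup>2"
      by (simp add: power2_eq_square flip: powr_add)
    then show ?thesis by (simp add: power_mult_distrib)
  qed
  then have "summable (\<lambda>k. (?c k)\<^sup>2)" using assms by (simp add: hdot_def)
  then have "(\<lambda>k. ?c k *\<^sub>R e k) sums frac_power e lam r x"
    unfolding frac_power_def by (intro summable_sums orthonormal_series_summable orthonormal)
  then have "(\<lambda>j. inner (?c j *\<^sub>R e j) (e k)) sums inner (frac_power e lam r x) (e k)"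
    by (rule bounded_linear.sums[OF bounded_linear_inner_left])
  moreover have "(\<lambda>j. inner (?c j *\<^sub>R e j) (e k)) = (\<lambda>j. if j = k then ?c k else 0)"
    using orthonormal by (auto simp: orthonormal_family_def)
  ultimately have "(\<lambda>j. if j = k then ?c k else 0) sums inner (frac_power e lam r x) (e k)" by simp
  then show ?thesis by (rule sums_unique2[OF _ sums_single])
qed

text \<open>
  Linearity holds as all vectors involved are in the domain: both sides have the same Fourier coefficients.
\<close>

lemma frac_power_linear_combination:
  assumes "finite G" "\<And>g. g \<in> G \<Longrightarrow> g \<in> hdot e lam (2 * r)" "y \<in> hdot e lam (2 * r)"
    and "y = (\<Sum>g\<in>G. c g *\<^sub>R g)"
  shows "frac_power e lam r y = (\<Sum>g\<in>G. c g *\<^sub>R frac_power e lam r g)"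
proof -
  have "frac_power e lam r y - (\<Sum>g\<in>G. c g *\<^sub>R frac_power e lam r g) = 0"
  proof (rule eq_0_if_coefficients_0)
    fix k
    have "inner y (e k) = (\<Sum>g\<in>G. c g * inner g (e k))"
      unfolding assms(4) by (simp add: inner_sum_left)
    then show "inner (frac_power e lam r y - (\<Sum>g\<in>G. c g *\<^sub>R frac_power e lam r g)) (e k) = 0"
      using assms(2) by (simp add: inner_diff_left inner_sum_left inner_frac_power[OF assms(3)]
          inner_frac_power sum_distrib_left mult_ac)
  qed
  then show ?thesis by simp
qed

lemma hdot_add:
  assumes "x \<in> hdot e lam s" "y \<in> hdot e lam s"
  shows "x + y \<in> hdot e lam s"
proof -
  let ?g = "\<lambda>k. 2 * (lam k powr s * (inner x (e k))\<^sup>2) + 2 * (lam k powr s * (inner y (e k))\<^sup>2)"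
  have summable: "summable ?g"
    using assms by (intro summable_add summable_mult) (simp_all add: hdot_def)
  have square: "(a + b)\<^sup>2 \<le> 2 * a\<^sup>2 + 2 * b\<^sup>2" for a b :: real
    using sum_squares_bound[of a b] by (simp add: power2_sum)
  have "norm (lam k powr s * (inner (x + y) (e k))\<^sup>2) \<le> ?g k" for k
    using mult_left_mono[OF square[of "inner x (e k)" "inner y (e k)"], of "lam k powr s"]
    by (simp add: inner_add_left distrib_left mult_ac)
  then have "summable (\<lambda>k. lam k powr s * (inner (x + y) (e k))\<^sup>2)"
    by (intro summable_comparison_test'[OF summable, of 0])
  then show ?thesis by (simp add: hdot_def)
qed

lemma hdot_scale:
  assumes "x \<in> hdot e lam s"
  shows "c *\<^sub>R x \<in> hdot e lam s"
proof -
  have "summable (\<lambda>k. c\<^sup>2 * (lam k powr s * (inner x (e k))\<^sup>2))"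
    using assms by (intro summable_mult) (simp add: hdot_def)
  then show ?thesis by (simp add: hdot_def power_mult_distrib mult_ac)
qed

lemma subspace_hdot: "subspace (hdot e lam s)"
  unfolding subspace_def using hdot_add hdot_scale by (auto simp: hdot_def)

lemma basis_in_hdot: "e k \<in> hdot e lam s"
proof -
  have "(\<lambda>j. lam j powr s * (inner (e k) (e j))\<^sup>2) = (\<lambda>j. if j = k then lam k powr s else 0)"
    using orthonormal by (auto simp: orthonormal_family_def)
  then show ?thesis unfolding hdot_def using sums_single[of k "\<lambda>_. lam k powr s"]
    by (simp add: sums_summable)
qed

lemma span_subset_hdot: "span (range e) \<subseteq> hdot e lam s"
  using basis_in_hdot by (intro span_minimal subspace_hdot) auto

lemma fourier_sum_in_hdot: "fourier_sum e {..<n} g x \<in> hdot e lam s"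
  using span_subset_hdot fourier_sum_in_span[of e "{..<n}" g x] span_mono[of "e ` {..<n}" "range e"] by blast

lemma inner_fourier_sum_coefficient:
  "inner (fourier_sum e {..<n} g x) (e k) = (if k < n then g k * inner x (e k) else 0)"
proof (cases "k < n")
  case True
  then show ?thesis by (simp add: inner_fourier_sum_member orthonormal_on)
next
  case False
  then show ?thesis
    using orthonormal unfolding fourier_sum_def inner_sum_left
    by (auto simp: orthonormal_family_def intro!: sum.neutral)
qed

lemma frac_power_fourier_sum:
  "frac_power e lam r (fourier_sum e {..<n} g x) = fourier_sum e {..<n} (\<lambda>k. lam k powr r * g k) x"
proof -
  have "inner (frac_power e lam r (fourier_sum e {..<n} g x)
      - fourier_sum e {..<n} (\<lambda>k. lam k powr r * g k) x) (e k) = 0" for k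
    by (simp add: inner_diff_left inner_frac_power[OF fourier_sum_in_hdot] inner_fourier_sum_coefficient)
  then show ?thesis using eq_0_if_coefficients_0 by fastforce
qed

text \<open>
  The truncated inverse applied to \<open>g\<close> solves the weak equation with right-hand side \<open>truncation n g\<close>.  Together with
  \<open>hdot_norm_inverse\<close> this turns the bound on the Ritz projection into a bound on inverses.
\<close>

lemma hdot_inner_inverse:
  assumes "x \<in> hdot e lam 1"
  shows "hdot_inner e lam 1 x (fourier_sum e {..<n} (\<lambda>k. 1 / lam k) g) = inner x (truncation n g)"
proof -
  let ?J = "frac_power e lam (1 / 2)"
  have "hdot_inner e lam 1 x (fourier_sum e {..<n} (\<lambda>k. 1 / lam k) g)
      = inner (fourier_sum e {..<n} (\<lambda>k. lam k powr (1 / 2) * (1 / lam k)) g) (?J x)"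
    unfolding hdot_inner_def frac_power_fourier_sum by (rule inner_commute)
  also have "\<dots> = (\<Sum>k<n. inner g (e k) * inner x (e k))"
  proof -
    have "lam k powr (1 / 2) * (1 / lam k) * inner g (e k) * inner (?J x) (e k)
        = inner g (e k) * inner x (e k)" for k
    proof -
      have "s * (1 / (s * s)) * a * (s * b) = a * b" if "0 < s" for s a b :: real
        using that by simp
      from this[of "sqrt (lam k)"] show ?thesis
        using lam_pos[of k] inner_frac_power[of x "1 / 2" k] assms by (simp add: powr_half_sqrt)
    qed
    then show ?thesis unfolding inner_fourier_sum by simp
  qed
  also have "\<dots> = inner (truncation n g) x" unfolding inner_fourier_sum by simp
  finally show ?thesis by (simp add: inner_commute)
qed

lemma hdot_norm_inverse:
  "hdot_norm e lam 2 (fourier_sum e {..<n} (\<lambda>k. 1 / lam k) g) = norm (truncation n g)"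
proof -
  have "fourier_sum e {..<n} (\<lambda>k. lam k powr 1 * (1 / lam k)) g = truncation n g"
  proof -
    have "lam k powr 1 * (1 / lam k) = 1" for k using lam_pos[of k] by simp
    then show ?thesis by simp
  qed
  then show ?thesis unfolding hdot_norm_def frac_power_fourier_sum by simp
qed

lemma hdot_inner_positive:
  assumes "x \<in> hdot e lam 1" "x \<noteq> 0"
  shows "0 < hdot_inner e lam 1 x x"
proof (rule ccontr)
  assume "\<not> 0 < hdot_inner e lam 1 x x"
  then have 0: "frac_power e lam (1 / 2) x = 0"
    unfolding hdot_inner_def by (metis inner_gt_zero_iff)
  have "inner x (e k) = 0" for k
    using inner_frac_power[of x "1 / 2" k] assms(1) lam_pos[of k] unfolding 0 by simp
  then show False using eq_0_if_coefficients_0 assms(2) by blast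
qed

end

section \<open>Spectral form of the Galerkin operators\<close>

context spectral_operator
begin

text \<open>
  The form \<open>hdot_inner e lam 1\<close> restricted to \<open>V\<close> is symmetric and positive definite.  Its eigenvectors and
  eigenvalues are those of \<open>A\<^sub>h\<close>.
\<close>

lemma galerkin_diagonalization:
  assumes "finite_dim_subspace V" "V \<subseteq> hdot e lam 1"
  obtains G \<mu> where "finite G" "orthonormal_family (\<lambda>x. x) G" "V = span G" "\<And>g. g \<in> G \<Longrightarrow> 0 < \<mu> g"
    and "\<And>x z. x \<in> V \<Longrightarrow> z \<in> V \<Longrightarrow>
      hdot_inner e lam 1 x z = inner (fourier_sum (\<lambda>x. x) G \<mu> x) z"
proof -
  let ?a = "hdot_inner e lam 1"
  let ?J = "frac_power e lam (1 / 2)"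
  obtain B where B: "finite B" "V = span B" using assms(1) by (auto simp: finite_dim_subspace_def)
  have hdot: "x \<in> hdot e lam (2 * (1 / 2))" if "x \<in> V" for x using that assms(2) by auto
  have V_add: "x + y \<in> V" if "x \<in> V" "y \<in> V" for x y using that by (simp add: B span_add)
  have V_scale: "c *\<^sub>R x \<in> V" if "x \<in> V" for x c using that by (simp add: B span_scale)
  have J_scale: "?J (c *\<^sub>R x) = c *\<^sub>R ?J x" if "x \<in> V" for c x
  proof -
    have "?J (c *\<^sub>R x) = (\<Sum>g\<in>{x}. c *\<^sub>R ?J g)"
      by (rule frac_power_linear_combination[OF _ hdot hdot[OF V_scale[OF that]]]) (use that in auto)
    then show ?thesis by simp
  qed
  have J_add: "?J (x + y) = ?J x + ?J y" if "x \<in> V" "y \<in> V" for x y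
  proof (cases "x = y")
    case True
    then show ?thesis using J_scale[OF that(1), of 2] by (simp add: scaleR_2)
  next
    case False
    have "?J (x + y) = (\<Sum>g\<in>{x, y}. 1 *\<^sub>R ?J g)"
      by (rule frac_power_linear_combination[OF _ hdot hdot[OF V_add[OF that]]]) (use that False in auto)
    then show ?thesis using False by simp
  qed
  have "\<exists>G. finite G \<and> span G = span B \<and> orthonormal_family (\<lambda>x. x) G \<and>
    (\<forall>g\<in>G. \<forall>h\<in>G. g \<noteq> h \<longrightarrow> ?a g h = 0)"
    by (rule finite_dim_diagonalization[OF B(1)], unfold B(2)[symmetric] hdot_inner_def)
      (auto simp: J_add J_scale inner_add_left intro: inner_commute)
  then obtain G where G: "finite G" "span G = span B" "orthonormal_family (\<lambda>x. x) G"
    "\<And>g h. g \<in> G \<Longrightarrow> h \<in> G \<Longrightarrow> g \<noteq> h \<Longrightarrow> ?a g h = 0" by blast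
  define \<mu> where "\<mu> g = ?a g g" for g
  have GV: "g \<in> V" if "g \<in> G" for g using that G(2) B(2) span_base by blast
  have pos: "0 < \<mu> g" if "g \<in> G" for g
  proof -
    have "inner g g = 1" using G(3) that unfolding orthonormal_family_def by simp
    then have "g \<noteq> 0" by auto
    then show ?thesis unfolding \<mu>_def using GV[OF that] assms(2) by (intro hdot_inner_positive) auto
  qed
  have form: "?a x z = inner (fourier_sum (\<lambda>x. x) G \<mu> x) z" if "x \<in> V" "z \<in> V" for x z
  proof -
    have J: "?J y = (\<Sum>g\<in>G. inner y g *\<^sub>R ?J g)" if "y \<in> V" for y
    proof (rule frac_power_linear_combination[OF G(1) hdot[OF GV] hdot[OF that]])
      show "y = (\<Sum>g\<in>G. inner y g *\<^sub>R g)"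
        using that fourier_sum_span[OF G(1,3), of y] by (simp add: B G(2) fourier_sum_def)
    qed
    have "?a x z = (\<Sum>g\<in>G. \<Sum>h\<in>G. inner x g * inner z h * ?a g h)"
      unfolding hdot_inner_def J[OF that(1)] J[OF that(2)] unfolding inner_sum_left
      unfolding inner_sum_right by (simp add: mult_ac)
    also have "\<dots> = (\<Sum>g\<in>G. \<Sum>h\<in>G. if g = h then inner x g * inner z g * \<mu> g else 0)"
      using G(4) by (intro sum.cong refl) (auto simp: \<mu>_def)
    also have "\<dots> = inner (fourier_sum (\<lambda>x. x) G \<mu> x) z"
      using G(1) by (simp add: inner_fourier_sum mult_ac)
    finally show ?thesis .
  qed
  show thesis by (rule that[OF G(1,3) _ pos form]) (use G B in auto)
qed

context
  fixes V :: "'h set" and G :: "'h set" and \<mu> :: "'h \<Rightarrow> real"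
  assumes V_hdot: "V \<subseteq> hdot e lam 1" and G: "finite G" "orthonormal_family (\<lambda>x. x) G" "V = span G"
    and \<mu>_pos: "\<And>g. g \<in> G \<Longrightarrow> 0 < \<mu> g"
    and form: "\<And>x z. x \<in> V \<Longrightarrow> z \<in> V \<Longrightarrow>
      hdot_inner e lam 1 x z = inner (fourier_sum (\<lambda>x. x) G \<mu> x) z"
begin

abbreviation "galerkin_sum \<equiv> fourier_sum (\<lambda>x. x) G"

lemma galerkin_sum_in_V: "galerkin_sum g x \<in> V"
  using fourier_sum_in_span[of "\<lambda>x. x" G g x] G(3) by simp

lemma galerkin_sum_id: "x \<in> V \<Longrightarrow> galerkin_sum (\<lambda>_. 1) x = x"
  using fourier_sum_span[OF G(1,2), of x] G(3) by simp

lemma orth_proj_galerkin: "orth_proj V x = galerkin_sum (\<lambda>_. 1) x"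
  unfolding orth_proj_def
proof (rule the_equality)
  have "inner (x - galerkin_sum (\<lambda>_. 1) x) z = 0" if "z \<in> V" for z
    by (simp add: inner_diff_left fourier_sum_symmetric galerkin_sum_id[OF that])
  then show "galerkin_sum (\<lambda>_. 1) x \<in> V \<and> (\<forall>z\<in>V. inner (x - galerkin_sum (\<lambda>_. 1) x) z = 0)"
    using galerkin_sum_in_V by blast
next
  fix y assume y: "y \<in> V \<and> (\<forall>z\<in>V. inner (x - y) z = 0)"
  have "galerkin_sum (\<lambda>_. 1) (x - y) = 0"
    using y G span_base unfolding fourier_sum_def by (intro sum.neutral) auto
  then show "y = galerkin_sum (\<lambda>_. 1) x"
    using y galerkin_sum_id by (simp add: linear_diff[OF linear_fourier_sum])
qed

lemma discrete_op_galerkin: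
  assumes "x \<in> V"
  shows "discrete_op e lam V x = galerkin_sum \<mu> x"
  unfolding discrete_op_def
proof (rule the_equality)
  show "galerkin_sum \<mu> x \<in> V \<and> (\<forall>z\<in>V. inner (galerkin_sum \<mu> x) z = hdot_inner e lam 1 x z)"
    using galerkin_sum_in_V form assms by simp
next
  fix y assume y: "y \<in> V \<and> (\<forall>z\<in>V. inner y z = hdot_inner e lam 1 x z)"
  let ?d = "y - galerkin_sum \<mu> x"
  have "?d \<in> V" using y galerkin_sum_in_V G(3) by (simp add: span_diff)
  then have "inner ?d ?d = 0" using y form[OF assms \<open>?d \<in> V\<close>] by (simp add: inner_diff_left)
  then show "y = galerkin_sum \<mu> x" by simp
qed

text \<open>
  On each eigenvector the exponential series of \<open>A\<^sub>h\<close> is the scalar one.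
\<close>

lemma discrete_semigroup_galerkin:
  "discrete_semigroup e lam V t (orth_proj V x) = galerkin_sum (\<lambda>g. exp (- (t * \<mu> g))) x"
proof -
  have power: "(discrete_op e lam V ^^ n) (orth_proj V x) = galerkin_sum (\<lambda>g. \<mu> g ^ n) x" for n
  proof (induction n)
    case 0
    show ?case by (simp add: orth_proj_galerkin)
  next
    case (Suc n)
    then show ?case
      by (simp add: discrete_op_galerkin[OF galerkin_sum_in_V] fourier_sum_compose[OF G(1,2)])
  qed
  have "(\<lambda>n. \<Sum>g\<in>G. ((- (t * \<mu> g)) ^ n /\<^sub>R fact n) *\<^sub>R (inner x g *\<^sub>R g)) sums
      (\<Sum>g\<in>G. exp (- (t * \<mu> g)) *\<^sub>R (inner x g *\<^sub>R g))"
    by (intro sums_sum bounded_linear.sums[OF bounded_linear_scaleR_left] exp_converges)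
  moreover have "(\<Sum>g\<in>G. ((- (t * \<mu> g)) ^ n /\<^sub>R fact n) *\<^sub>R (inner x g *\<^sub>R g))
      = ((- t) ^ n / fact n) *\<^sub>R (discrete_op e lam V ^^ n) (orth_proj V x)" for n
  proof -
    have neg: "(- (t * m)) ^ n = (- t) ^ n * m ^ n" for m
      using power_mult_distrib[of "- t" m n] by simp
    show ?thesis
      unfolding power fourier_sum_def scaleR_sum_right neg
      by (intro sum.cong) (simp_all add: divide_inverse mult_ac)
  qed
  ultimately have "(\<lambda>n. ((- t) ^ n / fact n) *\<^sub>R (discrete_op e lam V ^^ n) (orth_proj V x)) sums
      galerkin_sum (\<lambda>g. exp (- (t * \<mu> g))) x"
    by (simp add: fourier_sum_def)
  then show ?thesis unfolding discrete_semigroup_def by (rule sums_unique[symmetric])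
qed

text \<open>
  This is \<open>R\<^sub>h A\<^sup>-\<^sup>1 = A\<^sub>h\<^sup>-\<^sup>1 P\<^sub>h\<close> on a finite span of eigenvectors.
\<close>

lemma ritz_proj_galerkin:
  "ritz_proj e lam V (fourier_sum e {..<n} (\<lambda>k. 1 / lam k) x) = galerkin_sum (\<lambda>g. 1 / \<mu> g) (truncation n x)"
  (is "ritz_proj e lam V ?y = ?r")
  unfolding ritz_proj_def
proof (rule the_equality)
  have inv: "galerkin_sum \<mu> (galerkin_sum (\<lambda>g. 1 / \<mu> g) w) = galerkin_sum (\<lambda>_. 1) w" for w
    unfolding fourier_sum_compose[OF G(1,2)] unfolding fourier_sum_def
    by (intro sum.cong) (auto dest: \<mu>_pos)
  let ?J = "frac_power e lam (1 / 2)"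
  have y: "?y \<in> hdot e lam 1" by (rule fourier_sum_in_hdot)
  have split: "hdot_inner e lam 1 (?y - w) z = hdot_inner e lam 1 ?y z - hdot_inner e lam 1 w z"
    if "w \<in> V" for w z
  proof -
    have w: "w \<in> hdot e lam 1" using that V_hdot by blast
    have "?J (?y - w) = ?J ?y - ?J w"
    proof -
      have "inner (?J (?y - w) - (?J ?y - ?J w)) (e k) = 0" for k
        using inner_frac_power[of _ "1 / 2"] subspace_diff[OF subspace_hdot y w] y w
        by (simp add: inner_diff_left algebra_simps)
      then show ?thesis using eq_0_if_coefficients_0 by fastforce
    qed
    then show ?thesis by (simp add: hdot_inner_def inner_diff_left)
  qed
  have test: "hdot_inner e lam 1 ?y z = inner (truncation n x) z" if "z \<in> V" for z
  proof -
    have "hdot_inner e lam 1 ?y z = hdot_inner e lam 1 z ?y"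
      by (simp add: hdot_inner_def inner_commute)
    then show ?thesis using hdot_inner_inverse[of z n x] that V_hdot by (auto simp: inner_commute)
  qed
  have r: "?r \<in> V" by (rule galerkin_sum_in_V)
  have "hdot_inner e lam 1 ?r z = inner (truncation n x) z" if "z \<in> V" for z
    unfolding form[OF r that] inv by (simp add: fourier_sum_symmetric[of _ G] galerkin_sum_id[OF that])
  then show "?r \<in> V \<and> (\<forall>z\<in>V. hdot_inner e lam 1 (?y - ?r) z = 0)"
    using r by (simp add: split test)
  fix w assume w: "w \<in> V \<and> (\<forall>z\<in>V. hdot_inner e lam 1 (?y - w) z = 0)"
  then have "inner (galerkin_sum \<mu> w) z = inner (truncation n x) z" if "z \<in> V" for z
    using split[of w z] test[OF that] form[of w z] that by auto
  moreover have "g \<in> V" if "g \<in> G" for g using that G(3) by (simp add: span_base)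
  ultimately have coeff: "\<mu> g * inner w g = inner (truncation n x) g" if "g \<in> G" for g
    using that inner_fourier_sum_member[OF G(1,2) that, of \<mu> w] by simp
  have "w = galerkin_sum (\<lambda>_. 1) w" using w galerkin_sum_id by simp
  also have "\<dots> = ?r"
    unfolding fourier_sum_def[of _ G]
  proof (intro sum.cong refl)
    fix g assume "g \<in> G"
    show "(1 * inner w g) *\<^sub>R g = (1 / \<mu> g * inner (truncation n x) g) *\<^sub>R g"
      using coeff[OF \<open>g \<in> G\<close>, symmetric] \<mu>_pos[OF \<open>g \<in> G\<close>] by simp
  qed
  finally show "w = ?r" .
qed

text \<open>
  The component of the error in \<open>V\<close> is tested with itself and estimated by \<open>nonsmooth_data_pairing\<close>.  The
  component orthogonal to \<open>V\<close> sees the continuous semigroup only.  Writing \<open>S(t) x = A\<^sup>-\<^sup>1 z\<close> with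
  \<open>z = A S(t) x\<close> of size \<open>1 / t\<close>, it may be replaced by the difference of the inverses at \<open>z\<close>, because the
  discrete inverse has values in \<open>V\<close>.
\<close>

lemma galerkin_error_truncated:
  assumes ritz: "\<And>x. x \<in> hdot e lam 2 \<Longrightarrow> norm (ritz_proj e lam V x - x) \<le> \<delta> * hdot_norm e lam 2 x"
    and "0 \<le> \<delta>" "0 < t"
  shows "norm (galerkin_sum (\<lambda>g. exp (- (t * \<mu> g))) (truncation n x)
      - fourier_sum e {..<n} (\<lambda>k. exp (- (t * lam k))) x) \<le> 14 * \<delta> / t * norm x"
proof -
  let ?K = "{..<n}"
  have K: "finite ?K" "orthonormal_family e ?K" by (simp_all add: orthonormal_on)
  define W where "W z = galerkin_sum (\<lambda>g. 1 / \<mu> g) z - fourier_sum e ?K (\<lambda>k. 1 / lam k) z" for z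
  have W: "norm (W z) \<le> \<delta> * norm z" if "z \<in> span (e ` ?K)" for z
  proof -
    have "truncation n z = z" by (rule fourier_sum_span[OF K that])
    then show ?thesis
      using ritz[OF fourier_sum_in_hdot, of n "\<lambda>k. 1 / lam k" z]
      by (simp add: W_def ritz_proj_galerkin hdot_norm_inverse)
  qed
  define x' where "x' = truncation n x"
  have x': "norm x' \<le> norm x"
    unfolding x'_def using norm_fourier_sum_le[OF K, of "\<lambda>_. 1" 1 x] by simp
  define y where "y = fourier_sum e ?K (\<lambda>k. exp (- (t * lam k))) x"
  define z where "z = fourier_sum e ?K (\<lambda>k. lam k * exp (- (t * lam k))) x'"
  have y_eq: "y = fourier_sum e ?K (\<lambda>k. exp (- (t * lam k))) x'"
    unfolding y_def x'_def fourier_sum_compose[OF K] by simp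
  have yz: "fourier_sum e ?K (\<lambda>k. 1 / lam k) z = y"
  proof -
    have "1 / lam k * (lam k * c) = c" for k c using lam_pos[of k] by simp
    then show ?thesis unfolding z_def y_eq fourier_sum_compose[OF K] by simp
  qed
  have Wz: "norm (W z) \<le> \<delta> / t * norm x"
  proof -
    have "norm z \<le> 1 / t * norm x'"
      unfolding z_def using \<open>0 < t\<close> mult_exp_minus_le(1)[OF \<open>0 < t\<close>] lam_pos
      by (intro norm_fourier_sum_le K) (auto simp: abs_mult less_imp_le)
    also have "\<dots> \<le> 1 / t * norm x" using x' \<open>0 < t\<close> by (intro mult_left_mono) auto
    finally have "\<delta> * norm z \<le> \<delta> * (1 / t * norm x)" using \<open>0 \<le> \<delta>\<close> by (rule mult_left_mono)
    moreover have "z \<in> span (e ` ?K)" unfolding z_def by (rule fourier_sum_in_span)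
    ultimately show ?thesis using W[of z] by simp
  qed
  define u where "u = galerkin_sum (\<lambda>g. exp (- (t * \<mu> g))) x'"
  define P where "P = galerkin_sum (\<lambda>_. 1)"
  have P_norm: "norm (P w) \<le> norm w" for w
    unfolding P_def using norm_fourier_sum_le[OF G(1,2), of "\<lambda>_. 1" 1 w] by simp
  have P_lin: "P (a - b) = P a - P b" for a b
    unfolding P_def by (rule linear_diff[OF linear_fourier_sum])
  have P_id: "P w = w" if "w \<in> V" for w unfolding P_def by (rule galerkin_sum_id[OF that])
  have near: "norm (P (y - u)) \<le> 12 * \<delta> / t * norm x"
  proof (cases "P (y - u) = 0")
    case True
    then show ?thesis using \<open>0 \<le> \<delta>\<close> \<open>0 < t\<close> by simp
  next
    case False
    define v where "v = P (y - u)"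
    have vV: "v \<in> V" unfolding v_def P_def by (rule galerkin_sum_in_V)
    have u_pair: "inner (galerkin_sum (\<lambda>g. exp (- (t * \<mu> g))) v) (truncation n x') = inner v u"
      unfolding u_def fourier_sum_symmetric[of _ G] by (simp add: x'_def fourier_sum_compose[OF K])
    have "(norm v)\<^sup>2 = inner v (y - u)"
      unfolding power2_norm_eq_inner using P_id[OF vV] unfolding P_def
      by (metis P_def fourier_sum_symmetric v_def)
    also have "\<dots> = inner (galerkin_sum (\<lambda>_. 1) v) (fourier_sum e ?K (\<lambda>k. exp (- (t * lam k))) x')
        - inner (galerkin_sum (\<lambda>g. exp (- (t * \<mu> g))) v) (truncation n x')"
      unfolding u_pair using P_id[OF vV] by (simp add: P_def inner_diff_right y_eq)
    also have "\<dots> \<le> 12 * \<delta> / t * norm v * norm x'"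
      using nonsmooth_data_pairing[OF G(1,2) \<mu>_pos K lam_pos W[unfolded W_def] \<open>0 \<le> \<delta>\<close> \<open>0 < t\<close>, of v x']
      by linarith
    also have "\<dots> \<le> 12 * \<delta> / t * norm v * norm x"
      using x' \<open>0 \<le> \<delta>\<close> \<open>0 < t\<close> by (intro mult_left_mono) auto
    finally have "norm v * norm v \<le> (12 * \<delta> / t * norm x) * norm v"
      by (simp add: power2_eq_square mult_ac)
    moreover have "0 < norm v" using False unfolding v_def by simp
    ultimately show ?thesis unfolding v_def[symmetric] by (rule mult_right_le_imp_le)
  qed
  \<comment> \<open>Both \<open>u\<close> and the discrete part of \<open>W z\<close> lie in \<open>V\<close>, so only \<open>y\<close> and the discretization error remain.\<close>
  have rest: "(y - u) - P (y - u) = P (W z) - W z"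
  proof -
    have "P u = u" unfolding u_def by (intro P_id galerkin_sum_in_V)
    moreover have "P (galerkin_sum (\<lambda>g. 1 / \<mu> g) z) = galerkin_sum (\<lambda>g. 1 / \<mu> g) z"
      by (intro P_id galerkin_sum_in_V)
    ultimately show ?thesis by (simp add: W_def yz P_lin)
  qed
  have "y - u = P (y - u) + (P (W z) - W z)" unfolding rest[symmetric] by simp
  then have "norm (y - u) \<le> norm (P (y - u)) + norm (P (W z) - W z)" by (metis norm_triangle_ineq)
  also have "\<dots> \<le> 12 * \<delta> / t * norm x + (norm (P (W z)) + norm (W z))"
    by (intro add_mono near norm_triangle_ineq4)
  also have "\<dots> \<le> 14 * \<delta> / t * norm x"
  proof -
    have "14 * \<delta> / t * norm x = 12 * \<delta> / t * norm x + 2 * (\<delta> / t * norm x)" by simp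
    then show ?thesis using P_norm[of "W z"] Wz by linarith
  qed
  finally show ?thesis by (simp add: u_def y_def x'_def norm_minus_commute)
qed

end

end

section \<open>Error of the Galerkin semigroup\<close>

lemma borel_measurable_fourier_sum:
  fixes e :: "'i \<Rightarrow> 'h::{real_inner, second_countable_topology}"
  assumes "f \<in> borel_measurable N"
    and "\<And>j. (\<lambda>s. g s j) \<in> borel_measurable N"
  shows "(\<lambda>s. fourier_sum e J (g s) (f s)) \<in> borel_measurable N"
  unfolding fourier_sum_def using assms by (auto intro!: borel_measurable_sum borel_measurable_scaleR borel_measurable_times borel_measurable_inner)

locale semigroup_with_eigenbasis =
  fixes D :: "'h::{real_inner, banach, second_countable_topology} set" and A S e lam
  assumes S: "contraction_semigroup_of D A S" and basis: "eigenbasis D A e lam"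

sublocale semigroup_with_eigenbasis \<subseteq> spectral_operator e lam
proof
  show "orthonormal_family e UNIV" "closure (span (range e)) = UNIV"
    using basis by (auto simp: eigenbasis_def orthonormal_family_def)
  fix k
  have "lam 0 \<le> lam k" "0 < lam 0" using basis by (auto simp: eigenbasis_def incseq_def)
  then show "0 < lam k" by linarith
qed

context semigroup_with_eigenbasis
begin

lemma semigroup_norm_le:
  assumes "0 \<le> t"
  shows "norm (blinfun_apply (S t) x) \<le> norm x"
proof -
  have "norm (S t) \<le> 1" using S assms by (simp add: contraction_semigroup_of_def)
  then show ?thesis
    using norm_blinfun[of "S t" x] mult_right_mono[of "norm (S t)" 1 "norm x"] by simp
qed

lemma semigroup_truncation:
  assumes "0 \<le> t"
  shows "blinfun_apply (S t) (truncation n x) = fourier_sum e {..<n} (\<lambda>k. exp (- (t * lam k))) x"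
proof -
  have "blinfun_apply (S t) (e k) = exp (- (t * lam k)) *\<^sub>R e k" for k
    using basis less_imp_le[OF lam_pos] assms
    by (intro semigroup_eigenvector[OF S]) (auto simp: eigenbasis_def)
  then show ?thesis
    unfolding fourier_sum_def by (simp add: blinfun.sum_right blinfun.scaleR_right mult.commute)
qed

text \<open>
  Strong limits of explicit finite sums provide the measurability of \<open>s \<mapsto> S(T - s) f(s)\<close>.
\<close>

lemma semigroup_limit:
  assumes "0 \<le> t"
  shows "(\<lambda>n. fourier_sum e {..<n} (\<lambda>k. exp (- (t * lam k))) x) \<longlonglongrightarrow> blinfun_apply (S t) x"
  unfolding semigroup_truncation[OF assms, symmetric] by (intro tendsto_intros truncation_tendsto)

lemma borel_measurable_semigroup:
  assumes "f \<in> borel_measurable N" "r \<in> borel_measurable N" "\<And>s. s \<in> space N \<Longrightarrow> 0 \<le> r s"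
  shows "(\<lambda>s. blinfun_apply (S (r s)) (f s)) \<in> borel_measurable N"
proof (rule borel_measurable_LIMSEQ_metric)
  show "(\<lambda>s. fourier_sum e {..<n} (\<lambda>k. exp (- (r s * lam k))) (f s)) \<in> borel_measurable N" for n
    using assms by (intro borel_measurable_fourier_sum) auto
  show "(\<lambda>n. fourier_sum e {..<n} (\<lambda>k. exp (- (r s * lam k))) (f s)) \<longlonglongrightarrow> blinfun_apply (S (r s)) (f s)"
    if "s \<in> space N" for s
    using assms(3)[OF that] by (rule semigroup_limit)
qed

text \<open>
  All three facts are read off the spectral form of the discrete semigroup; the error bound passes from truncations
  of \<open>x\<close> to the limit because both semigroups are continuous on \<open>H\<close>.
\<close>

lemma
  assumes "finite_dim_subspace V" "V \<subseteq> hdot e lam 1"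
  shows galerkin_semigroup_norm_le:
      "\<And>t x. 0 \<le> t \<Longrightarrow> norm (discrete_semigroup e lam V t (orth_proj V x)) \<le> norm x"
    and borel_measurable_galerkin_semigroup:
      "\<And>f r N. f \<in> borel_measurable N \<Longrightarrow> r \<in> borel_measurable N \<Longrightarrow>
        (\<lambda>s. discrete_semigroup e lam V (r s) (orth_proj V (f s))) \<in> borel_measurable N"
    and galerkin_semigroup_error:
      "\<And>\<delta> t x. \<lbrakk>\<And>x. x \<in> hdot e lam 2 \<Longrightarrow> norm (ritz_proj e lam V x - x) \<le> \<delta> * hdot_norm e lam 2 x;
        0 \<le> \<delta>; 0 < t\<rbrakk> \<Longrightarrow>
        norm (discrete_semigroup e lam V t (orth_proj V x) - blinfun_apply (S t) x) \<le> 14 * \<delta> / t * norm x"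
proof -
  obtain G \<mu> where G: "finite G" "orthonormal_family (\<lambda>x. x) G" "V = span G" "\<And>g. g \<in> G \<Longrightarrow> 0 < \<mu> g"
    and form: "\<And>x z. x \<in> V \<Longrightarrow> z \<in> V \<Longrightarrow>
      hdot_inner e lam 1 x z = inner (fourier_sum (\<lambda>x. x) G \<mu> x) z"
    using galerkin_diagonalization[OF assms] by blast
  have explicit: "discrete_semigroup e lam V t (orth_proj V x)
      = fourier_sum (\<lambda>x. x) G (\<lambda>g. exp (- (t * \<mu> g))) x" for t x
    by (rule discrete_semigroup_galerkin[OF assms(2) G form])
  show "norm (discrete_semigroup e lam V t (orth_proj V x)) \<le> norm x" if "0 \<le> t" for t x
  proof -
    have "norm (fourier_sum (\<lambda>x. x) G (\<lambda>g. exp (- (t * \<mu> g))) x) \<le> 1 * norm x"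
      using G(4) that by (intro norm_fourier_sum_le G(1,2)) (auto simp: less_imp_le)
    then show ?thesis by (simp add: explicit)
  qed
  show "(\<lambda>s. discrete_semigroup e lam V (r s) (orth_proj V (f s))) \<in> borel_measurable N"
    if "f \<in> borel_measurable N" "r \<in> borel_measurable N" for f r N
    unfolding explicit using that by (intro borel_measurable_fourier_sum) auto
  fix \<delta> t :: real and x
  assume ritz: "\<And>x. x \<in> hdot e lam 2 \<Longrightarrow> norm (ritz_proj e lam V x - x) \<le> \<delta> * hdot_norm e lam 2 x"
    and "0 \<le> \<delta>" "0 < t"
  let ?K = "fourier_sum (\<lambda>x. x) G (\<lambda>g. exp (- (t * \<mu> g)))"
  have "(\<lambda>n. norm (?K (truncation n x) - fourier_sum e {..<n} (\<lambda>k. exp (- (t * lam k))) x))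
      \<longlonglongrightarrow> norm (?K x - blinfun_apply (S t) x)"
    using \<open>0 < t\<close>
    by (intro tendsto_norm tendsto_diff semigroup_limit bounded_linear.tendsto[OF bounded_linear_fourier_sum]
        truncation_tendsto) auto
  then show "norm (discrete_semigroup e lam V t (orth_proj V x) - blinfun_apply (S t) x) \<le> 14 * \<delta> / t * norm x"
    unfolding explicit
    by (rule LIMSEQ_le_const2)
      (use galerkin_error_truncated[OF assms(2) G form ritz \<open>0 \<le> \<delta>\<close> \<open>0 < t\<close>] in blast)
qed

text \<open>
  The bound 2 from contractivity covers \<open>t \<le> \<eta>\<close>, and \<open>C \<eta> / t\<close> covers \<open>t > \<eta>\<close>.  The single
  majorant \<open>\<eta> / (\<eta> + t)\<close> is bounded, bounded away from zero for \<open>t \<le> T\<close>, and has an elementary primitive.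
\<close>

lemma galerkin_semigroup_error_uniform:
  assumes V: "finite_dim_subspace V" "V \<subseteq> hdot e lam 1"
    and ritz: "\<And>x. x \<in> hdot e lam 2 \<Longrightarrow> norm (ritz_proj e lam V x - x) \<le> C * \<eta> * hdot_norm e lam 2 x"
    and "0 \<le> C" "0 < \<eta>" "0 \<le> t"
  shows "norm (discrete_semigroup e lam V t (orth_proj V x) - blinfun_apply (S t) x)
    \<le> (28 * C + 4) * (\<eta> / (\<eta> + t)) * norm x"
proof (cases "t \<le> \<eta>")
  case True
  have "norm (discrete_semigroup e lam V t (orth_proj V x) - blinfun_apply (S t) x) \<le> norm x + norm x"
    by (rule order_trans[OF norm_triangle_ineq4 add_mono])
      (intro galerkin_semigroup_norm_le V semigroup_norm_le \<open>0 \<le> t\<close>)+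
  also have "\<dots> = 4 * (1 / 2) * norm x" by simp
  also have "\<dots> \<le> (28 * C + 4) * (\<eta> / (\<eta> + t)) * norm x"
    using True assms by (intro mult_right_mono mult_mono) (auto simp: field_simps)
  finally show ?thesis .
next
  case False
  have "norm (discrete_semigroup e lam V t (orth_proj V x) - blinfun_apply (S t) x)
      \<le> 14 * (C * \<eta>) / t * norm x"
    using False assms by (intro galerkin_semigroup_error V ritz) auto
  also have "\<dots> \<le> (28 * C + 4) * (\<eta> / (\<eta> + t)) * norm x"
  proof (rule mult_right_mono)
    have "14 * (C * \<eta>) / t = 14 * C * (\<eta> / t)" by simp
    also have "\<dots> \<le> 14 * C * (2 * (\<eta> / (\<eta> + t)))"
      using False assms by (intro mult_left_mono) (auto simp: field_simps)
    also have "\<dots> \<le> (28 * C + 4) * (\<eta> / (\<eta> + t))"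
      using assms by (simp add: algebra_simps)
    finally show "14 * (C * \<eta>) / t \<le> (28 * C + 4) * (\<eta> / (\<eta> + t))" .
  qed simp
  finally show ?thesis .
qed

end

section \<open>Pairing sums of independent random vectors\<close>

definition square_integrable ::
    "'w measure \<Rightarrow> ('w \<Rightarrow> 'h::{real_inner, banach, second_countable_topology}) \<Rightarrow> bool" where
  "square_integrable M X \<longleftrightarrow> X \<in> borel_measurable M \<and> integrable M (\<lambda>\<omega>. (norm (X \<omega>))\<^sup>2)"

lemma norm_mult_le_half_squares: "norm a * norm b \<le> ((norm a)\<^sup>2 + (norm b)\<^sup>2) / 2"
  using sum_squares_bound[of "norm a" "norm b"] by (simp add: power2_eq_square)

lemma norm_add_square_le: "(norm (x + y))\<^sup>2 \<le> 2 * (norm x)\<^sup>2 + 2 * (norm y)\<^sup>2"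
proof -
  have "(norm (x + y))\<^sup>2 \<le> (norm x + norm y)\<^sup>2" by (intro power_mono norm_triangle_ineq) auto
  also have "\<dots> \<le> 2 * (norm x)\<^sup>2 + 2 * (norm y)\<^sup>2"
    using sum_squares_bound[of "norm x" "norm y"] by (simp add: power2_sum)
  finally show ?thesis .
qed

lemma square_integrable_measurable:
  "square_integrable M X \<Longrightarrow> X \<in> borel_measurable M"
  by (simp add: square_integrable_def)

lemma square_integrable_integrable_mult:
  assumes "square_integrable M X" "square_integrable M Y"
  shows "integrable M (\<lambda>\<omega>. norm (X \<omega>) * norm (Y \<omega>))"
proof (rule Bochner_Integration.integrable_bound)
  show "integrable M (\<lambda>\<omega>. ((norm (X \<omega>))\<^sup>2 + (norm (Y \<omega>))\<^sup>2) / 2)"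
    using assms by (simp add: square_integrable_def)
  have [measurable]: "X \<in> borel_measurable M" "Y \<in> borel_measurable M"
    using assms by (simp_all add: square_integrable_def)
  show "(\<lambda>\<omega>. norm (X \<omega>) * norm (Y \<omega>)) \<in> borel_measurable M" by measurable
  show "AE \<omega> in M. norm (norm (X \<omega>) * norm (Y \<omega>)) \<le> norm (((norm (X \<omega>))\<^sup>2 + (norm (Y \<omega>))\<^sup>2) / 2)"
    using norm_mult_le_half_squares by (intro AE_I2) (simp add: abs_mult)
qed

lemma square_integrable_integrable_inner:
  assumes "square_integrable M X" "square_integrable M Y"
  shows "integrable M (\<lambda>\<omega>. inner (X \<omega>) (Y \<omega>))"
proof (rule Bochner_Integration.integrable_bound[OF square_integrable_integrable_mult[OF assms]])
  have [measurable]: "X \<in> borel_measurable M" "Y \<in> borel_measurable M"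
    using assms by (simp_all add: square_integrable_def)
  show "(\<lambda>\<omega>. inner (X \<omega>) (Y \<omega>)) \<in> borel_measurable M" by measurable
  show "AE \<omega> in M. norm (inner (X \<omega>) (Y \<omega>)) \<le> norm (norm (X \<omega>) * norm (Y \<omega>))"
    by (intro AE_I2) (simp add: Cauchy_Schwarz_ineq2 abs_mult)
qed

lemma square_integrable_bound:
  assumes "square_integrable M X" "Y \<in> borel_measurable M"
    and "\<And>\<omega>. \<omega> \<in> space M \<Longrightarrow> norm (Y \<omega>) \<le> c * norm (X \<omega>)"
  shows "square_integrable M Y"
  unfolding square_integrable_def
proof
  show "integrable M (\<lambda>\<omega>. (norm (Y \<omega>))\<^sup>2)"
  proof (rule Bochner_Integration.integrable_bound)
    show "integrable M (\<lambda>\<omega>. c\<^sup>2 * (norm (X \<omega>))\<^sup>2)" using assms(1) by (simp add: square_integrable_def)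
    show "(\<lambda>\<omega>. (norm (Y \<omega>))\<^sup>2) \<in> borel_measurable M" using assms(2) by measurable
    show "AE \<omega> in M. norm ((norm (Y \<omega>))\<^sup>2) \<le> norm (c\<^sup>2 * (norm (X \<omega>))\<^sup>2)"
    proof (intro AE_I2)
      fix \<omega> assume "\<omega> \<in> space M"
      then have "(norm (Y \<omega>))\<^sup>2 \<le> (c * norm (X \<omega>))\<^sup>2" by (intro power_mono assms) auto
      then show "norm ((norm (Y \<omega>))\<^sup>2) \<le> norm (c\<^sup>2 * (norm (X \<omega>))\<^sup>2)" by (simp add: power_mult_distrib)
    qed
  qed
qed (rule assms)

lemma square_integrable_add:
  assumes "square_integrable M X" "square_integrable M Y"
  shows "square_integrable M (\<lambda>\<omega>. X \<omega> + Y \<omega>)"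
  unfolding square_integrable_def
proof
  have [measurable]: "X \<in> borel_measurable M" "Y \<in> borel_measurable M"
    using assms by (simp_all add: square_integrable_def)
  show "(\<lambda>\<omega>. X \<omega> + Y \<omega>) \<in> borel_measurable M" by measurable
  show "integrable M (\<lambda>\<omega>. (norm (X \<omega> + Y \<omega>))\<^sup>2)"
  proof (rule Bochner_Integration.integrable_bound)
    show "integrable M (\<lambda>\<omega>. 2 * (norm (X \<omega>))\<^sup>2 + 2 * (norm (Y \<omega>))\<^sup>2)"
      using assms by (simp add: square_integrable_def)
    show "AE \<omega> in M. norm ((norm (X \<omega> + Y \<omega>))\<^sup>2) \<le> norm (2 * (norm (X \<omega>))\<^sup>2 + 2 * (norm (Y \<omega>))\<^sup>2)"
      by (intro AE_I2) (simp add: norm_add_square_le)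
  qed measurable
qed

lemma square_integrable_bounded_linear:
  assumes "bounded_linear B" "square_integrable M X"
  shows "square_integrable M (\<lambda>\<omega>. B (X \<omega>))"
proof -
  obtain c where "\<And>x. norm (B x) \<le> norm x * c" using bounded_linear.bounded[OF assms(1)] by blast
  moreover have "(\<lambda>\<omega>. B (X \<omega>)) \<in> borel_measurable M"
    using borel_measurable_continuous_onI[OF linear_continuous_on[OF assms(1)]] assms(2)
    unfolding square_integrable_def by (metis measurable_compose)
  ultimately show ?thesis
    by (intro square_integrable_bound[OF assms(2), of _ c]) (simp_all add: mult.commute)
qed

lemma square_integrable_scaleR:
  "square_integrable M X \<Longrightarrow> square_integrable M (\<lambda>\<omega>. c *\<^sub>R X \<omega>)"
  by (rule square_integrable_bounded_linear[OF bounded_linear_scaleR_right])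

lemma square_integrable_diff:
  assumes "square_integrable M X" "square_integrable M Y"
  shows "square_integrable M (\<lambda>\<omega>. X \<omega> - Y \<omega>)"
  using square_integrable_add[OF assms(1) square_integrable_scaleR[OF assms(2), of "-1"]] by simp

lemma square_integrable_sum:
  assumes "\<And>i. i \<in> I \<Longrightarrow> square_integrable M (X i)"
  shows "square_integrable M (\<lambda>\<omega>. \<Sum>i\<in>I. X i \<omega>)"
  using assms
  by (induction I rule: infinite_finite_induct)
    (auto intro!: square_integrable_add simp: square_integrable_def[of _ "\<lambda>_. 0"])

context prob_space
begin

lemma square_integrable_const: "square_integrable M (\<lambda>_. c)"
  by (simp add: square_integrable_def)

lemma square_integrable_integrable:
  assumes "square_integrable M X"
  shows "integrable M X"
proof -
  have "integrable M (\<lambda>\<omega>. norm (1::real) * norm (X \<omega>))"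
    by (rule square_integrable_integrable_mult[OF square_integrable_const assms])
  then have "integrable M (\<lambda>\<omega>. norm (X \<omega>))" by simp
  then show ?thesis by (rule integrable_norm_cancel[OF _ square_integrable_measurable[OF assms]])
qed

lemma square_integrable_lipschitz:
  assumes "square_integrable M X" "K-lipschitz_on UNIV F"
  shows "square_integrable M (\<lambda>\<omega>. F (X \<omega>))"
proof -
  have F: "continuous_on UNIV F" by (rule lipschitz_on_continuous_on[OF assms(2)])
  have [measurable]: "X \<in> borel_measurable M" using assms(1) by (simp add: square_integrable_def)
  have "square_integrable M (\<lambda>\<omega>. F (X \<omega>) - F 0)"
  proof (rule square_integrable_bound[OF assms(1)])
    show "(\<lambda>\<omega>. F (X \<omega>) - F 0) \<in> borel_measurable M"
      by (intro borel_measurable_diff borel_measurable_continuous_on[OF F]) auto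
    show "norm (F (X \<omega>) - F 0) \<le> K * norm (X \<omega>)" for \<omega>
      using lipschitz_onD[OF assms(2), of "X \<omega>" 0] by (simp add: dist_norm)
  qed
  from square_integrable_add[OF this square_integrable_const[of "F 0"]] show ?thesis by simp
qed

text \<open>
  Fubini for the joint law, which is the product of the marginal laws.
\<close>

lemma expectation_indep_var_iterated:
  fixes h :: "_ \<Rightarrow> real"
  assumes indep: "indep_var S X T Y" and h: "h \<in> borel_measurable (S \<Otimes>\<^sub>M T)"
    and int: "integrable M (\<lambda>\<omega>. h (X \<omega>, Y \<omega>))"
  shows "expectation (\<lambda>\<omega>. h (X \<omega>, Y \<omega>)) = expectation (\<lambda>\<omega>. expectation (\<lambda>\<omega>'. h (X \<omega>, Y \<omega>')))"
proof -
  have X: "X \<in> M \<rightarrow>\<^sub>M S" and Y: "Y \<in> M \<rightarrow>\<^sub>M T"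
    and eq: "distr M S X \<Otimes>\<^sub>M distr M T Y = distr M (S \<Otimes>\<^sub>M T) (\<lambda>\<omega>. (X \<omega>, Y \<omega>))"
    using indep unfolding indep_var_distribution_eq by auto
  interpret X: prob_space "distr M S X" by (rule prob_space_distr[OF X])
  interpret Y: prob_space "distr M T Y" by (rule prob_space_distr[OF Y])
  interpret XY: pair_sigma_finite "distr M S X" "distr M T Y" ..
  have XY: "(\<lambda>\<omega>. (X \<omega>, Y \<omega>)) \<in> M \<rightarrow>\<^sub>M S \<Otimes>\<^sub>M T" using X Y by simp
  have inth: "integrable (distr M S X \<Otimes>\<^sub>M distr M T Y) h"
    unfolding eq using int by (subst integrable_distr_eq[OF XY h])
  have "expectation (\<lambda>\<omega>. h (X \<omega>, Y \<omega>)) = integral\<^sup>L (distr M S X \<Otimes>\<^sub>M distr M T Y) h"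
    unfolding eq by (rule integral_distr[OF XY h, symmetric])
  also have "\<dots> = (\<integral>x. (\<integral>y. h (x, y) \<partial>distr M T Y) \<partial>distr M S X)"
    by (rule XY.integral_fst'[OF inth, symmetric])
  also have "\<dots> = (\<integral>x. (\<integral>\<omega>'. h (x, Y \<omega>') \<partial>M) \<partial>distr M S X)"
  proof (rule Bochner_Integration.integral_cong[OF refl])
    fix x assume "x \<in> space (distr M S X)"
    then have "(\<lambda>y. h (x, y)) \<in> borel_measurable T" using h by simp
    then show "(\<integral>y. h (x, y) \<partial>distr M T Y) = (\<integral>\<omega>'. h (x, Y \<omega>') \<partial>M)"
      by (rule integral_distr[OF Y])
  qed
  also have "\<dots> = expectation (\<lambda>\<omega>. expectation (\<lambda>\<omega>'. h (X \<omega>, Y \<omega>')))"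
  proof (rule integral_distr[OF X])
    have "(\<lambda>(x, \<omega>'). h (x, Y \<omega>')) \<in> borel_measurable (S \<Otimes>\<^sub>M M)"
      using h Y by measurable
    then show "(\<lambda>x. \<integral>\<omega>'. h (x, Y \<omega>') \<partial>M) \<in> borel_measurable S"
      by (rule borel_measurable_lebesgue_integral)
  qed
  finally show ?thesis .
qed

text \<open>
  Integrating out \<open>(P, Q)\<close> replaces \<open>F\<close> by its average \<open>F'\<close> over the law of \<open>P\<close>, which has the same Lipschitz
  constant.  In the term with \<open>Q\<close>, the expectation of \<open>\<langle>F(W), Q\<rangle>\<close> vanishes, so that
  \<open>F(W + P)\<close> may be replaced by \<open>F(W + P) - F(W)\<close>, which is at most \<open>K\<close> times the norm of \<open>P\<close>.
\<close>

lemma pairing_with_independent_increment: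
  fixes W Z P Q :: "'a \<Rightarrow> 'h::{real_inner, banach, second_countable_topology}"
  assumes sq: "square_integrable M W" "square_integrable M Z" "square_integrable M P" "square_integrable M Q"
    and indep: "indep_var borel (\<lambda>\<omega>. (W \<omega>, Z \<omega>)) borel (\<lambda>\<omega>. (P \<omega>, Q \<omega>))"
    and centred: "expectation Q = 0"
    and F: "K-lipschitz_on UNIV F"
  defines "F' \<equiv> \<lambda>w. expectation (\<lambda>\<omega>. F (w + P \<omega>))"
  shows "K-lipschitz_on UNIV F'"
    and "\<bar>expectation (\<lambda>\<omega>. inner (F (W \<omega> + P \<omega>)) (Z \<omega> + Q \<omega>))\<bar>
      \<le> \<bar>expectation (\<lambda>\<omega>. inner (F' (W \<omega>)) (Z \<omega>))\<bar> + K * expectation (\<lambda>\<omega>. norm (P \<omega>) * norm (Q \<omega>))"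
proof -
  have [measurable]: "W \<in> borel_measurable M" "Z \<in> borel_measurable M" "P \<in> borel_measurable M"
    "Q \<in> borel_measurable M"
    using sq by (simp_all add: square_integrable_def)
  have F_cont: "continuous_on UNIV F" by (rule lipschitz_on_continuous_on[OF F])
  have [measurable]: "F \<in> borel_measurable borel" by (rule borel_measurable_continuous_onI[OF F_cont])
  have K: "0 \<le> K" using F by (rule lipschitz_on_nonneg)
  have lip: "norm (F x - F y) \<le> K * norm (x - y)" for x y
    using lipschitz_onD[OF F, of x y] by (simp add: dist_norm)
  have shifted: "square_integrable M (\<lambda>\<omega>. F (w + P \<omega>))" for w
    by (intro square_integrable_lipschitz[OF _ F] square_integrable_add square_integrable_const sq)
  show lip': "K-lipschitz_on UNIV F'"
  proof (rule lipschitz_onI)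
    fix x y :: 'h
    have "F' x - F' y = expectation (\<lambda>\<omega>. F (x + P \<omega>) - F (y + P \<omega>))"
      unfolding F'_def by (intro Bochner_Integration.integral_diff[symmetric] square_integrable_integrable shifted)
    also have "norm \<dots> \<le> expectation (\<lambda>\<omega>. norm (F (x + P \<omega>) - F (y + P \<omega>)))"
      by (rule integral_norm_bound)
    also have "\<dots> \<le> expectation (\<lambda>_. K * norm (x - y))"
    proof (rule integral_mono)
      show "integrable M (\<lambda>\<omega>. norm (F (x + P \<omega>) - F (y + P \<omega>)))"
        by (intro integrable_norm square_integrable_integrable square_integrable_diff shifted)
      show "norm (F (x + P \<omega>) - F (y + P \<omega>)) \<le> K * norm (x - y)" for \<omega>
        using lip[of "x + P \<omega>" "y + P \<omega>"] by simp
    qed simp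
    finally show "dist (F' x) (F' y) \<le> K * dist x y" by (simp add: dist_norm prob_space)
  qed (rule K)
  have FWP: "square_integrable M (\<lambda>\<omega>. F (W \<omega> + P \<omega>))" and FW: "square_integrable M (\<lambda>\<omega>. F (W \<omega>))"
    by (intro square_integrable_lipschitz[OF _ F] square_integrable_add sq)+
  have 1: "expectation (\<lambda>\<omega>. inner (F (W \<omega> + P \<omega>)) (Z \<omega>)) = expectation (\<lambda>\<omega>. inner (F' (W \<omega>)) (Z \<omega>))"
  proof -
    have "(\<lambda>x. inner (F (fst (fst x) + fst (snd x))) (snd (fst x))) \<in> borel_measurable
        (((borel :: 'h measure) \<Otimes>\<^sub>M (borel :: 'h measure)) \<Otimes>\<^sub>M ((borel :: 'h measure) \<Otimes>\<^sub>M (borel :: 'h measure)))"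
      by measurable
    then have "expectation (\<lambda>\<omega>. inner (F (W \<omega> + P \<omega>)) (Z \<omega>))
      = expectation (\<lambda>\<omega>. expectation (\<lambda>\<omega>'. inner (F (W \<omega> + P \<omega>')) (Z \<omega>)))"
      using expectation_indep_var_iterated[OF indep, of "\<lambda>x. inner (F (fst (fst x) + fst (snd x))) (snd (fst x))"]
        square_integrable_integrable_inner[OF FWP sq(2)]
      by (simp add: borel_prod[symmetric] split_beta)
    then show ?thesis
      unfolding F'_def using square_integrable_integrable[OF shifted] by simp
  qed
  have 2: "expectation (\<lambda>\<omega>. inner (F (W \<omega>)) (Q \<omega>)) = 0"
  proof -
    have "(\<lambda>x. inner (F (fst (fst x))) (snd (snd x))) \<in> borel_measurable
        (((borel :: 'h measure) \<Otimes>\<^sub>M (borel :: 'h measure)) \<Otimes>\<^sub>M ((borel :: 'h measure) \<Otimes>\<^sub>M (borel :: 'h measure)))"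
      by measurable
    then have "expectation (\<lambda>\<omega>. inner (F (W \<omega>)) (Q \<omega>))
      = expectation (\<lambda>\<omega>. expectation (\<lambda>\<omega>'. inner (F (W \<omega>)) (Q \<omega>')))"
      using expectation_indep_var_iterated[OF indep, of "\<lambda>x. inner (F (fst (fst x))) (snd (snd x))"]
        square_integrable_integrable_inner[OF FW sq(4)]
      by (simp add: borel_prod[symmetric] split_beta)
    then show ?thesis
      using square_integrable_integrable[OF sq(4)] by (simp add: centred)
  qed
  have diff: "square_integrable M (\<lambda>\<omega>. F (W \<omega> + P \<omega>) - F (W \<omega>))"
    by (intro square_integrable_diff FWP FW)
  have 3: "\<bar>expectation (\<lambda>\<omega>. inner (F (W \<omega> + P \<omega>) - F (W \<omega>)) (Q \<omega>))\<bar>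
      \<le> K * expectation (\<lambda>\<omega>. norm (P \<omega>) * norm (Q \<omega>))"
  proof -
    have "\<bar>expectation (\<lambda>\<omega>. inner (F (W \<omega> + P \<omega>) - F (W \<omega>)) (Q \<omega>))\<bar>
        \<le> expectation (\<lambda>\<omega>. K * (norm (P \<omega>) * norm (Q \<omega>)))"
    proof (rule order_trans[OF integral_abs_bound integral_mono])
      show "integrable M (\<lambda>\<omega>. \<bar>inner (F (W \<omega> + P \<omega>) - F (W \<omega>)) (Q \<omega>)\<bar>)"
        by (intro integrable_abs square_integrable_integrable_inner diff sq)
      show "integrable M (\<lambda>\<omega>. K * (norm (P \<omega>) * norm (Q \<omega>)))"
        by (intro integrable_mult_right square_integrable_integrable_mult sq)
      fix \<omega>
      have "\<bar>inner (F (W \<omega> + P \<omega>) - F (W \<omega>)) (Q \<omega>)\<bar> \<le> norm (F (W \<omega> + P \<omega>) - F (W \<omega>)) * norm (Q \<omega>)"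
        by (rule Cauchy_Schwarz_ineq2)
      also have "\<dots> \<le> (K * norm (P \<omega>)) * norm (Q \<omega>)"
        using lip[of "W \<omega> + P \<omega>" "W \<omega>"] by (intro mult_right_mono) auto
      finally show "\<bar>inner (F (W \<omega> + P \<omega>) - F (W \<omega>)) (Q \<omega>)\<bar> \<le> K * (norm (P \<omega>) * norm (Q \<omega>))"
        by (simp add: mult.assoc)
    qed
    then show ?thesis by simp
  qed
  have "expectation (\<lambda>\<omega>. inner (F (W \<omega> + P \<omega>)) (Z \<omega> + Q \<omega>))
    = expectation (\<lambda>\<omega>. inner (F (W \<omega> + P \<omega>)) (Z \<omega>)
        + (inner (F (W \<omega> + P \<omega>) - F (W \<omega>)) (Q \<omega>) + inner (F (W \<omega>)) (Q \<omega>)))"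
    by (simp add: inner_add_right inner_diff_left)
  also have "\<dots> = expectation (\<lambda>\<omega>. inner (F (W \<omega> + P \<omega>)) (Z \<omega>))
      + (expectation (\<lambda>\<omega>. inner (F (W \<omega> + P \<omega>) - F (W \<omega>)) (Q \<omega>)) + expectation (\<lambda>\<omega>. inner (F (W \<omega>)) (Q \<omega>)))"
    using FWP FW diff sq
    by (simp only: Bochner_Integration.integral_add Bochner_Integration.integrable_add
        square_integrable_integrable_inner)
  finally show "\<bar>expectation (\<lambda>\<omega>. inner (F (W \<omega> + P \<omega>)) (Z \<omega> + Q \<omega>))\<bar>
      \<le> \<bar>expectation (\<lambda>\<omega>. inner (F' (W \<omega>)) (Z \<omega>))\<bar> + K * expectation (\<lambda>\<omega>. norm (P \<omega>) * norm (Q \<omega>))"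
    using 1 2 3 by linarith
qed

text \<open>
  The last increment is integrated out and the induction hypothesis applied to the averaged function; this is
  why \<open>F\<close> is arbitrary in the induction.  Off-diagonal products \<open>P i\<close>, \<open>Q j\<close> leave no trace in the bound.
\<close>

lemma pairing_of_independent_sums:
  fixes P Q :: "nat \<Rightarrow> 'a \<Rightarrow> 'h::{real_inner, banach, second_countable_topology}"
  assumes "\<And>j. j < n \<Longrightarrow> square_integrable M (P j)" "\<And>j. j < n \<Longrightarrow> square_integrable M (Q j)"
    and "\<And>j. j < n \<Longrightarrow> expectation (Q j) = 0"
    and "\<And>j. j < n \<Longrightarrow> indep_var borel (\<lambda>\<omega>. (\<Sum>i<j. P i \<omega>, \<Sum>i<j. Q i \<omega>)) borel (\<lambda>\<omega>. (P j \<omega>, Q j \<omega>))"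
    and "K-lipschitz_on UNIV F"
  shows "\<bar>expectation (\<lambda>\<omega>. inner (F (\<Sum>i<n. P i \<omega>)) (\<Sum>i<n. Q i \<omega>))\<bar>
    \<le> K * (\<Sum>i<n. expectation (\<lambda>\<omega>. norm (P i \<omega>) * norm (Q i \<omega>)))"
  using assms
proof (induction n arbitrary: F)
  case 0
  then show ?case by simp
next
  case (Suc n)
  let ?F' = "\<lambda>w. expectation (\<lambda>\<omega>. F (w + P n \<omega>))"
  have sq: "square_integrable M (\<lambda>\<omega>. \<Sum>i<n. P i \<omega>)" "square_integrable M (\<lambda>\<omega>. \<Sum>i<n. Q i \<omega>)"
    by (intro square_integrable_sum Suc.prems; simp)+
  note step = pairing_with_independent_increment[OF sq Suc.prems(1)[of n] Suc.prems(2)[of n]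
      Suc.prems(4)[of n] Suc.prems(3)[of n] Suc.prems(5), simplified]
  have "\<bar>expectation (\<lambda>\<omega>. inner (?F' (\<Sum>i<n. P i \<omega>)) (\<Sum>i<n. Q i \<omega>))\<bar>
      \<le> K * (\<Sum>i<n. expectation (\<lambda>\<omega>. norm (P i \<omega>) * norm (Q i \<omega>)))"
    by (rule Suc.IH[OF Suc.prems(1,2,3,4) step(1)]) auto
  then show ?case using step(2) by (simp add: distrib_left)
qed

end

section \<open>Mean squares of increments of the noise\<close>

text \<open>
  The orthonormal basis of the target space belongs to the locale because second moments of \<open>H\<close>-valued
  integrals are computed coordinatewise.
\<close>

locale levy_noise = prob_space M + hilbert_basis e
  for M :: "'w measure" and e :: "nat \<Rightarrow> 'h::{real_inner, banach, second_countable_topology}" +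
  fixes T :: real and F :: "real \<Rightarrow> 'w measure"
    and L :: "real \<Rightarrow> 'w \<Rightarrow> 'u::{real_inner, banach, second_countable_topology}"
    and Q :: "'u \<Rightarrow>\<^sub>L 'u"
  assumes T_pos: "0 < T"
    and filtration: "usual_filtration M T F"
    and levy: "levy_process M T F L"
    and centred: "square_integrable_centred M T L"
    and covariance: "covariance_operator M T L Q"
begin

lemma levy_measurable_filtration:
  assumes "0 \<le> s" "s \<le> t" "t \<le> T"
  shows "L s \<in> borel_measurable (F t)"
proof -
  have "L s \<in> borel_measurable (F s)" using levy assms by (simp add: levy_process_def)
  moreover have "subalgebra (F t) (F s)"
    using filtration assms by (auto simp: usual_filtration_def subalgebra_def)
  ultimately show ?thesis by (rule measurable_from_subalg[rotated])
qed

lemma subalgebra_filtration: "0 \<le> t \<Longrightarrow> t \<le> T \<Longrightarrow> subalgebra M (F t)"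
  using filtration by (simp add: usual_filtration_def)

lemma levy_square_integrable:
  assumes "0 \<le> t" "t \<le> T"
  shows "square_integrable M (L t)"
  using measurable_from_subalg[OF subalgebra_filtration levy_measurable_filtration[of t t]] assms centred
  by (auto simp: square_integrable_def square_integrable_centred_def)

lemma levy_expectation: "0 \<le> t \<Longrightarrow> t \<le> T \<Longrightarrow> expectation (L t) = 0"
  using centred by (simp add: square_integrable_centred_def)

lemma increment_square_integrable:
  assumes "0 \<le> s" "s \<le> T" "0 \<le> t" "t \<le> T" "bounded_linear B"
  shows "square_integrable M (\<lambda>\<omega>. B (L t \<omega> - L s \<omega>))"
  by (rule square_integrable_bounded_linear[OF assms(5)], intro square_integrable_diff levy_square_integrable assms)

lemma increment_expectation:
  fixes B :: "'u \<Rightarrow> 'h"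
  assumes "0 \<le> s" "s \<le> T" "0 \<le> t" "t \<le> T" "bounded_linear B"
  shows "expectation (\<lambda>\<omega>. B (L t \<omega> - L s \<omega>)) = 0"
proof -
  have int: "integrable M (L t)" "integrable M (L s)"
    using assms by (auto intro: square_integrable_integrable levy_square_integrable)
  have "expectation (\<lambda>\<omega>. B (L t \<omega> - L s \<omega>)) = B (expectation (\<lambda>\<omega>. L t \<omega> - L s \<omega>))"
    using int by (intro integral_bounded_linear assms Bochner_Integration.integrable_diff)
  also have "expectation (\<lambda>\<omega>. L t \<omega> - L s \<omega>) = 0"
    using int assms by (simp add: levy_expectation)
  finally show ?thesis using assms(5) by (simp add: linear_simps)
qed

text \<open>
  Independence of the increment from the past is a statement about \<open>\<sigma>\<close>-algebras; it passes to functions of the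
  increment and variables measurable with respect to the past.
\<close>

lemma increment_independent:
  fixes Y :: "'w \<Rightarrow> 'b::topological_space" and B :: "'u \<Rightarrow> 'b"
  assumes "0 \<le> s" "s < t" "t \<le> T" "Y \<in> borel_measurable (F s)" "B \<in> borel_measurable borel"
  shows "indep_var borel Y borel (\<lambda>\<omega>. B (L t \<omega> - L s \<omega>))"
proof -
  have sub: "subalgebra M (F s)" using assms by (intro subalgebra_filtration) auto
  have [measurable]: "L t \<in> borel_measurable M" "L s \<in> borel_measurable M"
    using assms by (auto intro!: square_integrable_measurable levy_square_integrable)
  note [measurable] = assms(5)
  have Y: "random_variable borel Y" by (rule measurable_from_subalg[OF sub assms(4)])
  have B: "random_variable borel (\<lambda>\<omega>. B (L t \<omega> - L s \<omega>))" by measurable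
  have vimage: "sigma_sets (space M) {X -` A \<inter> space M | A. A \<in> sets borel} = {X -` A \<inter> space M | A. A \<in> sets borel}"
    for X :: "'w \<Rightarrow> 'b"
    using sigma_sets_vimage_commute[of X "space M" "space borel" "sets borel"]
    unfolding sets.sigma_sets_eq by simp
  have indep: "indep_set (sets (F s)) {(\<lambda>\<omega>. L t \<omega> - L s \<omega>) -` A \<inter> space M | A. A \<in> sets borel}"
    using levy assms by (simp add: levy_process_def)
  have "indep_set {Y -` A \<inter> space M | A. A \<in> sets borel}
      {(\<lambda>\<omega>. B (L t \<omega> - L s \<omega>)) -` A \<inter> space M | A. A \<in> sets borel}"
    unfolding indep_sets2_eq
  proof (intro conjI ballI)
    fix a b assume "a \<in> {Y -` A \<inter> space M | A. A \<in> sets borel}"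
      and "b \<in> {(\<lambda>\<omega>. B (L t \<omega> - L s \<omega>)) -` A \<inter> space M | A. A \<in> sets borel}"
    then obtain A A' where a: "a = Y -` A \<inter> space M" "A \<in> sets borel"
      and b: "b = (\<lambda>\<omega>. B (L t \<omega> - L s \<omega>)) -` A' \<inter> space M" "A' \<in> sets borel" by blast
    have "a \<in> sets (F s)"
      using measurable_sets[OF assms(4) a(2)] sub a(1) by (simp add: subalgebra_def)
    moreover have "b = (\<lambda>\<omega>. L t \<omega> - L s \<omega>) -` (B -` A') \<inter> space M" using b(1) by auto
    moreover have "B -` A' \<in> sets borel" using measurable_sets[OF assms(5) b(2)] by simp
    ultimately show "prob (a \<inter> b) = prob a * prob b" using indep_setD[OF indep] by blast
  qed (use measurable_sets[OF Y] measurable_sets[OF B] in auto)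
  then show ?thesis unfolding indep_var_eq vimage using Y B by simp
qed

text \<open>
  For bounded linear \<open>B\<close> this is the squared Hilbert-Schmidt norm of \<open>B Q\<^sup>1\<^sup>/\<^sup>2\<close>.  The moment is used as the definition because it
  mentions neither \<open>Q\<close> nor a square root of it, so that integrals whose approximations were measured with
  different square roots can be compared.
\<close>

definition mean_square :: "('u \<Rightarrow> 'h) \<Rightarrow> real" where
  "mean_square B = expectation (\<lambda>\<omega>. (norm (B (L T \<omega>)))\<^sup>2) / T"

lemma mean_square_nonneg: "0 \<le> mean_square B"
  unfolding mean_square_def using T_pos by (intro divide_nonneg_pos integral_nonneg_AE) auto

text \<open>
  Parseval's identity in \<open>H\<close> reduces the second moment of \<open>B (L t)\<close> to those of the real variables
  \<open>\<langle>L t, b k\<rangle>\<close>, which are given by the covariance operator; \<open>b k\<close> is the adjoint of \<open>B\<close> at \<open>e k\<close>.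
\<close>

lemma expectation_levy_square_series:
  fixes B :: "'u \<Rightarrow> 'h"
  assumes "0 \<le> t" "t \<le> T" "bounded_linear B" "\<And>u k. inner (B u) (e k) = inner u (b k)"
  shows "ennreal (expectation (\<lambda>\<omega>. (norm (B (L t \<omega>)))\<^sup>2)) =
    ennreal t * (\<Sum>k. ennreal (inner (blinfun_apply Q (b k)) (b k)))"
proof -
  have sq: "square_integrable M (\<lambda>\<omega>. B (L t \<omega>))"
    by (rule square_integrable_bounded_linear[OF assms(3) levy_square_integrable[OF assms(1,2)]])
  have cov: "expectation (\<lambda>\<omega>. (inner (L t \<omega>) (b k))\<^sup>2) = t * inner (blinfun_apply Q (b k)) (b k)"
    if "0 \<le> t" "t \<le> T" for k t
    using covariance that by (simp add: covariance_operator_def power2_eq_square)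
  have int: "integrable M (\<lambda>\<omega>. (inner (L t \<omega>) (b k))\<^sup>2)" for k
  proof -
    have "square_integrable M (\<lambda>\<omega>. inner (L t \<omega>) (b k))"
      by (rule square_integrable_bounded_linear[OF bounded_linear_inner_left levy_square_integrable[OF assms(1,2)]])
    then show ?thesis by (simp add: square_integrable_def)
  qed
  have [measurable]: "L t \<in> borel_measurable M"
    using assms by (intro square_integrable_measurable levy_square_integrable)
  have "ennreal (expectation (\<lambda>\<omega>. (norm (B (L t \<omega>)))\<^sup>2)) = (\<integral>\<^sup>+\<omega>. ennreal ((norm (B (L t \<omega>)))\<^sup>2) \<partial>M)"
    using sq by (intro nn_integral_eq_integral[symmetric]) (auto simp: square_integrable_def)
  also have "\<dots> = (\<integral>\<^sup>+\<omega>. (\<Sum>k. ennreal ((inner (L t \<omega>) (b k))\<^sup>2)) \<partial>M)"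
  proof (rule nn_integral_cong)
    fix \<omega>
    have "(\<lambda>k. (inner (B (L t \<omega>)) (e k))\<^sup>2) sums (norm (B (L t \<omega>)))\<^sup>2" by (rule parseval)
    then have "(\<lambda>k. (inner (L t \<omega>) (b k))\<^sup>2) sums (norm (B (L t \<omega>)))\<^sup>2" by (simp only: assms(4))
    then show "ennreal ((norm (B (L t \<omega>)))\<^sup>2) = (\<Sum>k. ennreal ((inner (L t \<omega>) (b k))\<^sup>2))"
      by (subst suminf_ennreal2) (auto simp: sums_iff)
  qed
  also have "\<dots> = (\<Sum>k. (\<integral>\<^sup>+\<omega>. ennreal ((inner (L t \<omega>) (b k))\<^sup>2) \<partial>M))"
    by (rule nn_integral_suminf) measurable
  also have "\<dots> = (\<Sum>k. ennreal t * ennreal (inner (blinfun_apply Q (b k)) (b k)))"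
  proof (rule suminf_cong)
    fix k
    have "0 \<le> expectation (\<lambda>\<omega>. (inner (L T \<omega>) (b k))\<^sup>2)" by simp
    then have "0 \<le> T * inner (blinfun_apply Q (b k)) (b k)" using cov[of T] T_pos by simp
    then have "0 \<le> inner (blinfun_apply Q (b k)) (b k)" using T_pos by (simp add: zero_le_mult_iff)
    then show "(\<integral>\<^sup>+\<omega>. ennreal ((inner (L t \<omega>) (b k))\<^sup>2) \<partial>M) = ennreal t * ennreal (inner (blinfun_apply Q (b k)) (b k))"
      using int cov[OF assms(1,2)] assms(1) by (subst nn_integral_eq_integral) (auto simp: ennreal_mult)
  qed
  also have "\<dots> = ennreal t * (\<Sum>k. ennreal (inner (blinfun_apply Q (b k)) (b k)))"
    by (rule ennreal_suminf_cmult)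
  finally show ?thesis .
qed

lemma adjoint_coefficients:
  fixes B :: "'u \<Rightarrow> 'h"
  assumes "bounded_linear B"
  obtains b where "\<And>u k. inner (B u) (e k) = inner u (b k)"
proof -
  have "\<forall>k. \<exists>b. \<forall>u. inner (B u) (e k) = inner u b"
    using riesz_representation[OF bounded_linear_compose[OF bounded_linear_inner_left assms]] by blast
  then show thesis using that by metis
qed

lemma mean_square_series:
  assumes "bounded_linear B" "\<And>u k. inner (B u) (e k) = inner u (b k)"
  shows "ennreal (mean_square B) = (\<Sum>k. ennreal (inner (blinfun_apply Q (b k)) (b k)))"
    (is "_ = ?S")
proof -
  have "ennreal T * ?S = ennreal T * ennreal (mean_square B)"
    using expectation_levy_square_series[OF _ order_refl assms] T_pos mean_square_nonneg[of B]
    by (simp add: ennreal_mult[symmetric] mean_square_def)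
  then show ?thesis using T_pos by (simp add: ennreal_mult_cancel_left)
qed

lemma expectation_levy_square:
  assumes "0 \<le> t" "t \<le> T" "bounded_linear B"
  shows "expectation (\<lambda>\<omega>. (norm (B (L t \<omega>)))\<^sup>2) = t * mean_square B"
proof -
  obtain b where b: "\<And>u k. inner (B u) (e k) = inner u (b k)"
    using adjoint_coefficients[OF assms(3)] by blast
  have "ennreal (expectation (\<lambda>\<omega>. (norm (B (L t \<omega>)))\<^sup>2)) = ennreal (t * mean_square B)"
    unfolding expectation_levy_square_series[OF assms b] mean_square_series[OF assms(3) b, symmetric]
    using assms(1) mean_square_nonneg by (simp add: ennreal_mult)
  then show ?thesis using assms(1) mean_square_nonneg by (simp add: integral_nonneg_AE)
qed

text \<open>
  By stationarity the increment has the law of \<open>L (t - s)\<close>, whose second moments are linear in time.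
\<close>

lemma expectation_increment_square:
  assumes "0 \<le> s" "s \<le> t" "t \<le> T" "bounded_linear B"
  shows "expectation (\<lambda>\<omega>. (norm (B (L t \<omega> - L s \<omega>)))\<^sup>2) = (t - s) * mean_square B"
proof -
  have [measurable]: "L r \<in> borel_measurable M" if "0 \<le> r" "r \<le> T" for r
    using that by (intro square_integrable_measurable levy_square_integrable)
  have [measurable]: "B \<in> borel_measurable borel"
    by (rule borel_measurable_continuous_onI[OF linear_continuous_on[OF assms(4)]])
  have stationary: "\<forall>s\<in>{0..T}. \<forall>t\<in>{s..T}.
      distr M borel (\<lambda>\<omega>. L t \<omega> - L s \<omega>) = distr M borel (\<lambda>\<omega>. L (t - s) \<omega> - L 0 \<omega>)"
    using levy unfolding levy_process_def by blast
  let ?g = "\<lambda>u. (norm (B u))\<^sup>2"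
  have "expectation (\<lambda>\<omega>. ?g (L t \<omega> - L s \<omega>)) = integral\<^sup>L (distr M borel (\<lambda>\<omega>. L t \<omega> - L s \<omega>)) ?g"
    using assms by (intro integral_distr[symmetric]) auto
  also have "distr M borel (\<lambda>\<omega>. L t \<omega> - L s \<omega>) = distr M borel (\<lambda>\<omega>. L (t - s) \<omega> - L 0 \<omega>)"
    by (rule stationary[rule_format]) (use assms in auto)
  also have "integral\<^sup>L \<dots> ?g = expectation (\<lambda>\<omega>. ?g (L (t - s) \<omega> - L 0 \<omega>))"
    using assms T_pos by (intro integral_distr) auto
  also have "\<dots> = expectation (\<lambda>\<omega>. ?g (L (t - s) \<omega>))"
  proof (rule integral_cong_AE)
    have "AE \<omega> in M. L 0 \<omega> = 0" using levy by (simp add: levy_process_def)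
    then show "AE \<omega> in M. ?g (L (t - s) \<omega> - L 0 \<omega>) = ?g (L (t - s) \<omega>)" by eventually_elim simp
  qed (use assms T_pos in auto)
  also have "\<dots> = (t - s) * mean_square B"
    using assms by (intro expectation_levy_square) auto
  finally show ?thesis .
qed

text \<open>
  Partial sums of the series \<open>\<Sum>k. (norm (R (b k)))\<^sup>2\<close> involve finitely many vectors \<open>R (b k)\<close>, which lie in the span of
  a finite orthonormal set.  Expanding in this set and using Bessel's inequality in \<open>H\<close> gives one of the sums in
  the supremum.
\<close>

lemma mean_square_le_hs_norm_sq:
  assumes "bounded_linear B" "operator_sqrt Q R"
  shows "ennreal (mean_square B) \<le> hs_norm_sq (\<lambda>u. B (blinfun_apply R u))"
proof -
  obtain b where b: "\<And>u k. inner (B u) (e k) = inner u (b k)"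
    using adjoint_coefficients[OF assms(1)] by blast
  have R: "R o\<^sub>L R = Q" "\<And>x y. inner (blinfun_apply R x) y = inner x (blinfun_apply R y)"
    using assms(2) by (auto simp: operator_sqrt_def)
  have q: "inner (blinfun_apply Q x) x = (norm (blinfun_apply R x))\<^sup>2" for x
    by (simp add: R(1)[symmetric] R(2) power2_norm_eq_inner)
  have partial: "(\<Sum>k<n. ennreal (inner (blinfun_apply Q (b k)) (b k))) \<le> hs_norm_sq (\<lambda>u. B (blinfun_apply R u))" for n
  proof -
    have "finite ((\<lambda>k. blinfun_apply R (b k)) ` {..<n})" by simp
    then obtain E where E: "finite E" "span E = span ((\<lambda>k. blinfun_apply R (b k)) ` {..<n})"
      "orthonormal_family (\<lambda>x. x) E"
      using orthonormal_basis_exists by blast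
    have "inner (blinfun_apply Q (b k)) (b k) = (\<Sum>u\<in>E. (inner (B (blinfun_apply R u)) (e k))\<^sup>2)" if "k < n" for k
    proof -
      have "blinfun_apply R (b k) \<in> span ((\<lambda>x. x) ` E)" using that by (auto simp: E(2) intro: span_base)
      from fourier_sum_span[OF E(1,3) this]
      have "(norm (blinfun_apply R (b k)))\<^sup>2 = (norm (\<Sum>u\<in>E. inner (blinfun_apply R (b k)) u *\<^sub>R u))\<^sup>2"
        by (simp add: fourier_sum_def)
      also have "\<dots> = (\<Sum>u\<in>E. (inner (blinfun_apply R (b k)) u)\<^sup>2)"
        by (rule norm_orthonormal_sum[OF E(1,3)])
      also have "\<dots> = (\<Sum>u\<in>E. (inner (B (blinfun_apply R u)) (e k))\<^sup>2)"
        unfolding b by (simp only: R(2) inner_commute[of "b k"])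
      finally show ?thesis unfolding q .
    qed
    then have "(\<Sum>k<n. ennreal (inner (blinfun_apply Q (b k)) (b k)))
        = ennreal (\<Sum>k<n. \<Sum>u\<in>E. (inner (B (blinfun_apply R u)) (e k))\<^sup>2)"
      by (subst sum_ennreal) (auto simp: sum_nonneg)
    also have "(\<Sum>k<n. \<Sum>u\<in>E. (inner (B (blinfun_apply R u)) (e k))\<^sup>2)
        \<le> (\<Sum>u\<in>E. (norm (B (blinfun_apply R u)))\<^sup>2)"
      by (subst sum.swap) (intro sum_mono bessel_inequality finite_lessThan orthonormal_on)
    also have "ennreal \<dots> = (\<Sum>u\<in>E. ennreal ((norm (B (blinfun_apply R u)))\<^sup>2))"
      by (subst sum_ennreal) auto
    also have "\<dots> \<le> hs_norm_sq (\<lambda>u. B (blinfun_apply R u))"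
      unfolding hs_norm_sq_def using E(1,3)
      by (intro SUP_upper) (auto simp: orthonormal_family_def norm_eq_1 pairwise_def orthogonal_def)
    finally show ?thesis by (simp add: ennreal_leI)
  qed
  have "(\<Sum>k. ennreal (inner (blinfun_apply Q (b k)) (b k))) \<le> hs_norm_sq (\<lambda>u. B (blinfun_apply R u))"
    unfolding suminf_eq_SUP by (rule SUP_least) (rule partial)
  then show ?thesis by (simp add: mean_square_series[OF assms(1) b])
qed

end

section \<open>Elementary integrals on a grid\<close>

lemma elementary_integrand_append:
  "elementary_integrand (xs @ ys) s u = elementary_integrand xs s u + elementary_integrand ys s u"
  by (simp add: elementary_integrand_def)

lemma elementary_integral_append:
  "elementary_integral L (xs @ ys) \<omega> = elementary_integral L xs \<omega> + elementary_integral L ys \<omega>"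
  by (simp add: elementary_integral_def)

lemma elementary_on_append: "elementary_on t (xs @ ys) \<longleftrightarrow> elementary_on t xs \<and> elementary_on t ys"
  by (simp add: elementary_on_def ball_Un)

definition scale_elementary ::
    "real \<Rightarrow> (real \<times> real \<times> ('u::real_normed_vector \<Rightarrow>\<^sub>L 'h::real_normed_vector)) list \<Rightarrow>
     (real \<times> real \<times> ('u \<Rightarrow>\<^sub>L 'h)) list" where
  "scale_elementary c xs = map (\<lambda>(a, b, \<Phi>). (a, b, c *\<^sub>R \<Phi>)) xs"

lemma elementary_integrand_scale:
  "elementary_integrand (scale_elementary c xs) s u = c *\<^sub>R elementary_integrand xs s u"
  by (induction xs) (auto simp: elementary_integrand_def scale_elementary_def blinfun.scaleR_left scaleR_add_right)

lemma elementary_integral_scale: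
  "elementary_integral L (scale_elementary c xs) \<omega> = c *\<^sub>R elementary_integral L xs \<omega>"
  by (induction xs) (auto simp: elementary_integral_def scale_elementary_def blinfun.scaleR_left scaleR_add_right)

lemma elementary_on_scale: "elementary_on t (scale_elementary c xs) \<longleftrightarrow> elementary_on t xs"
  by (auto simp: elementary_on_def scale_elementary_def)

lemma elementary_integrand_Cons:
  "elementary_integrand ((a, b, \<Phi>) # xs) s u =
    (indicator {a<..b} s :: real) *\<^sub>R blinfun_apply \<Phi> u + elementary_integrand xs s u"
  by (simp add: elementary_integrand_def)

lemma bounded_linear_elementary_integrand: "bounded_linear (elementary_integrand xs s)"
proof (induction xs)
  case Nil
  then show ?case by (simp add: elementary_integrand_def[abs_def])
next
  case (Cons x xs)
  obtain a b \<Phi> where x: "x = (a, b, \<Phi>)" by (cases x)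
  have "bounded_linear (\<lambda>u. (indicator {a<..b} s :: real) *\<^sub>R blinfun_apply \<Phi> u + elementary_integrand xs s u)"
    by (intro bounded_linear_add bounded_linear_const_scaleR blinfun.bounded_linear_right Cons)
  then show ?case by (simp add: x elementary_integrand_Cons[abs_def])
qed

lemma norm_elementary_integrand_le:
  "norm (elementary_integrand xs s u) \<le> (\<Sum>(a, b, \<Phi>)\<leftarrow>xs. norm \<Phi>) * norm u"
proof (induction xs)
  case Nil
  then show ?case by (simp add: elementary_integrand_def)
next
  case (Cons x xs)
  obtain a b \<Phi> where x: "x = (a, b, \<Phi>)" by (cases x)
  have "norm ((indicator {a<..b} s :: real) *\<^sub>R blinfun_apply \<Phi> u) \<le> norm \<Phi> * norm u"
    using norm_blinfun[of \<Phi> u] by (auto simp: indicator_def)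
  then have "norm (elementary_integrand (x # xs) s u) \<le> norm \<Phi> * norm u + (\<Sum>(a, b, \<Phi>)\<leftarrow>xs. norm \<Phi>) * norm u"
    unfolding x elementary_integrand_Cons by (intro order_trans[OF norm_triangle_ineq] add_mono Cons)
  then show ?case by (simp add: x distrib_right)
qed

lemma borel_measurable_elementary_integrand:
  fixes xs :: "(real \<times> real \<times> ('u::real_normed_vector \<Rightarrow>\<^sub>L 'h::{second_countable_topology, real_normed_vector})) list"
  shows "(\<lambda>s. elementary_integrand xs s u) \<in> borel_measurable borel"
proof (induction xs)
  case Nil
  then show ?case by (simp add: elementary_integrand_def)
next
  case (Cons x xs)
  obtain a b \<Phi> where x: "x = (a, b, \<Phi>)" by (cases x)
  show ?case unfolding x elementary_integrand_Cons using Cons by measurable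
qed

lemma grid_exists:
  fixes P :: "real set"
  assumes "finite P" "P \<subseteq> {0..T}" "0 \<le> T"
  obtains n and t :: "nat \<Rightarrow> real" where "strict_mono t" "0 \<le> t 0" "t n \<le> T" "P \<subseteq> t ` {..n}"
proof -
  define ts where "ts = sorted_list_of_set (insert 0 P)"
  have fin: "finite (insert 0 P)" using assms(1) by simp
  have ts: "set ts = insert 0 P" "sorted ts" "distinct ts"
    unfolding ts_def by (rule set_sorted_list_of_set[OF fin] sorted_sorted_list_of_set distinct_sorted_list_of_set)+
  then have "ts \<noteq> []" by auto
  define n where "n = length ts - 1"
  have len: "length ts = Suc n" using \<open>ts \<noteq> []\<close> by (cases ts) (auto simp: n_def)
  \<comment> \<open>Beyond \<open>n\<close> the values only serve to make \<open>t\<close> strictly increasing on all of \<open>nat\<close>.\<close>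
  define t where "t i = (if i \<le> n then ts ! i else ts ! n + real (i - n))" for i
  have step: "t i < t (Suc i)" for i
  proof (cases "Suc i \<le> n")
    case True
    then have "ts ! i \<le> ts ! Suc i" "ts ! i \<noteq> ts ! Suc i"
      using ts len by (auto simp: sorted_nth_mono nth_eq_iff_index_eq)
    then show ?thesis using True by (simp add: t_def)
  next
    case False
    then show ?thesis by (cases "i = n") (auto simp: t_def)
  qed
  have in_set: "t i \<in> insert 0 P" if "i \<le> n" for i
    using that len nth_mem[of i ts] ts(1) by (simp add: t_def)
  show thesis
  proof (rule that)
    show "strict_mono t" using step by (rule strict_mono_Suc_iff[THEN iffD2, rule_format])
    show "0 \<le> t 0" "t n \<le> T" using in_set[of 0] in_set[of n] assms by auto
    have "insert 0 P \<subseteq> t ` {..n}"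
    proof
      fix x assume "x \<in> insert 0 P"
      then obtain i where "i < length ts" "ts ! i = x" unfolding ts(1)[symmetric] in_set_conv_nth by blast
      then show "x \<in> t ` {..n}" using len by (intro image_eqI[of _ _ i]) (auto simp: t_def)
    qed
    then show "P \<subseteq> t ` {..n}" by blast
  qed
qed

text \<open>
  On a grid that contains all endpoints, the integrand is constant on each cell \<open>(t j, t (Suc j)]\<close> and equal to its
  value at the right end, which turns the integral into a sum over disjoint increments.
\<close>

lemma elementary_on_grid:
  assumes t: "strict_mono t"
    and "\<And>a b \<Phi>. (a, b, \<Phi>) \<in> set xs \<Longrightarrow> a \<le> b \<and> a \<in> t ` {..n} \<and> b \<in> t ` {..n}"
  shows "elementary_integral L xs \<omega> =
      (\<Sum>j<n. elementary_integrand xs (t (Suc j)) (L (t (Suc j)) \<omega> - L (t j) \<omega>))"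
    and "j < n \<Longrightarrow> t j < s \<Longrightarrow> s \<le> t (Suc j) \<Longrightarrow>
      elementary_integrand xs s = elementary_integrand xs (t (Suc j))"
proof -
  have "elementary_integral L xs \<omega> =
      (\<Sum>j<n. elementary_integrand xs (t (Suc j)) (L (t (Suc j)) \<omega> - L (t j) \<omega>)) \<and>
    (j < n \<longrightarrow> t j < s \<longrightarrow> s \<le> t (Suc j) \<longrightarrow>
      elementary_integrand xs s = elementary_integrand xs (t (Suc j)))"
    using assms(2)
  proof (induction xs)
    case Nil
    then show ?case by (auto simp: elementary_integral_def elementary_integrand_def)
  next
    case (Cons x xs)
    obtain a b \<Phi> where x: "x = (a, b, \<Phi>)" by (cases x)
    from Cons.prems[of a b \<Phi>] obtain p q where pq: "p \<le> n" "q \<le> n" "a = t p" "b = t q" "a \<le> b"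
      by (auto simp: x)
    then have "p \<le> q" using strict_mono_less_eq[OF t] by simp
    have ind: "indicator {a<..b} (t (Suc j)) = (if p \<le> j \<and> j < q then 1 else (0::real))" for j
      using pq strict_mono_less[OF t] strict_mono_less_eq[OF t] by (auto simp: indicator_def less_Suc_eq_le Suc_le_eq)
    let ?d = "\<lambda>j. L (t (Suc j)) \<omega> - L (t j) \<omega>"
    have "(\<Sum>j<n. (indicator {a<..b} (t (Suc j)) :: real) *\<^sub>R blinfun_apply \<Phi> (?d j))
        = (\<Sum>j<n. if p \<le> j \<and> j < q then blinfun_apply \<Phi> (?d j) else 0)"
      by (intro sum.cong) (auto simp: ind)
    also have "\<dots> = (\<Sum>j\<in>{p..<q}. blinfun_apply \<Phi> (?d j))"
      using pq by (intro sum.mono_neutral_cong_right) auto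
    also have "\<dots> = blinfun_apply \<Phi> (L (t q) \<omega> - L (t p) \<omega>)"
      unfolding blinfun.sum_right[symmetric] using sum_Suc_diff'[OF \<open>p \<le> q\<close>, of "\<lambda>j. L (t j) \<omega>"] by simp
    finally have 1: "(\<Sum>j<n. (indicator {a<..b} (t (Suc j)) :: real) *\<^sub>R blinfun_apply \<Phi> (?d j))
        = blinfun_apply \<Phi> (L b \<omega> - L a \<omega>)" by (simp add: pq)
    have 2: "indicator {a<..b} s = (indicator {a<..b} (t (Suc j)) :: real)" if "t j < s" "s \<le> t (Suc j)"
    proof -
      have "a < s \<longleftrightarrow> a < t (Suc j)"
      proof
        assume "a < t (Suc j)"
        then have "p \<le> j" using pq strict_mono_less[OF t] by (simp add: less_Suc_eq_le)
        then have "a \<le> t j" using pq strict_mono_less_eq[OF t] by simp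
        then show "a < s" using that by simp
      qed (use that in simp)
      moreover have "s \<le> b \<longleftrightarrow> t (Suc j) \<le> b"
      proof
        assume "s \<le> b"
        then have "t j < t q" using that pq by simp
        then show "t (Suc j) \<le> b" using pq strict_mono_less[OF t] strict_mono_less_eq[OF t] by (simp add: Suc_le_eq)
      qed (use that in simp)
      ultimately show ?thesis by (auto simp: indicator_def)
    qed
    have IH: "elementary_integral L xs \<omega> =
      (\<Sum>j<n. elementary_integrand xs (t (Suc j)) (?d j))"
      "j < n \<longrightarrow> t j < s \<longrightarrow> s \<le> t (Suc j) \<longrightarrow>
      elementary_integrand xs s = elementary_integrand xs (t (Suc j))"
      using Cons.IH Cons.prems by auto
    show ?case
    proof (intro conjI impI)
      have "elementary_integral L (x # xs) \<omega> = blinfun_apply \<Phi> (L b \<omega> - L a \<omega>) + elementary_integral L xs \<omega>"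
        by (simp add: x elementary_integral_def)
      then show "elementary_integral L (x # xs) \<omega> =
          (\<Sum>j<n. elementary_integrand (x # xs) (t (Suc j)) (?d j))"
        unfolding x elementary_integrand_Cons sum.distrib 1 IH(1) .
    qed (use IH(2) 2 in \<open>auto simp: x elementary_integrand_Cons fun_eq_iff\<close>)
  qed
  then show "elementary_integral L xs \<omega> =
      (\<Sum>j<n. elementary_integrand xs (t (Suc j)) (L (t (Suc j)) \<omega> - L (t j) \<omega>))"
    and "j < n \<Longrightarrow> t j < s \<Longrightarrow> s \<le> t (Suc j) \<Longrightarrow>
      elementary_integrand xs s = elementary_integrand xs (t (Suc j))" by auto
qed

text \<open>
  A function that is measurable in one variable and continuous in the other is jointly measurable; here the second
  variable is approximated by simple functions.
\<close>

lemma borel_measurable_family_compose: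
  fixes \<Phi> :: "'s \<Rightarrow> 'u::{real_normed_vector, second_countable_topology} \<Rightarrow> 'h::{real_normed_vector, second_countable_topology}"
  assumes cont: "\<And>s. s \<in> space N \<Longrightarrow> continuous_on UNIV (\<Phi> s)"
    and meas: "\<And>u. (\<lambda>s. \<Phi> s u) \<in> borel_measurable N"
    and Y: "Y \<in> borel_measurable M"
  shows "(\<lambda>(s, \<omega>). \<Phi> s (Y \<omega>)) \<in> borel_measurable (N \<Otimes>\<^sub>M M)"
proof -
  obtain Y' where Y': "\<And>i. simple_function M (Y' i)" "\<And>\<omega>. \<omega> \<in> space M \<Longrightarrow> (\<lambda>i. Y' i \<omega>) \<longlonglongrightarrow> Y \<omega>"
    using borel_measurable_implies_sequence_metric[OF Y, of 0] by blast
  show ?thesis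
  proof (rule borel_measurable_LIMSEQ_metric)
    fix i
    have fin: "finite (Y' i ` space M)" using Y'(1) by (rule simple_functionD)
    have [measurable]: "Y' i -` {u} \<inter> space M \<in> sets M" for u by (rule simple_functionD[OF Y'(1)])
    note [measurable] = meas
    have "(\<lambda>x. \<Sum>u\<in>Y' i ` space M. indicator (Y' i -` {u} \<inter> space M) (snd x) *\<^sub>R \<Phi> (fst x) u)
        \<in> borel_measurable (N \<Otimes>\<^sub>M M)"
      by measurable
    also have "?this \<longleftrightarrow> (\<lambda>(s, \<omega>). \<Phi> s (Y' i \<omega>)) \<in> borel_measurable (N \<Otimes>\<^sub>M M)"
    proof (rule measurable_cong)
      fix x assume x: "x \<in> space (N \<Otimes>\<^sub>M M)"
      then have m: "snd x \<in> space M" by (auto simp: space_pair_measure)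
      have "(\<Sum>u\<in>Y' i ` space M. indicator (Y' i -` {u} \<inter> space M) (snd x) *\<^sub>R \<Phi> (fst x) u)
          = (\<Sum>u\<in>Y' i ` space M. if u = Y' i (snd x) then \<Phi> (fst x) u else 0)"
        using m by (intro sum.cong) (auto simp: indicator_def)
      also have "\<dots> = \<Phi> (fst x) (Y' i (snd x))" using fin m by simp
      finally show "(\<Sum>u\<in>Y' i ` space M. indicator (Y' i -` {u} \<inter> space M) (snd x) *\<^sub>R \<Phi> (fst x) u)
          = (\<lambda>(s, \<omega>). \<Phi> s (Y' i \<omega>)) x" by (simp add: split_beta)
    qed
    finally show "(\<lambda>(s, \<omega>). \<Phi> s (Y' i \<omega>)) \<in> borel_measurable (N \<Otimes>\<^sub>M M)" .
  next
    fix x assume "x \<in> space (N \<Otimes>\<^sub>M M)"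
    then have "fst x \<in> space N" "snd x \<in> space M" by (auto simp: space_pair_measure)
    then have "(\<lambda>i. \<Phi> (fst x) (Y' i (snd x))) \<longlonglongrightarrow> \<Phi> (fst x) (Y (snd x))"
      using continuous_on_tendsto_compose[OF cont Y'(2)] by auto
    then show "(\<lambda>i. case x of (s, \<omega>) \<Rightarrow> \<Phi> s (Y' i \<omega>)) \<longlonglongrightarrow> (case x of (s, \<omega>) \<Rightarrow> \<Phi> s (Y \<omega>))"
      by (simp add: split_beta)
  qed
qed

section \<open>The pairing estimate for elementary integrals\<close>

context levy_noise
begin

abbreviation time_measure :: "real measure" where
  "time_measure \<equiv> restrict_space lborel {0..T}"

lemma space_time_measure [simp]: "space time_measure = {0..T}"
  by (simp add: space_restrict_space)

lemma finite_measure_time: "finite_measure time_measure"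
  using T_pos by (intro finite_measureI) (simp add: emeasure_restrict_space)

lemma integrable_time_bounded:
  assumes "g \<in> borel_measurable time_measure" "\<And>s. s \<in> {0..T} \<Longrightarrow> \<bar>g s\<bar> \<le> (c::real)"
  shows "integrable time_measure g"
proof -
  interpret N: finite_measure time_measure by (rule finite_measure_time)
  show ?thesis using assms by (intro N.integrable_const_bound[of _ c] AE_I2) auto
qed

text \<open>
  The counterpart of \<open>mean_square\<close> for the identity, that is, the trace of the covariance operator.
\<close>

definition intensity :: real where
  "intensity = expectation (\<lambda>\<omega>. (norm (L T \<omega>))\<^sup>2) / T"

lemma square_integrable_levy_final: "square_integrable M (L T)"
  using T_pos by (intro levy_square_integrable) auto

lemma intensity_nonneg: "0 \<le> intensity"
  unfolding intensity_def using T_pos by (intro divide_nonneg_pos integral_nonneg_AE) auto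

lemma borel_measurable_mean_square:
  assumes "\<And>s. s \<in> space N \<Longrightarrow> bounded_linear (\<Phi> s)" "\<And>u. (\<lambda>s. \<Phi> s u) \<in> borel_measurable N"
  shows "(\<lambda>s. mean_square (\<Phi> s)) \<in> borel_measurable N"
proof -
  have "(\<lambda>(s, \<omega>). \<Phi> s (L T \<omega>)) \<in> borel_measurable (N \<Otimes>\<^sub>M M)"
    by (intro borel_measurable_family_compose assms linear_continuous_on
        square_integrable_measurable square_integrable_levy_final)
  then have "(\<lambda>x. (norm ((\<lambda>(s, \<omega>). \<Phi> s (L T \<omega>)) x))\<^sup>2) \<in> borel_measurable (N \<Otimes>\<^sub>M M)"
    by measurable
  then have "(\<lambda>(s, \<omega>). (norm (\<Phi> s (L T \<omega>)))\<^sup>2) \<in> borel_measurable (N \<Otimes>\<^sub>M M)"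
    by (simp add: split_beta')
  then have "(\<lambda>s. expectation (\<lambda>\<omega>. (norm (\<Phi> s (L T \<omega>)))\<^sup>2)) \<in> borel_measurable N"
    by (rule borel_measurable_lebesgue_integral)
  then show ?thesis unfolding mean_square_def by measurable
qed

lemma square_integrable_linear_levy:
  "bounded_linear B \<Longrightarrow> square_integrable M (\<lambda>\<omega>. B (L T \<omega>))"
  by (rule square_integrable_bounded_linear[OF _ square_integrable_levy_final])

lemma mean_square_le:
  assumes "bounded_linear B" "\<And>u. norm (B u) \<le> c * norm u"
  shows "mean_square B \<le> c\<^sup>2 * intensity"
proof -
  have "expectation (\<lambda>\<omega>. (norm (B (L T \<omega>)))\<^sup>2) \<le> expectation (\<lambda>\<omega>. c\<^sup>2 * (norm (L T \<omega>))\<^sup>2)"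
  proof (rule integral_mono)
    show "(norm (B (L T \<omega>)))\<^sup>2 \<le> c\<^sup>2 * (norm (L T \<omega>))\<^sup>2" for \<omega>
      using power_mono[OF assms(2) norm_ge_zero, of "L T \<omega>" 2] by (simp add: power_mult_distrib)
  qed (use square_integrable_linear_levy[OF assms(1)] square_integrable_levy_final
      in \<open>auto simp: square_integrable_def\<close>)
  then show ?thesis
    unfolding mean_square_def intensity_def using T_pos by (simp add: divide_right_mono)
qed

lemma mean_square_add_le:
  assumes "bounded_linear A" "bounded_linear B"
  shows "mean_square (\<lambda>u. A u + B u) \<le> 2 * mean_square A + 2 * mean_square B"
proof -
  have "expectation (\<lambda>\<omega>. (norm (A (L T \<omega>) + B (L T \<omega>)))\<^sup>2)
      \<le> expectation (\<lambda>\<omega>. 2 * (norm (A (L T \<omega>)))\<^sup>2 + 2 * (norm (B (L T \<omega>)))\<^sup>2)"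
  proof (rule integral_mono)
    show "integrable M (\<lambda>\<omega>. (norm (A (L T \<omega>) + B (L T \<omega>)))\<^sup>2)"
      using square_integrable_add[OF square_integrable_linear_levy[OF assms(1)] square_integrable_linear_levy[OF assms(2)]]
      by (simp add: square_integrable_def)
  qed (use square_integrable_linear_levy[OF assms(1)] square_integrable_linear_levy[OF assms(2)]
      norm_add_square_le in \<open>auto simp: square_integrable_def\<close>)
  also have "\<dots> = 2 * expectation (\<lambda>\<omega>. (norm (A (L T \<omega>)))\<^sup>2) + 2 * expectation (\<lambda>\<omega>. (norm (B (L T \<omega>)))\<^sup>2)"
    using square_integrable_linear_levy[OF assms(1)] square_integrable_linear_levy[OF assms(2)]
    by (simp add: square_integrable_def)
  finally show ?thesis
    unfolding mean_square_def using T_pos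
    by (simp add: add_divide_distrib[symmetric] divide_right_mono)
qed

lemma mean_square_scale: "mean_square (\<lambda>u. c *\<^sub>R B u) = c\<^sup>2 * mean_square B"
  unfolding mean_square_def by (simp add: power_mult_distrib)

lemma mean_square_elementary:
  shows "(\<lambda>s. mean_square (elementary_integrand xs s)) \<in> borel_measurable time_measure"
    and "\<exists>c. \<forall>s. mean_square (elementary_integrand xs s) \<le> c"
proof -
  show "(\<lambda>s. mean_square (elementary_integrand xs s)) \<in> borel_measurable time_measure"
    by (intro borel_measurable_mean_square bounded_linear_elementary_integrand
        measurable_restrict_space1) (simp add: borel_measurable_elementary_integrand)
  show "\<exists>c. \<forall>s. mean_square (elementary_integrand xs s) \<le> c"
    using mean_square_le[OF bounded_linear_elementary_integrand norm_elementary_integrand_le] by blast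
qed

text \<open>
  The weighted inequality \<open>2 p q \<le> w p\<^sup>2 + q\<^sup>2 / w\<close> holds for every weight, so the weight may be any function of
  time inside the cell.  Second moments of increments are linear in the length of the interval, so that the right-hand
  side becomes an integral over the cell; a weight of the size of the second factor makes it as small as the
  product itself.
\<close>

lemma increment_product_le_time_integral:
  assumes "0 \<le> a" "a < b" "b \<le> T" "bounded_linear \<Psi>" "bounded_linear \<Theta>"
    and \<theta>: "\<And>s. a < s \<Longrightarrow> s \<le> b \<Longrightarrow> 0 < \<theta> s"
    and int: "integrable time_measure
      (\<lambda>s. indicator {a<..b} s * ((\<theta> s * mean_square \<Psi> + mean_square \<Theta> / \<theta> s) / 2))"
  shows "expectation (\<lambda>\<omega>. norm (\<Psi> (L b \<omega> - L a \<omega>)) * norm (\<Theta> (L b \<omega> - L a \<omega>)))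
    \<le> (\<integral>s. indicator {a<..b} s * ((\<theta> s * mean_square \<Psi> + mean_square \<Theta> / \<theta> s) / 2) \<partial>time_measure)"
    (is "?E \<le> ?R")
proof -
  interpret N: finite_measure time_measure by (rule finite_measure_time)
  let ?P = "\<lambda>\<omega>. \<Psi> (L b \<omega> - L a \<omega>)" and ?Q = "\<lambda>\<omega>. \<Theta> (L b \<omega> - L a \<omega>)"
  have sq: "square_integrable M ?P" "square_integrable M ?Q"
    using assms by (intro increment_square_integrable; simp)+
  have bound: "?E \<le> (b - a) * ((w * mean_square \<Psi> + mean_square \<Theta> / w) / 2)" if "0 < w" for w
  proof -
    have "?E \<le> expectation (\<lambda>\<omega>. (w * (norm (?P \<omega>))\<^sup>2 + (norm (?Q \<omega>))\<^sup>2 / w) / 2)"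
    proof (rule integral_mono)
      show "integrable M (\<lambda>\<omega>. norm (?P \<omega>) * norm (?Q \<omega>))"
        by (rule square_integrable_integrable_mult[OF sq])
      show "integrable M (\<lambda>\<omega>. (w * (norm (?P \<omega>))\<^sup>2 + (norm (?Q \<omega>))\<^sup>2 / w) / 2)"
        using sq by (simp add: square_integrable_def)
      fix \<omega>
      have "2 * (p * q) \<le> w * p\<^sup>2 + q\<^sup>2 / w" for p q :: real
      proof -
        have "0 \<le> (w * p - q)\<^sup>2 / w" using \<open>0 < w\<close> by simp
        also have "(w * p - q)\<^sup>2 / w = w * p\<^sup>2 + q\<^sup>2 / w - 2 * (p * q)"
          using \<open>0 < w\<close> by (simp add: power2_eq_square field_simps)
        finally show ?thesis by simp
      qed
      from this[of "norm (?P \<omega>)" "norm (?Q \<omega>)"]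
      show "norm (?P \<omega>) * norm (?Q \<omega>) \<le> (w * (norm (?P \<omega>))\<^sup>2 + (norm (?Q \<omega>))\<^sup>2 / w) / 2" by simp
    qed
    also have "\<dots> = (w * expectation (\<lambda>\<omega>. (norm (?P \<omega>))\<^sup>2) + expectation (\<lambda>\<omega>. (norm (?Q \<omega>))\<^sup>2) / w) / 2"
      using sq by (simp add: square_integrable_def)
    also have "\<dots> = (b - a) * ((w * mean_square \<Psi> + mean_square \<Theta> / w) / 2)"
    proof -
      have squares: "expectation (\<lambda>\<omega>. (norm (?P \<omega>))\<^sup>2) = (b - a) * mean_square \<Psi>"
        "expectation (\<lambda>\<omega>. (norm (?Q \<omega>))\<^sup>2) = (b - a) * mean_square \<Theta>"
        using assms by (intro expectation_increment_square; simp)+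
      show ?thesis unfolding squares using \<open>0 < w\<close> by (simp add: field_simps)
    qed
    finally show ?thesis .
  qed
  have "?E = (\<integral>s. indicator {a<..b} s * (?E / (b - a)) \<partial>time_measure)"
  proof -
    have "{a<..b} \<inter> {0..T} = {a<..b}" using assms by auto
    then have "measure time_measure ({a<..b} \<inter> space time_measure) = b - a"
      using assms by (subst measure_restrict_space) auto
    then show ?thesis using assms(2) by (simp add: Int_commute)
  qed
  also have "\<dots> \<le> ?R"
  proof (rule integral_mono[OF _ int])
    show "integrable time_measure (\<lambda>s. indicator {a<..b} s * (?E / (b - a)))"
      by (rule integrable_time_bounded[of _ "\<bar>?E / (b - a)\<bar>"])
        (auto simp: indicator_def intro!: measurable_restrict_space1)
    fix s
    show "indicator {a<..b} s * (?E / (b - a)) \<le>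
        indicator {a<..b} s * ((\<theta> s * mean_square \<Psi> + mean_square \<Theta> / \<theta> s) / 2)"
      using bound[OF \<theta>, of s] assms(2) by (auto simp: indicator_def field_simps)
  qed
  finally show ?thesis .
qed

lemma elementary_integral_square_integrable:
  assumes "elementary_on T xs"
  shows "square_integrable M (elementary_integral L xs)"
  using assms
proof (induction xs)
  case Nil
  then show ?case by (simp add: elementary_integral_def[abs_def] square_integrable_const)
next
  case (Cons x xs)
  obtain a b \<Phi> where x: "x = (a, b, \<Phi>)" by (cases x)
  have "square_integrable M (\<lambda>\<omega>. blinfun_apply \<Phi> (L b \<omega> - L a \<omega>))"
    using Cons.prems by (intro increment_square_integrable blinfun.bounded_linear_right) (auto simp: x elementary_on_def)
  moreover have "square_integrable M (elementary_integral L xs)"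
    using Cons by (simp add: elementary_on_def)
  ultimately have "square_integrable M (\<lambda>\<omega>. blinfun_apply \<Phi> (L b \<omega> - L a \<omega>) + elementary_integral L xs \<omega>)"
    by (rule square_integrable_add)
  moreover have "elementary_integral L (x # xs) = (\<lambda>\<omega>. blinfun_apply \<Phi> (L b \<omega> - L a \<omega>) + elementary_integral L xs \<omega>)"
    by (simp add: x elementary_integral_def[abs_def])
  ultimately show ?case by simp
qed

text \<open>
  Both integrals are written on a common grid, whose increments are independent of the past.
\<close>

lemma elementary_pairing:
  assumes xs: "elementary_on T xs" and ys: "elementary_on T ys" and F: "K-lipschitz_on UNIV H"
    and \<theta>: "\<theta> \<in> borel_measurable time_measure" "0 < \<theta>\<^sub>0" "\<And>s. s \<in> {0..T} \<Longrightarrow> \<theta>\<^sub>0 \<le> \<theta> s \<and> \<theta> s \<le> \<theta>\<^sub>1"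
  defines "g \<equiv> \<lambda>s. (\<theta> s * mean_square (elementary_integrand xs s) + mean_square (elementary_integrand ys s) / \<theta> s) / 2"
  shows "integrable time_measure g"
    and "\<bar>expectation (\<lambda>\<omega>. inner (H (elementary_integral L xs \<omega>)) (elementary_integral L ys \<omega>))\<bar>
    \<le> K * (\<integral>s. g s \<partial>time_measure)"
proof -
  obtain cx where cx: "\<And>s. mean_square (elementary_integrand xs s) \<le> cx" using mean_square_elementary(2) by blast
  obtain cy where cy: "\<And>s. mean_square (elementary_integrand ys s) \<le> cy" using mean_square_elementary(2) by blast
  have g_nonneg: "0 \<le> g s" if "s \<in> {0..T}" for s
    unfolding g_def using \<theta>(2) \<theta>(3)[OF that] mean_square_nonneg by simp
  have g_meas: "g \<in> borel_measurable time_measure"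
    unfolding g_def using \<theta>(1) mean_square_elementary(1)[of xs] mean_square_elementary(1)[of ys] by measurable
  have g_bound: "\<bar>g s\<bar> \<le> (\<theta>\<^sub>1 * cx + cy / \<theta>\<^sub>0) / 2" if "s \<in> {0..T}" for s
  proof -
    have "\<theta> s * mean_square (elementary_integrand xs s) \<le> \<theta>\<^sub>1 * cx"
      using \<theta>(2) \<theta>(3)[OF that] cx mean_square_nonneg by (intro mult_mono) auto
    moreover have "mean_square (elementary_integrand ys s) / \<theta> s \<le> cy / \<theta>\<^sub>0"
      using \<theta>(2) \<theta>(3)[OF that] cy mean_square_nonneg
      by (intro frac_le) (auto intro: order_trans[OF mean_square_nonneg cy])
    ultimately show ?thesis
      unfolding abs_of_nonneg[OF g_nonneg[OF that]] unfolding g_def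
      by (intro divide_right_mono add_mono) auto
  qed
  show g_int: "integrable time_measure g" by (rule integrable_time_bounded[OF g_meas g_bound])
  let ?P = "(\<lambda>(a, b, \<Phi>). a) ` set (xs @ ys) \<union> (\<lambda>(a, b, \<Phi>). b) ` set (xs @ ys)"
  have "?P \<subseteq> {0..T}" using xs ys by (force simp: elementary_on_def)
  then obtain n and t :: "nat \<Rightarrow> real" where t: "strict_mono t" "0 \<le> t 0" "t n \<le> T" "?P \<subseteq> t ` {..n}"
    using grid_exists[of ?P T] T_pos by (metis List.finite_set finite_UnI finite_imageI less_imp_le)
  have grid: "a \<le> b \<and> a \<in> t ` {..n} \<and> b \<in> t ` {..n}" if "(a, b, \<Phi>) \<in> set xs \<or> (a, b, \<Phi>) \<in> set ys" for a b \<Phi>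
  proof -
    have "a \<in> ?P" "b \<in> ?P" using that by force+
    moreover have "a \<le> b" using that xs ys by (auto simp: elementary_on_def)
    ultimately show ?thesis using t(4) by blast
  qed
  have grid_integral: "elementary_integral L zs \<omega> =
      (\<Sum>j<n. elementary_integrand zs (t (Suc j)) (L (t (Suc j)) \<omega> - L (t j) \<omega>))"
    if "zs = xs \<or> zs = ys" for zs \<omega>
    by (rule elementary_on_grid(1)[OF t(1)]) (use grid that in blast)
  have grid_integrand: "elementary_integrand zs s = elementary_integrand zs (t (Suc j))"
    if "zs = xs \<or> zs = ys" "j < n" "t j < s" "s \<le> t (Suc j)" for zs j s
    by (rule elementary_on_grid(2)[OF t(1) _ that(2,3,4)]) (use grid that(1) in blast)
  define \<Psi> where "\<Psi> j = elementary_integrand xs (t (Suc j))" for j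
  define \<Theta> where "\<Theta> j = elementary_integrand ys (t (Suc j))" for j
  have lin: "bounded_linear (\<Psi> j)" "bounded_linear (\<Theta> j)" for j
    unfolding \<Psi>_def \<Theta>_def by (rule bounded_linear_elementary_integrand)+
  define D where "D j \<omega> = L (t (Suc j)) \<omega> - L (t j) \<omega>" for j \<omega>
  have mono: "t i \<le> t j" if "i \<le> j" for i j using that strict_mono_less_eq[OF t(1)] by simp
  have range: "0 \<le> t j" "t j \<le> T" if "j \<le> n" for j
    using t(2,3) mono[of 0 j] mono[OF that] by auto
  have cell: "0 \<le> t j" "t j < t (Suc j)" "t (Suc j) \<le> T" if "j < n" for j
    using that range[of j] range[of "Suc j"] strict_mono_less[OF t(1)] by auto
  have "\<bar>expectation (\<lambda>\<omega>. inner (H (\<Sum>j<n. \<Psi> j (D j \<omega>))) (\<Sum>j<n. \<Theta> j (D j \<omega>)))\<bar>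
      \<le> K * (\<Sum>j<n. expectation (\<lambda>\<omega>. norm (\<Psi> j (D j \<omega>)) * norm (\<Theta> j (D j \<omega>))))"
  proof (rule pairing_of_independent_sums[OF _ _ _ _ F])
    fix j assume j: "j < n"
    show "square_integrable M (\<lambda>\<omega>. \<Psi> j (D j \<omega>))" "square_integrable M (\<lambda>\<omega>. \<Theta> j (D j \<omega>))"
      unfolding D_def using cell[OF j] by (intro increment_square_integrable lin; simp)+
    show "expectation (\<lambda>\<omega>. \<Theta> j (D j \<omega>)) = 0"
      unfolding D_def using cell[OF j] by (intro increment_expectation lin) auto
    have borel_lin: "B \<in> borel_measurable borel" if "bounded_linear B" for B :: "'u \<Rightarrow> 'h"
      by (rule borel_measurable_continuous_onI[OF linear_continuous_on[OF that]])
    have past: "(\<lambda>\<omega>. B (D i \<omega>)) \<in> borel_measurable (F (t j))" if "i < j" "bounded_linear B"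
      for i and B :: "'u \<Rightarrow> 'h"
    proof -
      have "L (t (Suc i)) \<in> borel_measurable (F (t j))" "L (t i) \<in> borel_measurable (F (t j))"
        using that j range[of i] range[of "Suc i"] range[of j] mono[of i j] mono[of "Suc i" j]
        by (auto intro!: levy_measurable_filtration)
      then have "D i \<in> borel_measurable (F (t j))" unfolding D_def[abs_def] by measurable
      then show ?thesis by (rule measurable_compose[OF _ borel_lin[OF that(2)]])
    qed
    show "indep_var borel (\<lambda>\<omega>. (\<Sum>i<j. \<Psi> i (D i \<omega>), \<Sum>i<j. \<Theta> i (D i \<omega>)))
        borel (\<lambda>\<omega>. (\<Psi> j (D j \<omega>), \<Theta> j (D j \<omega>)))"
      unfolding D_def[of j]
    proof (rule increment_independent[OF cell[OF j]])
      show "(\<lambda>\<omega>. (\<Sum>i<j. \<Psi> i (D i \<omega>), \<Sum>i<j. \<Theta> i (D i \<omega>))) \<in> borel_measurable (F (t j))"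
        by (intro borel_measurable_Pair borel_measurable_sum past lin) auto
      show "(\<lambda>u. (\<Psi> j u, \<Theta> j u)) \<in> borel_measurable borel"
        by (intro borel_measurable_Pair borel_lin lin)
    qed
  qed
  also have "(\<Sum>j<n. expectation (\<lambda>\<omega>. norm (\<Psi> j (D j \<omega>)) * norm (\<Theta> j (D j \<omega>)))) \<le> (\<integral>s. g s \<partial>time_measure)"
  proof -
    let ?I = "\<lambda>j s. indicator {t j<..t (Suc j)} s :: real"
    have I_int: "integrable time_measure (\<lambda>s. ?I j s * g s)" for j
    proof (rule Bochner_Integration.integrable_bound[OF g_int])
      show "(\<lambda>s. ?I j s * g s) \<in> borel_measurable time_measure"
        using g_meas by (intro borel_measurable_times) (auto intro!: measurable_restrict_space1)
    qed (auto simp: indicator_def)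
    have "(\<Sum>j<n. expectation (\<lambda>\<omega>. norm (\<Psi> j (D j \<omega>)) * norm (\<Theta> j (D j \<omega>))))
        \<le> (\<Sum>j<n. \<integral>s. ?I j s * g s \<partial>time_measure)"
    proof (rule sum_mono)
      fix j assume "j \<in> {..<n}"
      then have j: "j < n" by simp
      have eq: "?I j s * ((\<theta> s * mean_square (\<Psi> j) + mean_square (\<Theta> j) / \<theta> s) / 2) = ?I j s * g s" for s
        using grid_integrand[of xs j s] grid_integrand[of ys j s] j
        by (auto simp: indicator_def g_def \<Psi>_def \<Theta>_def)
      have pos: "0 < \<theta> s" if "t j < s" "s \<le> t (Suc j)" for s
      proof -
        have "s \<in> {0..T}" using that cell[OF j] by auto
        then show ?thesis using \<theta>(2) \<theta>(3)[of s] by linarith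
      qed
      show "expectation (\<lambda>\<omega>. norm (\<Psi> j (D j \<omega>)) * norm (\<Theta> j (D j \<omega>))) \<le> (\<integral>s. ?I j s * g s \<partial>time_measure)"
        using increment_product_le_time_integral[OF cell[OF j] lin(1)[of j] lin(2)[of j], of \<theta>] pos I_int[of j]
        unfolding D_def eq by blast
    qed
    also have "\<dots> = (\<integral>s. (\<Sum>j<n. ?I j s) * g s \<partial>time_measure)"
      unfolding sum_distrib_right by (rule Bochner_Integration.integral_sum[symmetric]) (rule I_int)
    also have "\<dots> \<le> (\<integral>s. g s \<partial>time_measure)"
    proof (rule integral_mono[OF _ g_int])
      show "integrable time_measure (\<lambda>s. (\<Sum>j<n. ?I j s) * g s)"
        unfolding sum_distrib_right using I_int by (intro Bochner_Integration.integrable_sum)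
      fix s assume "s \<in> space time_measure"
      then have "0 \<le> g s" using g_nonneg by simp
      \<comment> \<open>The cells are disjoint.\<close>
      have "(\<Sum>j<n. ?I j s) \<le> 1"
      proof -
        have "disjoint_family_on (\<lambda>j. {t j<..t (Suc j)}) {..<n}"
          unfolding disjoint_family_on_def
        proof (intro ballI impI)
          fix i j :: nat assume "i \<noteq> j"
          then have "Suc i \<le> j \<or> Suc j \<le> i" by linarith
          then show "{t i<..t (Suc i)} \<inter> {t j<..t (Suc j)} = {}"
            using mono[of "Suc i" j] mono[of "Suc j" i] by fastforce
        qed
        then have "(\<Sum>j<n. ?I j s) = indicator (\<Union>j<n. {t j<..t (Suc j)}) s"
          by (intro indicator_UN_disjoint[symmetric] finite_lessThan)
        then show ?thesis by (simp only: indicator_le_1)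
      qed
      then show "(\<Sum>j<n. ?I j s) * g s \<le> g s" using \<open>0 \<le> g s\<close> by (intro mult_left_le_one_le sum_nonneg) auto
    qed
    finally show ?thesis .
  qed
  finally show "\<bar>expectation (\<lambda>\<omega>. inner (H (elementary_integral L xs \<omega>)) (elementary_integral L ys \<omega>))\<bar>
    \<le> K * (\<integral>s. g s \<partial>time_measure)"
    using grid_integral[of xs] grid_integral[of ys] lipschitz_on_nonneg[OF F]
    by (simp add: \<Psi>_def \<Theta>_def D_def mult_left_mono)
qed

end

section \<open>Approximation of stochastic integrals\<close>

context prob_space
begin

text \<open>
  A weighted inequality between products and squares, with the weight \<open>r\<close> adapted to \<open>\<epsilon>\<close>, plays the role of the
  Cauchy-Schwarz inequality.
\<close>

lemma expectation_norm_mult_tendsto_0: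
  assumes U: "\<And>n. square_integrable M (U n)" and V: "square_integrable M V"
    and lim: "(\<lambda>n. expectation (\<lambda>\<omega>. (norm (U n \<omega>))\<^sup>2)) \<longlonglongrightarrow> 0"
  shows "(\<lambda>n. expectation (\<lambda>\<omega>. norm (U n \<omega>) * norm (V \<omega>))) \<longlonglongrightarrow> 0"
proof (rule LIMSEQ_I)
  fix \<epsilon> :: real assume "0 < \<epsilon>"
  define b where "b = expectation (\<lambda>\<omega>. (norm (V \<omega>))\<^sup>2)"
  have b: "0 \<le> b" unfolding b_def by simp
  define r where "r = \<epsilon> / (b + 1)"
  have r: "0 < r" unfolding r_def using \<open>0 < \<epsilon>\<close> b by simp
  have rb: "r * b < \<epsilon>" unfolding r_def using \<open>0 < \<epsilon>\<close> b by (simp add: field_simps)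
  obtain N where N: "\<And>n. n \<ge> N \<Longrightarrow> expectation (\<lambda>\<omega>. (norm (U n \<omega>))\<^sup>2) < \<epsilon> * r"
    using LIMSEQ_D[OF lim, of "\<epsilon> * r"] r \<open>0 < \<epsilon>\<close> by auto
  have "norm (expectation (\<lambda>\<omega>. norm (U n \<omega>) * norm (V \<omega>)) - 0) < \<epsilon>" if "n \<ge> N" for n
  proof -
    let ?a = "expectation (\<lambda>\<omega>. (norm (U n \<omega>))\<^sup>2)"
    have "expectation (\<lambda>\<omega>. norm (U n \<omega>) * norm (V \<omega>))
        \<le> expectation (\<lambda>\<omega>. ((norm (U n \<omega>))\<^sup>2 / r + r * (norm (V \<omega>))\<^sup>2) / 2)"
    proof (rule integral_mono)
      show "integrable M (\<lambda>\<omega>. norm (U n \<omega>) * norm (V \<omega>))"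
        by (rule square_integrable_integrable_mult[OF U V])
      show "integrable M (\<lambda>\<omega>. ((norm (U n \<omega>))\<^sup>2 / r + r * (norm (V \<omega>))\<^sup>2) / 2)"
        using U[of n] V by (simp add: square_integrable_def)
      fix \<omega>
      have "2 * (p * q) \<le> p\<^sup>2 / r + r * q\<^sup>2" for p q :: real
      proof -
        have "0 \<le> (p - r * q)\<^sup>2 / r" using r by simp
        also have "(p - r * q)\<^sup>2 / r = p\<^sup>2 / r + r * q\<^sup>2 - 2 * (p * q)"
          using r by (simp add: power2_eq_square field_simps)
        finally show ?thesis by simp
      qed
      from this[of "norm (U n \<omega>)" "norm (V \<omega>)"]
      show "norm (U n \<omega>) * norm (V \<omega>) \<le> ((norm (U n \<omega>))\<^sup>2 / r + r * (norm (V \<omega>))\<^sup>2) / 2" by simp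
    qed
    also have "\<dots> = (?a / r + r * b) / 2"
      using U[of n] V by (simp add: square_integrable_def b_def)
    also have "\<dots> < (\<epsilon> + \<epsilon>) / 2"
    proof -
      have "?a / r < \<epsilon>" using N[OF that] r by (simp add: pos_divide_less_eq)
      then show ?thesis using rb by simp
    qed
    finally have "expectation (\<lambda>\<omega>. norm (U n \<omega>) * norm (V \<omega>)) < \<epsilon>" by simp
    moreover have "0 \<le> expectation (\<lambda>\<omega>. norm (U n \<omega>) * norm (V \<omega>))" by simp
    ultimately show ?thesis by simp
  qed
  then show "\<exists>N. \<forall>n\<ge>N. norm (expectation (\<lambda>\<omega>. norm (U n \<omega>) * norm (V \<omega>)) - 0) < \<epsilon>" by blast
qed

lemma expectation_inner_tendsto:
  assumes X: "\<And>n. square_integrable M (X n)" "square_integrable M X'"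
    "(\<lambda>n. expectation (\<lambda>\<omega>. (norm (X n \<omega> - X' \<omega>))\<^sup>2)) \<longlonglongrightarrow> 0"
    and Y: "\<And>n. square_integrable M (Y n)" "square_integrable M Y'"
    "(\<lambda>n. expectation (\<lambda>\<omega>. (norm (Y n \<omega> - Y' \<omega>))\<^sup>2)) \<longlonglongrightarrow> 0"
  shows "(\<lambda>n. expectation (\<lambda>\<omega>. inner (X n \<omega>) (Y n \<omega>))) \<longlonglongrightarrow> expectation (\<lambda>\<omega>. inner (X' \<omega>) (Y' \<omega>))"
proof -
  have dX: "square_integrable M (\<lambda>\<omega>. X n \<omega> - X' \<omega>)" and dY: "square_integrable M (\<lambda>\<omega>. Y n \<omega> - Y' \<omega>)" for n
    by (intro square_integrable_diff X Y)+
  let ?e = "\<lambda>n. (expectation (\<lambda>\<omega>. (norm (X n \<omega> - X' \<omega>))\<^sup>2) + expectation (\<lambda>\<omega>. (norm (Y n \<omega> - Y' \<omega>))\<^sup>2)) / 2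
    + expectation (\<lambda>\<omega>. norm (X n \<omega> - X' \<omega>) * norm (Y' \<omega>))
    + expectation (\<lambda>\<omega>. norm (Y n \<omega> - Y' \<omega>) * norm (X' \<omega>))"
  have "?e \<longlonglongrightarrow> (0 + 0) / 2 + 0 + 0"
    by (intro tendsto_add tendsto_divide tendsto_const X Y expectation_norm_mult_tendsto_0 dX dY) simp
  then have e: "?e \<longlonglongrightarrow> 0" by simp
  have "norm (expectation (\<lambda>\<omega>. inner (X n \<omega>) (Y n \<omega>)) - expectation (\<lambda>\<omega>. inner (X' \<omega>) (Y' \<omega>))) \<le> ?e n" for n
  proof -
    have "expectation (\<lambda>\<omega>. inner (X n \<omega>) (Y n \<omega>)) - expectation (\<lambda>\<omega>. inner (X' \<omega>) (Y' \<omega>))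
        = expectation (\<lambda>\<omega>. inner (X n \<omega>) (Y n \<omega>) - inner (X' \<omega>) (Y' \<omega>))"
      by (intro Bochner_Integration.integral_diff[symmetric] square_integrable_integrable_inner X Y)
    also have "norm \<dots> \<le> expectation (\<lambda>\<omega>. norm (inner (X n \<omega>) (Y n \<omega>) - inner (X' \<omega>) (Y' \<omega>)))"
      by (rule integral_norm_bound)
    also have "\<dots> \<le> expectation (\<lambda>\<omega>. ((norm (X n \<omega> - X' \<omega>))\<^sup>2 + (norm (Y n \<omega> - Y' \<omega>))\<^sup>2) / 2
        + norm (X n \<omega> - X' \<omega>) * norm (Y' \<omega>) + norm (Y n \<omega> - Y' \<omega>) * norm (X' \<omega>))"
    proof (rule integral_mono)
      show "integrable M (\<lambda>\<omega>. norm (inner (X n \<omega>) (Y n \<omega>) - inner (X' \<omega>) (Y' \<omega>)))"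
        by (intro integrable_norm Bochner_Integration.integrable_diff square_integrable_integrable_inner X Y)
      show "integrable M (\<lambda>\<omega>. ((norm (X n \<omega> - X' \<omega>))\<^sup>2 + (norm (Y n \<omega> - Y' \<omega>))\<^sup>2) / 2
        + norm (X n \<omega> - X' \<omega>) * norm (Y' \<omega>) + norm (Y n \<omega> - Y' \<omega>) * norm (X' \<omega>))"
        using dX[of n] dY[of n]
        by (intro Bochner_Integration.integrable_add square_integrable_integrable_mult X Y dX dY)
          (simp add: square_integrable_def)
      fix \<omega>
      have "inner (X n \<omega>) (Y n \<omega>) - inner (X' \<omega>) (Y' \<omega>) = inner (X n \<omega> - X' \<omega>) (Y n \<omega> - Y' \<omega>)
        + inner (X n \<omega> - X' \<omega>) (Y' \<omega>) + inner (Y n \<omega> - Y' \<omega>) (X' \<omega>)"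
        by (simp add: inner_diff_left inner_diff_right inner_commute)
      then have "norm (inner (X n \<omega>) (Y n \<omega>) - inner (X' \<omega>) (Y' \<omega>))
        \<le> \<bar>inner (X n \<omega> - X' \<omega>) (Y n \<omega> - Y' \<omega>)\<bar>
          + \<bar>inner (X n \<omega> - X' \<omega>) (Y' \<omega>)\<bar> + \<bar>inner (Y n \<omega> - Y' \<omega>) (X' \<omega>)\<bar>" by simp
      also have "\<dots> \<le> ((norm (X n \<omega> - X' \<omega>))\<^sup>2 + (norm (Y n \<omega> - Y' \<omega>))\<^sup>2) / 2
        + norm (X n \<omega> - X' \<omega>) * norm (Y' \<omega>) + norm (Y n \<omega> - Y' \<omega>) * norm (X' \<omega>)"
        by (intro add_mono Cauchy_Schwarz_ineq2 order_trans[OF Cauchy_Schwarz_ineq2 norm_mult_le_half_squares])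
      finally show "norm (inner (X n \<omega>) (Y n \<omega>) - inner (X' \<omega>) (Y' \<omega>)) \<le> ((norm (X n \<omega> - X' \<omega>))\<^sup>2 + (norm (Y n \<omega> - Y' \<omega>))\<^sup>2) / 2
        + norm (X n \<omega> - X' \<omega>) * norm (Y' \<omega>) + norm (Y n \<omega> - Y' \<omega>) * norm (X' \<omega>)" .
    qed
    also have "\<dots> = ?e n"
      using dX[of n] dY[of n] square_integrable_integrable_mult[OF dX[of n] Y(2)]
        square_integrable_integrable_mult[OF dY[of n] X(2)]
      by (simp add: square_integrable_def)
    finally show ?thesis .
  qed
  then have "(\<lambda>n. expectation (\<lambda>\<omega>. inner (X n \<omega>) (Y n \<omega>)) - expectation (\<lambda>\<omega>. inner (X' \<omega>) (Y' \<omega>))) \<longlonglongrightarrow> 0"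
    by (intro tendsto_0_le[OF e, of _ 1] eventuallyI) (simp add: order_trans[OF _ abs_ge_self])
  then show ?thesis by (simp add: LIM_zero_iff)
qed

end

lemma tendsto_integral_of_nn_integral:
  fixes g :: "nat \<Rightarrow> 'x \<Rightarrow> real"
  assumes "\<And>n. integrable N (g n)" "\<And>n x. 0 \<le> g n x" "(\<lambda>n. \<integral>\<^sup>+x. ennreal (g n x) \<partial>N) \<longlonglongrightarrow> 0"
  shows "(\<lambda>n. \<integral>x. g n x \<partial>N) \<longlonglongrightarrow> 0"
proof -
  have "(\<lambda>n. ennreal (\<integral>x. g n x \<partial>N)) \<longlonglongrightarrow> ennreal 0"
    using assms by (simp add: nn_integral_eq_integral)
  then show ?thesis using assms(2) by (subst (asm) tendsto_ennreal_iff) (auto intro: integral_nonneg_AE)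
qed

context levy_noise
begin

lemma levy_noise_covariance: "covariance_operator M T L Q' \<Longrightarrow> levy_noise M e T F L Q'"
  by (intro levy_noise.intro levy_noise_axioms.intro prob_space_axioms hilbert_basis_axioms
      T_pos filtration levy centred)

text \<open>
  The approximation in the definition is measured by Hilbert-Schmidt norms that need not be measurable in time.
  Mean squares are smaller and measurable, so they can be integrated and split without care.
\<close>

lemma stochastic_integral_approximation:
  assumes int: "stochastic_integral M T L T \<Phi> I"
    and bound: "\<And>s u. s \<in> {0..T} \<Longrightarrow> norm (\<Phi> s u) \<le> c * norm u"
  obtains xs where "\<And>n. elementary_on T (xs n)" "square_integrable M I"
    "(\<lambda>n. expectation (\<lambda>\<omega>. (norm (elementary_integral L (xs n) \<omega> - I \<omega>))\<^sup>2)) \<longlonglongrightarrow> 0"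
    "\<And>n. integrable time_measure (\<lambda>s. mean_square (\<lambda>u. elementary_integrand (xs n) s u - \<Phi> s u))"
    "(\<lambda>n. \<integral>s. mean_square (\<lambda>u. elementary_integrand (xs n) s u - \<Phi> s u) \<partial>time_measure) \<longlonglongrightarrow> 0"
proof -
  have I: "I \<in> borel_measurable M" and lin: "\<And>s. s \<in> {0..T} \<Longrightarrow> bounded_linear (\<Phi> s)"
    and meas: "\<And>u. (\<lambda>s. \<Phi> s u) \<in> borel_measurable (restrict_space borel {0..T})"
    using int by (simp_all add: stochastic_integral_def)
  obtain Q' R xs where QR: "covariance_operator M T L Q'" "operator_sqrt Q' R"
    and el: "\<And>n::nat. elementary_on T (xs n)"
    and hs: "(\<lambda>n. \<integral>\<^sup>+s\<in>{0..T}. hs_norm_sq (\<lambda>u. elementary_integrand (xs n) s (blinfun_apply R u)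
        - \<Phi> s (blinfun_apply R u)) \<partial>lborel) \<longlonglongrightarrow> 0"
    and lim: "(\<lambda>n. \<integral>\<^sup>+\<omega>. ennreal ((norm (elementary_integral L (xs n) \<omega> - I \<omega>))\<^sup>2) \<partial>M) \<longlonglongrightarrow> 0"
    using int unfolding stochastic_integral_def by blast
  have sq_el: "square_integrable M (elementary_integral L (xs n))" for n
    by (rule elementary_integral_square_integrable[OF el])
  have sq_I: "square_integrable M I"
  proof -
    have "\<forall>\<^sub>F n in sequentially. (\<integral>\<^sup>+\<omega>. ennreal ((norm (elementary_integral L (xs n) \<omega> - I \<omega>))\<^sup>2) \<partial>M) < 1"
      using lim by (rule order_tendstoD) simp
    then obtain n where n: "(\<integral>\<^sup>+\<omega>. ennreal ((norm (elementary_integral L (xs n) \<omega> - I \<omega>))\<^sup>2) \<partial>M) < 1"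
      by (auto simp: eventually_sequentially)
    have [measurable]: "elementary_integral L (xs n) \<in> borel_measurable M"
      using sq_el by (rule square_integrable_measurable)
    note [measurable] = I
    have "integrable M (\<lambda>\<omega>. (norm (elementary_integral L (xs n) \<omega> - I \<omega>))\<^sup>2)"
      using order.strict_trans[OF n, of \<infinity>] by (intro integrableI_nonneg) auto
    then have "square_integrable M (\<lambda>\<omega>. elementary_integral L (xs n) \<omega> - I \<omega>)"
      by (simp add: square_integrable_def)
    from square_integrable_diff[OF sq_el[of n] this] show ?thesis by simp
  qed
  let ?d = "\<lambda>n s u. elementary_integrand (xs n) s u - \<Phi> s u"
  have d_lin: "bounded_linear (?d n s)" if "s \<in> {0..T}" for n s
    by (intro bounded_linear_sub bounded_linear_elementary_integrand lin that)
  have d_meas: "(\<lambda>s. mean_square (?d n s)) \<in> borel_measurable time_measure" for n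
  proof (rule borel_measurable_mean_square)
    fix u
    have "sets time_measure = sets (restrict_space borel {0..T})" by (simp add: sets_restrict_space)
    then have "(\<lambda>s. \<Phi> s u) \<in> borel_measurable time_measure"
      using meas[of u] measurable_cong_sets by blast
    moreover have "(\<lambda>s. elementary_integrand (xs n) s u) \<in> borel_measurable time_measure"
      by (intro measurable_restrict_space1) (simp add: borel_measurable_elementary_integrand)
    ultimately show "(\<lambda>s. ?d n s u) \<in> borel_measurable time_measure" by measurable
  qed (use d_lin in simp)
  have d_int: "integrable time_measure (\<lambda>s. mean_square (?d n s))" for n
  proof (rule integrable_time_bounded[OF d_meas])
    fix s assume s: "s \<in> {0..T}"
    have "mean_square (?d n s) \<le> ((\<Sum>(a, b, \<Phi>)\<leftarrow>xs n. norm \<Phi>) + c)\<^sup>2 * intensity"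
    proof (rule mean_square_le[OF d_lin[OF s]])
      fix u
      show "norm (?d n s u) \<le> ((\<Sum>(a, b, \<Phi>)\<leftarrow>xs n. norm \<Phi>) + c) * norm u"
        using norm_triangle_ineq4[of "elementary_integrand (xs n) s u" "\<Phi> s u"]
          norm_elementary_integrand_le[of "xs n" s u] bound[OF s, of u] by (simp add: distrib_right)
    qed
    then show "\<bar>mean_square (?d n s)\<bar> \<le> ((\<Sum>(a, b, \<Phi>)\<leftarrow>xs n. norm \<Phi>) + c)\<^sup>2 * intensity"
      using mean_square_nonneg by simp
  qed
  have "(\<lambda>n. \<integral>\<^sup>+s. ennreal (mean_square (?d n s)) \<partial>time_measure) \<longlonglongrightarrow> 0"
  proof (rule tendsto_sandwich[OF _ _ tendsto_const hs])
    have "(\<integral>\<^sup>+s. ennreal (mean_square (?d n s)) \<partial>time_measure)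
        \<le> (\<integral>\<^sup>+s. hs_norm_sq (\<lambda>u. ?d n s (blinfun_apply R u)) \<partial>time_measure)" for n
      by (intro nn_integral_mono
          levy_noise.mean_square_le_hs_norm_sq[OF levy_noise_covariance[OF QR(1)] d_lin QR(2)]) simp
    then show "\<forall>\<^sub>F n in sequentially. (\<integral>\<^sup>+s. ennreal (mean_square (?d n s)) \<partial>time_measure)
        \<le> (\<integral>\<^sup>+s\<in>{0..T}. hs_norm_sq (\<lambda>u. ?d n s (blinfun_apply R u)) \<partial>lborel)"
      by (simp add: nn_integral_restrict_space)
  qed simp
  then have "(\<lambda>n. \<integral>s. mean_square (?d n s) \<partial>time_measure) \<longlonglongrightarrow> 0"
    by (intro tendsto_integral_of_nn_integral d_int mean_square_nonneg)
  moreover have "(\<lambda>n. expectation (\<lambda>\<omega>. (norm (elementary_integral L (xs n) \<omega> - I \<omega>))\<^sup>2)) \<longlonglongrightarrow> 0"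
    using square_integrable_diff[OF sq_el sq_I]
    by (intro tendsto_integral_of_nn_integral lim) (auto simp: square_integrable_def)
  ultimately show thesis using that[of xs] el sq_I d_int by blast
qed

lemma expectation_norm_square_tendsto_combination:
  fixes X Y :: "nat \<Rightarrow> 'w \<Rightarrow> 'h"
  assumes X: "\<And>n. square_integrable M (X n)" "square_integrable M X'"
    "(\<lambda>n. expectation (\<lambda>\<omega>. (norm (X n \<omega> - X' \<omega>))\<^sup>2)) \<longlonglongrightarrow> 0"
    and Y: "\<And>n. square_integrable M (Y n)" "square_integrable M Y'"
    "(\<lambda>n. expectation (\<lambda>\<omega>. (norm (Y n \<omega> - Y' \<omega>))\<^sup>2)) \<longlonglongrightarrow> 0"
  shows "(\<lambda>n. expectation (\<lambda>\<omega>. (norm ((a *\<^sub>R X n \<omega> + b *\<^sub>R Y n \<omega>) - (a *\<^sub>R X' \<omega> + b *\<^sub>R Y' \<omega>)))\<^sup>2)) \<longlonglongrightarrow> 0"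
proof -
  have dX: "square_integrable M (\<lambda>\<omega>. X n \<omega> - X' \<omega>)" and dY: "square_integrable M (\<lambda>\<omega>. Y n \<omega> - Y' \<omega>)" for n
    by (intro square_integrable_diff X Y)+
  let ?e = "\<lambda>n. 2 * a\<^sup>2 * expectation (\<lambda>\<omega>. (norm (X n \<omega> - X' \<omega>))\<^sup>2) + 2 * b\<^sup>2 * expectation (\<lambda>\<omega>. (norm (Y n \<omega> - Y' \<omega>))\<^sup>2)"
  have "?e \<longlonglongrightarrow> 2 * a\<^sup>2 * 0 + 2 * b\<^sup>2 * 0" by (intro tendsto_intros X Y)
  then have e: "?e \<longlonglongrightarrow> 0" by simp
  have "expectation (\<lambda>\<omega>. (norm ((a *\<^sub>R X n \<omega> + b *\<^sub>R Y n \<omega>) - (a *\<^sub>R X' \<omega> + b *\<^sub>R Y' \<omega>)))\<^sup>2) \<le> ?e n" for n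
  proof -
    have "expectation (\<lambda>\<omega>. (norm ((a *\<^sub>R X n \<omega> + b *\<^sub>R Y n \<omega>) - (a *\<^sub>R X' \<omega> + b *\<^sub>R Y' \<omega>)))\<^sup>2)
        \<le> expectation (\<lambda>\<omega>. 2 * a\<^sup>2 * (norm (X n \<omega> - X' \<omega>))\<^sup>2 + 2 * b\<^sup>2 * (norm (Y n \<omega> - Y' \<omega>))\<^sup>2)"
    proof (rule integral_mono)
      show "integrable M (\<lambda>\<omega>. (norm ((a *\<^sub>R X n \<omega> + b *\<^sub>R Y n \<omega>) - (a *\<^sub>R X' \<omega> + b *\<^sub>R Y' \<omega>)))\<^sup>2)"
        using square_integrable_diff[OF square_integrable_add[OF square_integrable_scaleR[OF X(1)] square_integrable_scaleR[OF Y(1)]]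
            square_integrable_add[OF square_integrable_scaleR[OF X(2)] square_integrable_scaleR[OF Y(2)]]]
        by (simp add: square_integrable_def)
      show "integrable M (\<lambda>\<omega>. 2 * a\<^sup>2 * (norm (X n \<omega> - X' \<omega>))\<^sup>2 + 2 * b\<^sup>2 * (norm (Y n \<omega> - Y' \<omega>))\<^sup>2)"
        using dX[of n] dY[of n] by (simp add: square_integrable_def)
      fix \<omega>
      have eq: "(a *\<^sub>R X n \<omega> + b *\<^sub>R Y n \<omega>) - (a *\<^sub>R X' \<omega> + b *\<^sub>R Y' \<omega>)
          = a *\<^sub>R (X n \<omega> - X' \<omega>) + b *\<^sub>R (Y n \<omega> - Y' \<omega>)"
        by (simp add: algebra_simps)
      show "(norm ((a *\<^sub>R X n \<omega> + b *\<^sub>R Y n \<omega>) - (a *\<^sub>R X' \<omega> + b *\<^sub>R Y' \<omega>)))\<^sup>2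
          \<le> 2 * a\<^sup>2 * (norm (X n \<omega> - X' \<omega>))\<^sup>2 + 2 * b\<^sup>2 * (norm (Y n \<omega> - Y' \<omega>))\<^sup>2"
        unfolding eq
        using norm_add_square_le[of "a *\<^sub>R (X n \<omega> - X' \<omega>)" "b *\<^sub>R (Y n \<omega> - Y' \<omega>)"]
        by (simp add: power_mult_distrib)
    qed
    also have "\<dots> = ?e n" using dX[of n] dY[of n] by (simp add: square_integrable_def)
    finally show ?thesis .
  qed
  then have "\<forall>\<^sub>F n in sequentially. expectation (\<lambda>\<omega>. (norm ((a *\<^sub>R X n \<omega> + b *\<^sub>R Y n \<omega>) - (a *\<^sub>R X' \<omega> + b *\<^sub>R Y' \<omega>)))\<^sup>2) \<le> ?e n"
    by simp
  then show ?thesis by (rule tendsto_sandwich[OF _ _ tendsto_const e, rotated]) simp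
qed

end

section \<open>The pairing estimate for stochastic integrals\<close>

context levy_noise
begin

text \<open>
  For the approximations this is \<open>elementary_pairing\<close> with the weight \<open>\<theta>\<close>, the bound on \<open>\<Psi> - \<Phi>\<close>: the first
  factor contributes \<open>\<theta> c\<^sup>2\<close> and the second \<open>\<theta>\<^sup>2 / \<theta>\<close>, up to approximation errors which are multiplied by at
  most \<open>\<theta>\<^sub>1 + 1 / \<theta>\<^sub>0\<close> and vanish in the limit.
\<close>

lemma stochastic_integral_pairing:
  fixes \<Phi> \<Psi> :: "real \<Rightarrow> 'u \<Rightarrow> 'h" and H :: "'h \<Rightarrow> 'h"
  assumes int: "stochastic_integral M T L T \<Phi> I" "stochastic_integral M T L T \<Psi> J"
    and bound: "\<And>s u. s \<in> {0..T} \<Longrightarrow> norm (\<Phi> s u) \<le> c * norm u"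
      "\<And>s u. s \<in> {0..T} \<Longrightarrow> norm (\<Psi> s u) \<le> c * norm u"
    and diff: "\<And>s u. s \<in> {0..T} \<Longrightarrow> norm (\<Psi> s u - \<Phi> s u) \<le> \<theta> s * norm u"
    and \<theta>: "\<theta> \<in> borel_measurable time_measure" "0 < \<theta>\<^sub>0" "\<And>s. s \<in> {0..T} \<Longrightarrow> \<theta>\<^sub>0 \<le> \<theta> s \<and> \<theta> s \<le> \<theta>\<^sub>1"
    and H: "K-lipschitz_on UNIV H" and \<rho>: "0 \<le> \<rho>" "\<rho> \<le> 1"
  shows "\<bar>expectation (\<lambda>\<omega>. inner (H (d + ((1 - \<rho>) *\<^sub>R I \<omega> + \<rho> *\<^sub>R J \<omega>))) (J \<omega> - I \<omega>))\<bar>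
    \<le> K * ((c\<^sup>2 + 1) * intensity * (\<integral>s. \<theta> s \<partial>time_measure))"
proof -
  obtain xs where xs: "\<And>n. elementary_on T (xs n)" "square_integrable M I"
    "(\<lambda>n. expectation (\<lambda>\<omega>. (norm (elementary_integral L (xs n) \<omega> - I \<omega>))\<^sup>2)) \<longlonglongrightarrow> 0"
    "\<And>n. integrable time_measure (\<lambda>s. mean_square (\<lambda>u. elementary_integrand (xs n) s u - \<Phi> s u))"
    "(\<lambda>n. \<integral>s. mean_square (\<lambda>u. elementary_integrand (xs n) s u - \<Phi> s u) \<partial>time_measure) \<longlonglongrightarrow> 0"
    using stochastic_integral_approximation[OF int(1) bound(1)] by blast
  obtain ys where ys: "\<And>n. elementary_on T (ys n)" "square_integrable M J"
    "(\<lambda>n. expectation (\<lambda>\<omega>. (norm (elementary_integral L (ys n) \<omega> - J \<omega>))\<^sup>2)) \<longlonglongrightarrow> 0"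
    "\<And>n. integrable time_measure (\<lambda>s. mean_square (\<lambda>u. elementary_integrand (ys n) s u - \<Psi> s u))"
    "(\<lambda>n. \<integral>s. mean_square (\<lambda>u. elementary_integrand (ys n) s u - \<Psi> s u) \<partial>time_measure) \<longlonglongrightarrow> 0"
    using stochastic_integral_approximation[OF int(2) bound(2)] by blast
  let ?X = "\<lambda>n. elementary_integral L (xs n)" and ?Y = "\<lambda>n. elementary_integral L (ys n)"
  have sq: "square_integrable M (?X n)" "square_integrable M (?Y n)" for n
    by (intro elementary_integral_square_integrable xs ys)+
  have lin: "bounded_linear (\<Phi> s)" "bounded_linear (\<Psi> s)" if "s \<in> {0..T}" for s
    using int that by (simp_all add: stochastic_integral_def)
  \<comment> \<open>The deterministic shift is absorbed into the Lipschitz function.\<close>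
  define Hd where "Hd x = H (d + x)" for x
  have Hd: "K-lipschitz_on UNIV Hd"
  proof (rule lipschitz_onI)
    show "dist (Hd x) (Hd y) \<le> K * dist x y" for x y
      using lipschitz_onD[OF H, of "d + x" "d + y"] by (simp add: Hd_def)
  qed (rule lipschitz_on_nonneg[OF H])
  have K: "0 \<le> K" using H by (rule lipschitz_on_nonneg)
  define dx where "dx n s = mean_square (\<lambda>u. elementary_integrand (xs n) s u - \<Phi> s u)" for n s
  define dy where "dy n s = mean_square (\<lambda>u. elementary_integrand (ys n) s u - \<Psi> s u)" for n s
  \<comment> \<open>Elementary integrands of the argument of \<open>Hd\<close> and of the difference \<open>J - I\<close>.\<close>
  let ?W = "\<lambda>n. scale_elementary (1 - \<rho>) (xs n) @ scale_elementary \<rho> (ys n)"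
  let ?Z = "\<lambda>n. scale_elementary (- 1) (xs n) @ scale_elementary 1 (ys n)"
  have combine: "p \<le> 4 * (x + y) + 2 * z"
    if "p \<le> 2 * r + 2 * m" "r \<le> v" "v \<le> 2 * x + 2 * y" "m \<le> z" for p r m v x y z :: real
    using that by argo
  have W: "mean_square (elementary_integrand (?W n) s) \<le> 4 * (dx n s + dy n s) + 2 * (c\<^sup>2 * intensity)"
    if s: "s \<in> {0..T}" for n s
  proof -
    let ?a = "\<lambda>u. elementary_integrand (xs n) s u - \<Phi> s u"
    let ?b = "\<lambda>u. elementary_integrand (ys n) s u - \<Psi> s u"
    let ?m = "\<lambda>u. (1 - \<rho>) *\<^sub>R \<Phi> s u + \<rho> *\<^sub>R \<Psi> s u"
    have ab: "bounded_linear ?a" "bounded_linear ?b"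
      by (intro bounded_linear_sub bounded_linear_elementary_integrand lin s)+
    have m: "bounded_linear ?m" by (intro bounded_linear_add bounded_linear_const_scaleR lin s)
    have "elementary_integrand (?W n) s = (\<lambda>u. ((1 - \<rho>) *\<^sub>R ?a u + \<rho> *\<^sub>R ?b u) + ?m u)"
      by (simp add: fun_eq_iff elementary_integrand_append elementary_integrand_scale algebra_simps)
    then have 1: "mean_square (elementary_integrand (?W n) s)
        \<le> 2 * mean_square (\<lambda>u. (1 - \<rho>) *\<^sub>R ?a u + \<rho> *\<^sub>R ?b u) + 2 * mean_square ?m"
      by (simp only:) (intro mean_square_add_le bounded_linear_add bounded_linear_const_scaleR ab m lin s)
    have 2: "mean_square (\<lambda>u. (1 - \<rho>) *\<^sub>R ?a u + \<rho> *\<^sub>R ?b u)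
        \<le> 2 * mean_square (\<lambda>u. (1 - \<rho>) *\<^sub>R ?a u) + 2 * mean_square (\<lambda>u. \<rho> *\<^sub>R ?b u)"
      by (intro mean_square_add_le bounded_linear_const_scaleR ab)
    have 3: "2 * mean_square (\<lambda>u. (1 - \<rho>) *\<^sub>R ?a u) + 2 * mean_square (\<lambda>u. \<rho> *\<^sub>R ?b u)
        \<le> 2 * dx n s + 2 * dy n s"
    proof -
      have "(1 - \<rho>)\<^sup>2 \<le> 1" "\<rho>\<^sup>2 \<le> 1" using \<rho> by (auto intro: power_le_one)
      then have "(1 - \<rho>)\<^sup>2 * dx n s \<le> dx n s" "\<rho>\<^sup>2 * dy n s \<le> dy n s"
        unfolding dx_def dy_def using mean_square_nonneg by (auto intro!: mult_left_le_one_le)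
      then show ?thesis unfolding mean_square_scale dx_def dy_def by simp
    qed
    have "mean_square ?m \<le> c\<^sup>2 * intensity"
    proof (rule mean_square_le[OF m])
      fix u
      have "norm (?m u) \<le> (1 - \<rho>) * norm (\<Phi> s u) + \<rho> * norm (\<Psi> s u)"
        using norm_triangle_ineq[of "(1 - \<rho>) *\<^sub>R \<Phi> s u" "\<rho> *\<^sub>R \<Psi> s u"] \<rho> by simp
      also have "\<dots> \<le> (1 - \<rho>) * (c * norm u) + \<rho> * (c * norm u)"
        using \<rho> by (intro add_mono mult_left_mono bound s) auto
      finally show "norm (?m u) \<le> c * norm u" by (simp add: algebra_simps)
    qed
    then show ?thesis by (rule combine[OF 1 2 3])
  qed
  have Z: "mean_square (elementary_integrand (?Z n) s) \<le> 4 * (dx n s + dy n s) + 2 * ((\<theta> s)\<^sup>2 * intensity)"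
    if s: "s \<in> {0..T}" for n s
  proof -
    let ?a = "\<lambda>u. elementary_integrand (xs n) s u - \<Phi> s u"
    let ?b = "\<lambda>u. elementary_integrand (ys n) s u - \<Psi> s u"
    let ?m = "\<lambda>u. \<Psi> s u - \<Phi> s u"
    have ab: "bounded_linear ?a" "bounded_linear ?b"
      by (intro bounded_linear_sub bounded_linear_elementary_integrand lin s)+
    have m: "bounded_linear ?m" by (intro bounded_linear_sub lin s)
    have "elementary_integrand (?Z n) s = (\<lambda>u. ((- 1) *\<^sub>R ?a u + 1 *\<^sub>R ?b u) + ?m u)"
      by (simp add: fun_eq_iff elementary_integrand_append elementary_integrand_scale algebra_simps)
    then have 1: "mean_square (elementary_integrand (?Z n) s)
        \<le> 2 * mean_square (\<lambda>u. (- 1) *\<^sub>R ?a u + 1 *\<^sub>R ?b u) + 2 * mean_square ?m"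
      by (simp only:) (intro mean_square_add_le bounded_linear_add bounded_linear_const_scaleR ab m)
    have 2: "mean_square (\<lambda>u. (- 1) *\<^sub>R ?a u + 1 *\<^sub>R ?b u)
        \<le> 2 * mean_square (\<lambda>u. (- 1) *\<^sub>R ?a u) + 2 * mean_square (\<lambda>u. 1 *\<^sub>R ?b u)"
      by (intro mean_square_add_le bounded_linear_const_scaleR ab)
    have 3: "2 * mean_square (\<lambda>u. (- 1) *\<^sub>R ?a u) + 2 * mean_square (\<lambda>u. 1 *\<^sub>R ?b u)
        = 2 * dx n s + 2 * dy n s" unfolding mean_square_scale dx_def dy_def by simp
    have "mean_square ?m \<le> (\<theta> s)\<^sup>2 * intensity"
      by (rule mean_square_le[OF m diff[OF s]])
    then show ?thesis by (rule combine[OF 1 2 eq_refl[OF 3]])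
  qed
  define q where "q = \<theta>\<^sub>1 + 1 / \<theta>\<^sub>0"
  have \<theta>_int: "integrable time_measure \<theta>"
    using \<theta>(2,3) by (intro integrable_time_bounded[OF \<theta>(1), of \<theta>\<^sub>1]) force
  have pre: "\<bar>expectation (\<lambda>\<omega>. inner (Hd ((1 - \<rho>) *\<^sub>R ?X n \<omega> + \<rho> *\<^sub>R ?Y n \<omega>)) (- 1 *\<^sub>R ?X n \<omega> + 1 *\<^sub>R ?Y n \<omega>))\<bar>
      \<le> K * ((c\<^sup>2 + 1) * intensity * (\<integral>s. \<theta> s \<partial>time_measure)
        + 2 * q * ((\<integral>s. dx n s \<partial>time_measure) + (\<integral>s. dy n s \<partial>time_measure)))" for n
  proof -
    let ?g = "\<lambda>s. (\<theta> s * mean_square (elementary_integrand (?W n) s)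
        + mean_square (elementary_integrand (?Z n) s) / \<theta> s) / 2"
    have el: "elementary_on T (?W n)" "elementary_on T (?Z n)"
      using xs(1) ys(1) by (simp_all add: elementary_on_append elementary_on_scale)
    have ig: "integrable time_measure ?g"
      by (rule elementary_pairing(1)[OF el Hd \<theta>])
    have G1: "\<bar>expectation (\<lambda>\<omega>. inner (Hd ((1 - \<rho>) *\<^sub>R ?X n \<omega> + \<rho> *\<^sub>R ?Y n \<omega>)) (- 1 *\<^sub>R ?X n \<omega> + 1 *\<^sub>R ?Y n \<omega>))\<bar>
        \<le> K * (\<integral>s. ?g s \<partial>time_measure)"
      using elementary_pairing(2)[OF el Hd \<theta>]
      by (simp only: elementary_integral_append elementary_integral_scale)
    have G2: "(\<integral>s. ?g s \<partial>time_measure) \<le>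
        (\<integral>s. (c\<^sup>2 + 1) * intensity * \<theta> s + 2 * q * (dx n s + dy n s) \<partial>time_measure)"
    proof (rule integral_mono[OF ig])
      show "integrable time_measure (\<lambda>s. (c\<^sup>2 + 1) * intensity * \<theta> s + 2 * q * (dx n s + dy n s))"
        using \<theta>_int xs(4)[of n] ys(4)[of n] by (simp add: dx_def dy_def)
      fix s assume "s \<in> space time_measure"
      then have s: "s \<in> {0..T}" by simp
      have \<theta>s: "0 < \<theta> s" "\<theta> s \<le> \<theta>\<^sub>1" "1 / \<theta> s \<le> 1 / \<theta>\<^sub>0"
        using \<theta>(2) \<theta>(3)[OF s] by (auto intro!: divide_left_mono mult_pos_pos)
      have dd: "0 \<le> dx n s + dy n s" unfolding dx_def dy_def using mean_square_nonneg by simp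
      have "\<theta> s * mean_square (elementary_integrand (?W n) s) \<le> \<theta> s * (4 * (dx n s + dy n s) + 2 * (c\<^sup>2 * intensity))"
        using \<theta>s by (intro mult_left_mono W s) auto
      also have "\<dots> = 4 * (\<theta> s * (dx n s + dy n s)) + 2 * c\<^sup>2 * intensity * \<theta> s" by (simp add: algebra_simps)
      also have "\<dots> \<le> 4 * (\<theta>\<^sub>1 * (dx n s + dy n s)) + 2 * c\<^sup>2 * intensity * \<theta> s"
        using \<theta>s dd by (simp add: mult_right_mono)
      finally have 1: "\<theta> s * mean_square (elementary_integrand (?W n) s)
        \<le> 4 * (\<theta>\<^sub>1 * (dx n s + dy n s)) + 2 * c\<^sup>2 * intensity * \<theta> s" .
      have "mean_square (elementary_integrand (?Z n) s) / \<theta> s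
          \<le> (4 * (dx n s + dy n s) + 2 * ((\<theta> s)\<^sup>2 * intensity)) / \<theta> s"
        using \<theta>s by (intro divide_right_mono Z s) auto
      also have "\<dots> = 4 * (1 / \<theta> s * (dx n s + dy n s)) + 2 * intensity * \<theta> s"
        using \<theta>s by (simp add: field_simps power2_eq_square)
      also have "\<dots> \<le> 4 * (1 / \<theta>\<^sub>0 * (dx n s + dy n s)) + 2 * intensity * \<theta> s"
        by (intro add_right_mono mult_left_mono mult_right_mono \<theta>s(3) dd) simp
      finally have 2: "mean_square (elementary_integrand (?Z n) s) / \<theta> s
          \<le> 4 * (1 / \<theta>\<^sub>0 * (dx n s + dy n s)) + 2 * intensity * \<theta> s" .
      have "?g s \<le> ((4 * (\<theta>\<^sub>1 * (dx n s + dy n s)) + 2 * c\<^sup>2 * intensity * \<theta> s)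
          + (4 * (1 / \<theta>\<^sub>0 * (dx n s + dy n s)) + 2 * intensity * \<theta> s)) / 2"
        by (intro divide_right_mono add_mono 1 2) simp
      also have "\<dots> = (c\<^sup>2 + 1) * intensity * \<theta> s + 2 * q * (dx n s + dy n s)"
        unfolding q_def by (simp add: algebra_simps)
      finally show "?g s \<le> (c\<^sup>2 + 1) * intensity * \<theta> s + 2 * q * (dx n s + dy n s)" .
    qed
    have G3: "(\<integral>s. (c\<^sup>2 + 1) * intensity * \<theta> s + 2 * q * (dx n s + dy n s) \<partial>time_measure)
      = (c\<^sup>2 + 1) * intensity * (\<integral>s. \<theta> s \<partial>time_measure)
        + 2 * q * ((\<integral>s. dx n s \<partial>time_measure) + (\<integral>s. dy n s \<partial>time_measure))"
      using \<theta>_int xs(4)[of n] ys(4)[of n] by (simp add: dx_def dy_def)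
    show ?thesis by (rule order_trans[OF G1 mult_left_mono[OF ord_le_eq_trans[OF G2 G3] K]])
  qed
  have bound_lim: "(\<lambda>n. K * ((c\<^sup>2 + 1) * intensity * (\<integral>s. \<theta> s \<partial>time_measure)
        + 2 * q * ((\<integral>s. dx n s \<partial>time_measure) + (\<integral>s. dy n s \<partial>time_measure))))
      \<longlonglongrightarrow> K * ((c\<^sup>2 + 1) * intensity * (\<integral>s. \<theta> s \<partial>time_measure) + 2 * q * (0 + 0))"
    unfolding dx_def dy_def by (intro tendsto_intros xs(5) ys(5))
  have pairing_lim: "(\<lambda>n. \<bar>expectation (\<lambda>\<omega>. inner (Hd ((1 - \<rho>) *\<^sub>R ?X n \<omega> + \<rho> *\<^sub>R ?Y n \<omega>)) (- 1 *\<^sub>R ?X n \<omega> + 1 *\<^sub>R ?Y n \<omega>))\<bar>)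
      \<longlonglongrightarrow> \<bar>expectation (\<lambda>\<omega>. inner (Hd ((1 - \<rho>) *\<^sub>R I \<omega> + \<rho> *\<^sub>R J \<omega>)) (- 1 *\<^sub>R I \<omega> + 1 *\<^sub>R J \<omega>))\<bar>"
  proof (intro tendsto_rabs expectation_inner_tendsto)
    note comb = square_integrable_add[OF square_integrable_scaleR square_integrable_scaleR]
    show W_sq: "square_integrable M (\<lambda>\<omega>. Hd ((1 - \<rho>) *\<^sub>R ?X n \<omega> + \<rho> *\<^sub>R ?Y n \<omega>))" for n
      by (rule square_integrable_lipschitz[OF comb[OF sq] Hd])
    show W_lim_sq: "square_integrable M (\<lambda>\<omega>. Hd ((1 - \<rho>) *\<^sub>R I \<omega> + \<rho> *\<^sub>R J \<omega>))"
      by (rule square_integrable_lipschitz[OF comb[OF xs(2) ys(2)] Hd])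
    show "square_integrable M (\<lambda>\<omega>. - 1 *\<^sub>R ?X n \<omega> + 1 *\<^sub>R ?Y n \<omega>)" for n
      by (rule comb[OF sq])
    show "square_integrable M (\<lambda>\<omega>. - 1 *\<^sub>R I \<omega> + 1 *\<^sub>R J \<omega>)"
      by (rule comb[OF xs(2) ys(2)])
    show "(\<lambda>n. expectation (\<lambda>\<omega>. (norm ((- 1 *\<^sub>R ?X n \<omega> + 1 *\<^sub>R ?Y n \<omega>) - (- 1 *\<^sub>R I \<omega> + 1 *\<^sub>R J \<omega>)))\<^sup>2)) \<longlonglongrightarrow> 0"
      by (rule expectation_norm_square_tendsto_combination[OF sq(1) xs(2,3) sq(2) ys(2,3)])
    let ?e = "\<lambda>n. expectation (\<lambda>\<omega>. (norm (((1 - \<rho>) *\<^sub>R ?X n \<omega> + \<rho> *\<^sub>R ?Y n \<omega>) - ((1 - \<rho>) *\<^sub>R I \<omega> + \<rho> *\<^sub>R J \<omega>)))\<^sup>2)"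
    have "(\<lambda>n. K\<^sup>2 * ?e n) \<longlonglongrightarrow> K\<^sup>2 * 0"
      by (intro tendsto_mult tendsto_const
          expectation_norm_square_tendsto_combination[OF sq(1) xs(2,3) sq(2) ys(2,3)])
    then have e: "(\<lambda>n. K\<^sup>2 * ?e n) \<longlonglongrightarrow> 0" by simp
    show "(\<lambda>n. expectation (\<lambda>\<omega>. (norm (Hd ((1 - \<rho>) *\<^sub>R ?X n \<omega> + \<rho> *\<^sub>R ?Y n \<omega>)
        - Hd ((1 - \<rho>) *\<^sub>R I \<omega> + \<rho> *\<^sub>R J \<omega>)))\<^sup>2)) \<longlonglongrightarrow> 0"
    proof (rule tendsto_sandwich[OF _ _ tendsto_const e])
      show "\<forall>\<^sub>F n in sequentially. expectation (\<lambda>\<omega>. (norm (Hd ((1 - \<rho>) *\<^sub>R ?X n \<omega> + \<rho> *\<^sub>R ?Y n \<omega>)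
        - Hd ((1 - \<rho>) *\<^sub>R I \<omega> + \<rho> *\<^sub>R J \<omega>)))\<^sup>2) \<le> K\<^sup>2 * ?e n"
      proof (intro always_eventually allI)
        fix n
        have "expectation (\<lambda>\<omega>. (norm (Hd ((1 - \<rho>) *\<^sub>R ?X n \<omega> + \<rho> *\<^sub>R ?Y n \<omega>)
            - Hd ((1 - \<rho>) *\<^sub>R I \<omega> + \<rho> *\<^sub>R J \<omega>)))\<^sup>2)
          \<le> expectation (\<lambda>\<omega>. K\<^sup>2 * (norm (((1 - \<rho>) *\<^sub>R ?X n \<omega> + \<rho> *\<^sub>R ?Y n \<omega>) - ((1 - \<rho>) *\<^sub>R I \<omega> + \<rho> *\<^sub>R J \<omega>)))\<^sup>2)"
        proof (rule integral_mono)
          show "integrable M (\<lambda>\<omega>. (norm (Hd ((1 - \<rho>) *\<^sub>R ?X n \<omega> + \<rho> *\<^sub>R ?Y n \<omega>)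
            - Hd ((1 - \<rho>) *\<^sub>R I \<omega> + \<rho> *\<^sub>R J \<omega>)))\<^sup>2)"
            using square_integrable_diff[OF W_sq W_lim_sq] by (simp add: square_integrable_def)
          show "integrable M (\<lambda>\<omega>. K\<^sup>2 * (norm (((1 - \<rho>) *\<^sub>R ?X n \<omega> + \<rho> *\<^sub>R ?Y n \<omega>) - ((1 - \<rho>) *\<^sub>R I \<omega> + \<rho> *\<^sub>R J \<omega>)))\<^sup>2)"
            using square_integrable_diff[OF comb[OF sq] comb[OF xs(2) ys(2)]]
            by (intro integrable_mult_right) (simp add: square_integrable_def)
          fix \<omega>
          have "norm (Hd x - Hd y) \<le> K * norm (x - y)" for x y
            using lipschitz_onD[OF Hd, of x y] by (simp add: dist_norm)
          then show "(norm (Hd ((1 - \<rho>) *\<^sub>R ?X n \<omega> + \<rho> *\<^sub>R ?Y n \<omega>) - Hd ((1 - \<rho>) *\<^sub>R I \<omega> + \<rho> *\<^sub>R J \<omega>)))\<^sup>2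
            \<le> K\<^sup>2 * (norm (((1 - \<rho>) *\<^sub>R ?X n \<omega> + \<rho> *\<^sub>R ?Y n \<omega>) - ((1 - \<rho>) *\<^sub>R I \<omega> + \<rho> *\<^sub>R J \<omega>)))\<^sup>2"
            unfolding power_mult_distrib[symmetric] by (intro power_mono) auto
        qed
        then show "expectation (\<lambda>\<omega>. (norm (Hd ((1 - \<rho>) *\<^sub>R ?X n \<omega> + \<rho> *\<^sub>R ?Y n \<omega>)
        - Hd ((1 - \<rho>) *\<^sub>R I \<omega> + \<rho> *\<^sub>R J \<omega>)))\<^sup>2) \<le> K\<^sup>2 * ?e n" by simp
      qed
    qed simp
  qed
  have "\<bar>expectation (\<lambda>\<omega>. inner (Hd ((1 - \<rho>) *\<^sub>R I \<omega> + \<rho> *\<^sub>R J \<omega>)) (- 1 *\<^sub>R I \<omega> + 1 *\<^sub>R J \<omega>))\<bar>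
      \<le> K * ((c\<^sup>2 + 1) * intensity * (\<integral>s. \<theta> s \<partial>time_measure) + 2 * q * (0 + 0))"
    by (rule LIMSEQ_le[OF pairing_lim bound_lim]) (use pre in blast)
  then show ?thesis by (simp add: Hd_def)
qed

end

section \<open>Weak error of shifted stochastic integrals\<close>

text \<open>
  Mean value theorem on the segment from \<open>x\<close> to \<open>x + v\<close>.
\<close>

lemma gradient_taylor_bound:
  fixes \<phi> :: "'h::real_inner \<Rightarrow> real"
  assumes deriv: "\<And>x. (\<phi> has_derivative (\<lambda>v. inner (\<phi>' x) v)) (at x)" and lip: "K-lipschitz_on UNIV \<phi>'"
  shows "\<bar>\<phi> (x + v) - \<phi> x - inner (\<phi>' x) v\<bar> \<le> K * (norm v)\<^sup>2"
proof -
  have K: "0 \<le> K" using lip by (rule lipschitz_on_nonneg)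
  have "((\<lambda>t. \<phi> (x + t *\<^sub>R v)) has_real_derivative inner (\<phi>' (x + t *\<^sub>R v)) v) (at t)" for t
  proof -
    have "((\<lambda>t. x + t *\<^sub>R v) has_derivative (\<lambda>t. t *\<^sub>R v)) (at t)"
      by (auto intro!: derivative_eq_intros)
    from has_derivative_compose[OF this deriv]
    have "((\<lambda>t. \<phi> (x + t *\<^sub>R v)) has_derivative (\<lambda>r. r * inner (\<phi>' (x + t *\<^sub>R v)) v)) (at t)" by simp
    then show ?thesis by (simp add: has_field_derivative_def mult.commute[of _ "inner _ _"])
  qed
  then obtain \<tau> where \<tau>: "0 < \<tau>" "\<tau> < 1" "\<phi> (x + 1 *\<^sub>R v) - \<phi> (x + 0 *\<^sub>R v) = (1 - 0) * inner (\<phi>' (x + \<tau> *\<^sub>R v)) v"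
    using MVT2[of 0 1 "\<lambda>t. \<phi> (x + t *\<^sub>R v)" "\<lambda>t. inner (\<phi>' (x + t *\<^sub>R v)) v"] by auto
  have "\<phi> (x + v) - \<phi> x - inner (\<phi>' x) v = inner (\<phi>' (x + \<tau> *\<^sub>R v) - \<phi>' x) v"
    using \<tau>(3) by (simp add: inner_diff_left)
  also have "\<bar>\<dots>\<bar> \<le> norm (\<phi>' (x + \<tau> *\<^sub>R v) - \<phi>' x) * norm v" by (rule Cauchy_Schwarz_ineq2)
  also have "\<dots> \<le> (K * (\<tau> * norm v)) * norm v"
    using lipschitz_onD[OF lip, of "x + \<tau> *\<^sub>R v" x] \<tau> by (intro mult_right_mono) (auto simp: dist_norm)
  also have "\<dots> \<le> (K * (1 * norm v)) * norm v"
    using \<tau> K by (intro mult_right_mono mult_left_mono) auto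
  finally show ?thesis by (simp add: power2_eq_square mult.assoc)
qed

lemma has_real_derivative_of_quadratic_remainder:
  fixes g :: "real \<Rightarrow> real"
  assumes "\<And>y. \<bar>g y - g x - (y - x) * g'\<bar> \<le> C * (y - x)\<^sup>2"
  shows "(g has_real_derivative g') (at x)"
  unfolding has_field_derivative_iff
proof (rule LIM_zero_cancel, rule Lim_null_comparison)
  show "((\<lambda>y. \<bar>C\<bar> * \<bar>y - x\<bar>) \<longlongrightarrow> 0) (at x)" by (auto intro!: tendsto_eq_intros)
  show "\<forall>\<^sub>F y in at x. norm ((g y - g x) / (y - x) - g') \<le> \<bar>C\<bar> * \<bar>y - x\<bar>"
    unfolding eventually_at_filter
  proof (intro always_eventually allI impI)
    fix y assume "y \<noteq> x"
    then have "(g y - g x) / (y - x) - g' = (g y - g x - (y - x) * g') / (y - x)" by (simp add: diff_divide_distrib)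
    then have "norm ((g y - g x) / (y - x) - g') = \<bar>g y - g x - (y - x) * g'\<bar> / \<bar>y - x\<bar>" by simp
    also have "\<dots> \<le> (\<bar>C\<bar> * (y - x)\<^sup>2) / \<bar>y - x\<bar>"
      by (intro divide_right_mono order_trans[OF assms] mult_right_mono) auto
    also have "\<dots> = \<bar>C\<bar> * \<bar>y - x\<bar>"
    proof -
      have "z\<^sup>2 / \<bar>z\<bar> = \<bar>z\<bar>" for z :: real by (cases "0 \<le> z") (auto simp: power2_eq_square)
      then show ?thesis by (metis times_divide_eq_right)
    qed
    finally show "norm ((g y - g x) / (y - x) - g') \<le> \<bar>C\<bar> * \<bar>y - x\<bar>" .
  qed
qed

text \<open>
  Solutions are determined only up to null sets, so their measurability rests on completeness.
\<close>

lemma (in complete_measure) borel_measurable_AE_eq: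
  fixes f g :: "'a \<Rightarrow> 'b::topological_space"
  assumes g: "g \<in> borel_measurable M" and eq: "AE x in M. f x = g x"
  shows "f \<in> borel_measurable M"
proof (rule measurableI)
  fix B :: "'b set" assume "B \<in> sets borel"
  then have B: "g -` B \<inter> space M \<in> sets M" by (rule measurable_sets[OF g])
  have "AE x in M. x \<in> g -` B \<inter> space M \<longleftrightarrow> x \<in> f -` B \<inter> space M"
    using eq by eventually_elim auto
  then show "f -` B \<inter> space M \<in> sets M" by (rule in_sets_AE[OF _ B]) auto
qed simp

context levy_noise
begin

lemma stochastic_integral_zero:
  assumes "stochastic_integral M T L T \<Phi> I"
  shows "stochastic_integral M T L T (\<lambda>s u. 0 :: 'h) (\<lambda>\<omega>. 0)"
proof -
  obtain Q' R where QR: "covariance_operator M T L Q'" "operator_sqrt Q' R"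
    using assms unfolding stochastic_integral_def by blast
  have "hs_norm_sq (\<lambda>u :: 'u. 0 :: 'h) \<le> 0"
    unfolding hs_norm_sq_def by (rule SUP_least) simp
  then have "hs_norm_sq (\<lambda>u :: 'u. 0 :: 'h) = 0" by simp
  then show ?thesis
    unfolding stochastic_integral_def
    by (intro conjI exI[of _ Q'] exI[of _ R] exI[of _ "\<lambda>_. []"] QR)
      (simp_all add: elementary_on_def elementary_integrand_def elementary_integral_def)
qed

text \<open>
  The pairing of the integral with itself, that is, of \<open>I\<close> and the zero integral at \<open>\<rho> = 1\<close> with \<open>H\<close> the identity.
\<close>

lemma expectation_stochastic_integral_square_le:
  fixes \<Phi> :: "real \<Rightarrow> 'u \<Rightarrow> 'h"
  assumes int: "stochastic_integral M T L T \<Phi> I" and "0 \<le> c"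
    and bound: "\<And>s u. s \<in> {0..T} \<Longrightarrow> norm (\<Phi> s u) \<le> c * norm u"
  shows "expectation (\<lambda>\<omega>. (norm (I \<omega>))\<^sup>2) \<le> (c\<^sup>2 + 1) * intensity * ((c + 1) * T)"
proof -
  have id: "1-lipschitz_on UNIV (\<lambda>x :: 'h. x)" by (intro lipschitz_onI) auto
  have "norm (\<Phi> s u) \<le> (c + 1) * norm u" if "s \<in> {0..T}" for s u
    using bound[OF that, of u] by (simp add: distrib_right add_increasing2)
  then have "\<bar>expectation (\<lambda>\<omega>. inner (0 + ((1 - 1) *\<^sub>R 0 + 1 *\<^sub>R I \<omega>)) (I \<omega> - 0))\<bar>
      \<le> 1 * ((c\<^sup>2 + 1) * intensity * (\<integral>s. (c + 1) \<partial>time_measure))"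
    using \<open>0 \<le> c\<close>
    by (intro stochastic_integral_pairing[OF stochastic_integral_zero[OF int] int _ bound, where \<theta>\<^sub>0="c + 1" and \<theta>\<^sub>1="c + 1"] id)
      auto
  moreover have "measure time_measure {0..T} = T"
    using T_pos by (simp add: measure_restrict_space)
  ultimately show ?thesis by (simp add: power2_norm_eq_inner mult.commute[of T])
qed

text \<open>
  The function \<open>g \<rho> = E \<phi>(X + \<rho> D)\<close> interpolates between the two values.  Its derivative at \<open>\<rho>\<close> is the expectation of
  \<open>\<langle>\<phi>'(X + \<rho> D), D\<rangle>\<close>, because the Taylor remainder is quadratic.  In the derivative, the deterministic part of
  \<open>D\<close> is estimated by the first moment of the gradient, and the noise part by
  \<open>stochastic_integral_pairing\<close>.
\<close>

lemma weak_error_of_stochastic_integrals: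
  fixes \<Phi> \<Psi> :: "real \<Rightarrow> 'u \<Rightarrow> 'h" and \<phi> :: "'h \<Rightarrow> real"
  assumes int: "stochastic_integral M T L T \<Phi> I" "stochastic_integral M T L T \<Psi> J"
    and c: "0 \<le> c" "\<And>s u. s \<in> {0..T} \<Longrightarrow> norm (\<Phi> s u) \<le> c * norm u"
      "\<And>s u. s \<in> {0..T} \<Longrightarrow> norm (\<Psi> s u) \<le> c * norm u"
    and diff: "\<And>s u. s \<in> {0..T} \<Longrightarrow> norm (\<Psi> s u - \<Phi> s u) \<le> \<theta> s * norm u"
    and \<theta>: "\<theta> \<in> borel_measurable time_measure" "0 < \<theta>\<^sub>0" "\<And>s. s \<in> {0..T} \<Longrightarrow> \<theta>\<^sub>0 \<le> \<theta> s \<and> \<theta> s \<le> \<theta>\<^sub>1"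
    and deriv: "\<And>x. (\<phi> has_derivative (\<lambda>v. inner (\<phi>' x) v)) (at x)" and lip: "K-lipschitz_on UNIV \<phi>'"
  shows "integrable M (\<lambda>\<omega>. \<phi> (y + J \<omega>) - \<phi> (x + I \<omega>))"
    and "\<bar>expectation (\<lambda>\<omega>. \<phi> (y + J \<omega>) - \<phi> (x + I \<omega>))\<bar>
      \<le> (norm (\<phi>' 0) + K * (norm x + norm y + 1 + (c\<^sup>2 + 1) * intensity * ((c + 1) * T))) * norm (y - x)
        + K * ((c\<^sup>2 + 1) * intensity * (\<integral>s. \<theta> s \<partial>time_measure))"
proof -
  have K: "0 \<le> K" using lip by (rule lipschitz_on_nonneg)
  have sqI: "square_integrable M I" using stochastic_integral_approximation[OF int(1) c(2)] by blast
  have sqJ: "square_integrable M J" using stochastic_integral_approximation[OF int(2) c(3)] by blast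
  define m where "m = (c\<^sup>2 + 1) * intensity * ((c + 1) * T)"
  have norm_I: "expectation (\<lambda>\<omega>. norm (I \<omega>)) \<le> (1 + m) / 2" and norm_J: "expectation (\<lambda>\<omega>. norm (J \<omega>)) \<le> (1 + m) / 2"
  proof -
    have *: "expectation (\<lambda>\<omega>. norm (U \<omega>)) \<le> (1 + m) / 2"
      if "square_integrable M U" "expectation (\<lambda>\<omega>. (norm (U \<omega>))\<^sup>2) \<le> m" for U :: "'w \<Rightarrow> 'h"
    proof -
      have sq: "integrable M (\<lambda>\<omega>. (norm (U \<omega>))\<^sup>2)" using that(1) by (simp add: square_integrable_def)
      have "expectation (\<lambda>\<omega>. norm (U \<omega>)) \<le> expectation (\<lambda>\<omega>. (1 + (norm (U \<omega>))\<^sup>2) / 2)"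
      proof (rule integral_mono)
        show "norm (U \<omega>) \<le> (1 + (norm (U \<omega>))\<^sup>2) / 2" for \<omega>
          using sum_squares_bound[of 1 "norm (U \<omega>)"] by simp
      qed (use sq square_integrable_integrable[OF that(1)] in simp_all)
      also have "\<dots> = (1 + expectation (\<lambda>\<omega>. (norm (U \<omega>))\<^sup>2)) / 2" using sq by (simp add: prob_space)
      finally show ?thesis using that(2) by simp
    qed
    show "expectation (\<lambda>\<omega>. norm (I \<omega>)) \<le> (1 + m) / 2"
      by (rule *[OF sqI]) (unfold m_def, rule expectation_stochastic_integral_square_le[OF int(1) c(1,2)])
    show "expectation (\<lambda>\<omega>. norm (J \<omega>)) \<le> (1 + m) / 2"
      by (rule *[OF sqJ]) (unfold m_def, rule expectation_stochastic_integral_square_le[OF int(2) c(1,3)])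
  qed
  define X where "X \<omega> = x + I \<omega>" for \<omega>
  define D where "D \<omega> = (y - x) + (J \<omega> - I \<omega>)" for \<omega>
  have sqX: "square_integrable M X" and sqD: "square_integrable M D"
    unfolding X_def D_def by (intro square_integrable_add square_integrable_diff square_integrable_const sqI sqJ)+
  have sq: "square_integrable M (\<lambda>\<omega>. X \<omega> + \<rho> *\<^sub>R D \<omega>)" for \<rho>
    by (rule square_integrable_add[OF sqX square_integrable_scaleR[OF sqD]])
  have cont: "continuous_on UNIV \<phi>" by (rule has_derivative_continuous_on) (rule deriv)
  have taylor: "\<bar>\<phi> (a + v) - \<phi> a - inner (\<phi>' a) v\<bar> \<le> K * (norm v)\<^sup>2" for a v
    by (rule gradient_taylor_bound[OF deriv lip])
  have int_\<phi>: "integrable M (\<lambda>\<omega>. \<phi> (Z \<omega>))" if Z: "square_integrable M Z" for Z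
  proof (rule Bochner_Integration.integrable_bound)
    show "integrable M (\<lambda>\<omega>. \<bar>\<phi> 0\<bar> + norm (\<phi>' 0) * norm (Z \<omega>) + K * (norm (Z \<omega>))\<^sup>2)"
      using square_integrable_integrable[OF Z] Z by (simp add: square_integrable_def)
    show "(\<lambda>\<omega>. \<phi> (Z \<omega>)) \<in> borel_measurable M"
      using borel_measurable_continuous_onI[OF cont] square_integrable_measurable[OF Z] by (rule measurable_compose[rotated])
    show "AE \<omega> in M. norm (\<phi> (Z \<omega>)) \<le> norm (\<bar>\<phi> 0\<bar> + norm (\<phi>' 0) * norm (Z \<omega>) + K * (norm (Z \<omega>))\<^sup>2)"
    proof (intro AE_I2)
      fix \<omega>
      have "\<bar>\<phi> (Z \<omega>)\<bar> \<le> \<bar>\<phi> 0\<bar> + norm (\<phi>' 0) * norm (Z \<omega>) + K * (norm (Z \<omega>))\<^sup>2"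
        using taylor[of 0 "Z \<omega>"] Cauchy_Schwarz_ineq2[of "\<phi>' 0" "Z \<omega>"] by simp
      then show "norm (\<phi> (Z \<omega>)) \<le> norm (\<bar>\<phi> 0\<bar> + norm (\<phi>' 0) * norm (Z \<omega>) + K * (norm (Z \<omega>))\<^sup>2)" by simp
    qed
  qed
  define g where "g \<rho> = expectation (\<lambda>\<omega>. \<phi> (X \<omega> + \<rho> *\<^sub>R D \<omega>))" for \<rho>
  define g' where "g' \<rho> = expectation (\<lambda>\<omega>. inner (\<phi>' (X \<omega> + \<rho> *\<^sub>R D \<omega>)) (D \<omega>))" for \<rho>
  have grad_sq: "square_integrable M (\<lambda>\<omega>. \<phi>' (X \<omega> + \<rho> *\<^sub>R D \<omega>))" for \<rho>
    by (rule square_integrable_lipschitz[OF sq lip])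
  have "(g has_real_derivative g' \<rho>) (at \<rho>)" for \<rho>
  proof (rule has_real_derivative_of_quadratic_remainder)
    fix r
    have i: "integrable M (\<lambda>\<omega>. inner (\<phi>' (X \<omega> + \<rho> *\<^sub>R D \<omega>)) (D \<omega>))"
      by (rule square_integrable_integrable_inner[OF grad_sq sqD])
    have "g r - g \<rho> - (r - \<rho>) * g' \<rho>
        = expectation (\<lambda>\<omega>. \<phi> (X \<omega> + r *\<^sub>R D \<omega>) - \<phi> (X \<omega> + \<rho> *\<^sub>R D \<omega>)
            - (r - \<rho>) * inner (\<phi>' (X \<omega> + \<rho> *\<^sub>R D \<omega>)) (D \<omega>))"
      unfolding g_def g'_def using int_\<phi>[OF sq] i by simp
    also have "\<bar>\<dots>\<bar> \<le> expectation (\<lambda>\<omega>. (K * (r - \<rho>)\<^sup>2) * (norm (D \<omega>))\<^sup>2)"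
    proof (rule order_trans[OF integral_abs_bound integral_mono])
      show "integrable M (\<lambda>\<omega>. \<bar>\<phi> (X \<omega> + r *\<^sub>R D \<omega>) - \<phi> (X \<omega> + \<rho> *\<^sub>R D \<omega>)
            - (r - \<rho>) * inner (\<phi>' (X \<omega> + \<rho> *\<^sub>R D \<omega>)) (D \<omega>)\<bar>)"
        using int_\<phi>[OF sq] i by simp
      show "integrable M (\<lambda>\<omega>. (K * (r - \<rho>)\<^sup>2) * (norm (D \<omega>))\<^sup>2)"
        using sqD by (simp add: square_integrable_def)
      fix \<omega>
      have eq: "X \<omega> + r *\<^sub>R D \<omega> = (X \<omega> + \<rho> *\<^sub>R D \<omega>) + (r - \<rho>) *\<^sub>R D \<omega>" by (simp add: algebra_simps)
      show "\<bar>\<phi> (X \<omega> + r *\<^sub>R D \<omega>) - \<phi> (X \<omega> + \<rho> *\<^sub>R D \<omega>)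
            - (r - \<rho>) * inner (\<phi>' (X \<omega> + \<rho> *\<^sub>R D \<omega>)) (D \<omega>)\<bar> \<le> (K * (r - \<rho>)\<^sup>2) * (norm (D \<omega>))\<^sup>2"

        unfolding eq using taylor[of "X \<omega> + \<rho> *\<^sub>R D \<omega>" "(r - \<rho>) *\<^sub>R D \<omega>"] by (simp add: power_mult_distrib mult.assoc)
    qed
    also have "\<dots> = (K * expectation (\<lambda>\<omega>. (norm (D \<omega>))\<^sup>2)) * (r - \<rho>)\<^sup>2" by simp
    finally show "\<bar>g r - g \<rho> - (r - \<rho>) * g' \<rho>\<bar> \<le> (K * expectation (\<lambda>\<omega>. (norm (D \<omega>))\<^sup>2)) * (r - \<rho>)\<^sup>2" .
  qed
  then obtain \<rho> where \<rho>: "0 < \<rho>" "\<rho> < 1" "g 1 - g 0 = (1 - 0) * g' \<rho>"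
    using MVT2[of 0 1 g g'] by auto
  have XD: "X \<omega> + 0 *\<^sub>R D \<omega> = x + I \<omega>" "X \<omega> + 1 *\<^sub>R D \<omega> = y + J \<omega>" for \<omega>
    by (simp_all add: X_def D_def)
  have ints: "integrable M (\<lambda>\<omega>. \<phi> (x + I \<omega>))" "integrable M (\<lambda>\<omega>. \<phi> (y + J \<omega>))"
    using int_\<phi>[OF sq[of 0]] int_\<phi>[OF sq[of 1]] unfolding XD by auto
  show "integrable M (\<lambda>\<omega>. \<phi> (y + J \<omega>) - \<phi> (x + I \<omega>))" using ints by simp
  have "expectation (\<lambda>\<omega>. \<phi> (y + J \<omega>) - \<phi> (x + I \<omega>)) = g 1 - g 0"
    unfolding g_def XD using ints by simp
  also have "\<dots> = g' \<rho>" using \<rho>(3) by simp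
  also have "\<dots> = expectation (\<lambda>\<omega>. inner (\<phi>' (X \<omega> + \<rho> *\<^sub>R D \<omega>)) (y - x))
      + expectation (\<lambda>\<omega>. inner (\<phi>' (X \<omega> + \<rho> *\<^sub>R D \<omega>)) (J \<omega> - I \<omega>))"
    unfolding g'_def D_def inner_add_right using grad_sq[of \<rho>] sqI sqJ
    by (intro Bochner_Integration.integral_add square_integrable_integrable_inner square_integrable_const square_integrable_diff)
      (simp_all add: D_def)
  finally have split: "expectation (\<lambda>\<omega>. \<phi> (y + J \<omega>) - \<phi> (x + I \<omega>))
      = expectation (\<lambda>\<omega>. inner (\<phi>' (X \<omega> + \<rho> *\<^sub>R D \<omega>)) (y - x))
      + expectation (\<lambda>\<omega>. inner (\<phi>' (X \<omega> + \<rho> *\<^sub>R D \<omega>)) (J \<omega> - I \<omega>))" .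
  have path: "X \<omega> + \<rho> *\<^sub>R D \<omega> = ((1 - \<rho>) *\<^sub>R x + \<rho> *\<^sub>R y) + ((1 - \<rho>) *\<^sub>R I \<omega> + \<rho> *\<^sub>R J \<omega>)" for \<omega>
    by (simp add: X_def D_def algebra_simps)
  have noise: "\<bar>expectation (\<lambda>\<omega>. inner (\<phi>' (X \<omega> + \<rho> *\<^sub>R D \<omega>)) (J \<omega> - I \<omega>))\<bar>
      \<le> K * ((c\<^sup>2 + 1) * intensity * (\<integral>s. \<theta> s \<partial>time_measure))"
    unfolding path using \<rho> by (intro stochastic_integral_pairing[OF int c(2,3) diff \<theta> lip]) auto
  have drift: "\<bar>expectation (\<lambda>\<omega>. inner (\<phi>' (X \<omega> + \<rho> *\<^sub>R D \<omega>)) (y - x))\<bar>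
      \<le> (norm (\<phi>' 0) + K * (norm x + norm y + 1 + m)) * norm (y - x)"
  proof -
    have bound: "\<bar>inner (\<phi>' (X \<omega> + \<rho> *\<^sub>R D \<omega>)) (y - x)\<bar>
        \<le> (norm (\<phi>' 0) + K * (norm x + norm y + norm (I \<omega>) + norm (J \<omega>))) * norm (y - x)" for \<omega>
    proof -
      have "norm (X \<omega> + \<rho> *\<^sub>R D \<omega>) \<le> (norm ((1 - \<rho>) *\<^sub>R x) + norm (\<rho> *\<^sub>R y)) + (norm ((1 - \<rho>) *\<^sub>R I \<omega>) + norm (\<rho> *\<^sub>R J \<omega>))"
        unfolding path by (intro order_trans[OF norm_triangle_ineq] add_mono norm_triangle_ineq)
      also have "\<dots> \<le> (norm x + norm y) + (norm (I \<omega>) + norm (J \<omega>))"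
        unfolding norm_scaleR using \<rho> by (intro add_mono mult_left_le_one_le) auto
      finally have "norm (X \<omega> + \<rho> *\<^sub>R D \<omega>) \<le> norm x + norm y + norm (I \<omega>) + norm (J \<omega>)" by simp
      then have "K * norm (X \<omega> + \<rho> *\<^sub>R D \<omega>) \<le> K * (norm x + norm y + norm (I \<omega>) + norm (J \<omega>))"
        using K by (rule mult_left_mono)
      moreover have "norm (\<phi>' (X \<omega> + \<rho> *\<^sub>R D \<omega>)) \<le> norm (\<phi>' 0) + norm (\<phi>' (X \<omega> + \<rho> *\<^sub>R D \<omega>) - \<phi>' 0)"
        by (rule norm_triangle_sub)
      moreover have "norm (\<phi>' (X \<omega> + \<rho> *\<^sub>R D \<omega>) - \<phi>' 0) \<le> K * norm (X \<omega> + \<rho> *\<^sub>R D \<omega>)"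
        using lipschitz_onD[OF lip, of "X \<omega> + \<rho> *\<^sub>R D \<omega>" 0] by (simp add: dist_norm)
      ultimately have "norm (\<phi>' (X \<omega> + \<rho> *\<^sub>R D \<omega>)) \<le> norm (\<phi>' 0) + K * (norm x + norm y + norm (I \<omega>) + norm (J \<omega>))"
        by linarith
      then show ?thesis
        by (intro order_trans[OF Cauchy_Schwarz_ineq2] mult_right_mono) auto
    qed
    have iI: "integrable M (\<lambda>\<omega>. norm (I \<omega>))" and iJ: "integrable M (\<lambda>\<omega>. norm (J \<omega>))"
      using sqI sqJ by (auto intro: square_integrable_integrable)
    have "\<bar>expectation (\<lambda>\<omega>. inner (\<phi>' (X \<omega> + \<rho> *\<^sub>R D \<omega>)) (y - x))\<bar>
        \<le> expectation (\<lambda>\<omega>. (norm (\<phi>' 0) + K * (norm x + norm y + norm (I \<omega>) + norm (J \<omega>))) * norm (y - x))"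
    proof (rule order_trans[OF integral_abs_bound integral_mono])
      show "integrable M (\<lambda>\<omega>. \<bar>inner (\<phi>' (X \<omega> + \<rho> *\<^sub>R D \<omega>)) (y - x)\<bar>)"
        by (intro integrable_abs square_integrable_integrable_inner grad_sq square_integrable_const)
    qed (use iI iJ bound in simp_all)
    also have "\<dots> = (norm (\<phi>' 0) + K * (norm x + norm y + expectation (\<lambda>\<omega>. norm (I \<omega>)) + expectation (\<lambda>\<omega>. norm (J \<omega>)))) * norm (y - x)"
      using iI iJ by (simp add: prob_space)
    also have "\<dots> \<le> (norm (\<phi>' 0) + K * (norm x + norm y + 1 + m)) * norm (y - x)"
      using norm_I norm_J K by (intro mult_right_mono add_left_mono mult_left_mono) auto
    finally show ?thesis .
  qed
  show "\<bar>expectation (\<lambda>\<omega>. \<phi> (y + J \<omega>) - \<phi> (x + I \<omega>))\<bar>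
      \<le> (norm (\<phi>' 0) + K * (norm x + norm y + 1 + (c\<^sup>2 + 1) * intensity * ((c + 1) * T))) * norm (y - x)
        + K * ((c\<^sup>2 + 1) * intensity * (\<integral>s. \<theta> s \<partial>time_measure))"
    unfolding split m_def[symmetric] by (intro order_trans[OF abs_triangle_ineq] add_mono drift noise)
qed

end

section \<open>Weak convergence of the Galerkin approximation\<close>

lemma logarithmic_kernel_integral:
  fixes \<eta> T :: real
  assumes "0 < \<eta>" "0 < T"
  defines "N \<equiv> restrict_space lborel {0..T}"
  shows "integrable N (\<lambda>s. \<eta> / (\<eta> + (T - s)))"
    and "(\<integral>s. \<eta> / (\<eta> + (T - s)) \<partial>N) = \<eta> * (ln (\<eta> + T) - ln \<eta>)"
proof -
  let ?k = "\<lambda>s. \<eta> / (\<eta> + (T - s))"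
  have "has_bochner_integral lborel (\<lambda>s. ?k s * indicator {0..T} s)
      (- \<eta> * ln (\<eta> + (T - T)) - (- \<eta> * ln (\<eta> + (T - 0))))"
  proof (rule has_bochner_integral_FTC_Icc_nonneg[where F = "\<lambda>s. - \<eta> * ln (\<eta> + (T - s))"])
    fix s assume s: "s \<in> {0..T}"
    show "((\<lambda>s. - \<eta> * ln (\<eta> + (T - s))) has_real_derivative ?k s) (at s)"
      using assms s by (auto intro!: derivative_eq_intros)
    show "0 \<le> ?k s" using assms s by simp
  qed (use assms in auto)
  then have "integrable lborel (\<lambda>s. ?k s * indicator {0..T} s)"
    "integral\<^sup>L lborel (\<lambda>s. ?k s * indicator {0..T} s) = \<eta> * (ln (\<eta> + T) - ln \<eta>)"
    by (auto simp: has_bochner_integral_iff algebra_simps)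
  then show "integrable N ?k" "integral\<^sup>L N ?k = \<eta> * (ln (\<eta> + T) - ln \<eta>)"
    unfolding N_def by (simp_all add: integrable_restrict_space integral_restrict_space mult.commute[of _ "indicator _ _"])
qed

text \<open>
  The integral is \<open>h\<^sup>2 (ln (h\<^sup>2 + T) - ln (h\<^sup>2))\<close>; the second logarithm is the source of the factor
  \<open>1 + |ln h|\<close> in the rate.
\<close>

lemma logarithmic_kernel_integral_le:
  fixes h T :: real
  assumes "0 < h" "h \<le> 1" "0 < T"
  shows "(\<integral>s. h\<^sup>2 / (h\<^sup>2 + (T - s)) \<partial>restrict_space lborel {0..T}) \<le> (ln (1 + T) + 2) * ((1 + \<bar>ln h\<bar>) * h\<^sup>2)"
proof -
  have "h\<^sup>2 \<le> 1" using assms by (simp add: power_le_one)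
  then have "ln (h\<^sup>2 + T) \<le> ln (1 + T)" using assms by (subst ln_le_cancel_iff) (auto intro: add_pos_pos)
  moreover have "ln (h\<^sup>2) = - (2 * \<bar>ln h\<bar>)" using assms by (simp add: ln_realpow)
  moreover have "0 \<le> ln (1 + T) * \<bar>ln h\<bar>" using assms by (intro mult_nonneg_nonneg) auto
  ultimately have "ln (h\<^sup>2 + T) - ln (h\<^sup>2) \<le> (ln (1 + T) + 2) * (1 + \<bar>ln h\<bar>)"
    by (simp add: algebra_simps)
  then have "h\<^sup>2 * (ln (h\<^sup>2 + T) - ln (h\<^sup>2)) \<le> h\<^sup>2 * ((ln (1 + T) + 2) * (1 + \<bar>ln h\<bar>))"
    by (intro mult_left_mono) auto
  then show ?thesis using assms by (simp add: logarithmic_kernel_integral mult_ac)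
qed

context semigroup_with_eigenbasis
begin

text \<open>
  The semigroup error is applied at time \<open>T\<close> to the initial value and under the integral to \<open>f\<close>, where its
  singularity at \<open>s = T\<close> is integrated.
\<close>

lemma deterministic_part_error:
  fixes f :: "real \<Rightarrow> 'h" and initial :: 'h and T \<eta> b C :: real
  assumes V: "finite_dim_subspace V" "V \<subseteq> hdot e lam 1"
    and ritz: "\<And>x. x \<in> hdot e lam 2 \<Longrightarrow> norm (ritz_proj e lam V x - x) \<le> C * \<eta> * hdot_norm e lam 2 x"
    and "0 \<le> C" "0 < \<eta>" "0 < T"
    and f: "f \<in> borel_measurable (restrict_space borel {0..T})" "\<And>s. s \<in> {0..T} \<Longrightarrow> norm (f s) \<le> b"
  defines "N \<equiv> restrict_space lborel {0..T}"
    and "x \<equiv> blinfun_apply (S T) initial + set_lebesgue_integral lborel {0..T} (\<lambda>s. blinfun_apply (S (T - s)) (f s))"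
    and "y \<equiv> discrete_semigroup e lam V T (orth_proj V initial)
      + set_lebesgue_integral lborel {0..T} (\<lambda>s. discrete_semigroup e lam V (T - s) (orth_proj V (f s)))"
  shows "norm x \<le> norm initial + T * b" "norm y \<le> norm initial + T * b"
    and "norm (y - x) \<le> (28 * C + 4) * (\<eta> / (\<eta> + T) * norm initial + b * (\<integral>s. \<eta> / (\<eta> + (T - s)) \<partial>N))"
proof -
  let ?p = "\<lambda>s. blinfun_apply (S (T - s)) (f s)"
  let ?q = "\<lambda>s. discrete_semigroup e lam V (T - s) (orth_proj V (f s))"
  have space: "space N = {0..T}" by (simp add: N_def space_restrict_space)
  interpret N: finite_measure N
    unfolding N_def using \<open>0 < T\<close> by (intro finite_measureI) (simp add: emeasure_restrict_space)
  have measN: "measure N {0..T} = T"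
    unfolding N_def using \<open>0 < T\<close> by (simp add: measure_restrict_space)
  have set_int: "set_lebesgue_integral lborel {0..T} g = integral\<^sup>L N g" for g :: "real \<Rightarrow> 'h"
    unfolding N_def set_lebesgue_integral_def by (simp add: integral_restrict_space)
  have "sets N = sets (restrict_space borel {0..T})" by (simp add: N_def sets_restrict_space)
  then have f_meas: "f \<in> borel_measurable N" using f(1) measurable_cong_sets by blast
  have r: "(\<lambda>s. T - s) \<in> borel_measurable N" unfolding N_def by (intro measurable_restrict_space1) auto
  have p_le: "norm (?p s) \<le> b" and q_le: "norm (?q s) \<le> b" if "s \<in> {0..T}" for s
    using order_trans[OF semigroup_norm_le[of "T - s" "f s"] f(2)[OF that]]
      order_trans[OF galerkin_semigroup_norm_le[OF V, of "T - s" "f s"] f(2)[OF that]] that by auto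
  have p_int: "integrable N ?p"
    by (rule N.integrable_const_bound[of _ b]) (use p_le borel_measurable_semigroup[OF f_meas r] in \<open>auto simp: space\<close>)
  have q_int: "integrable N ?q"
    by (rule N.integrable_const_bound[of _ b]) (use q_le borel_measurable_galerkin_semigroup[OF V f_meas r] in \<open>auto simp: space\<close>)
  have integral_le: "norm (integral\<^sup>L N g) \<le> T * b"
    if "integrable N g" "\<And>s. s \<in> {0..T} \<Longrightarrow> norm (g s) \<le> b" for g :: "real \<Rightarrow> 'h"
  proof -
    have "norm (integral\<^sup>L N g) \<le> (\<integral>s. norm (g s) \<partial>N)" by (rule integral_norm_bound)
    also have "\<dots> \<le> (\<integral>s. b \<partial>N)" using that by (intro integral_mono) (auto simp: space)
    finally show ?thesis by (simp add: space measN)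
  qed
  show "norm x \<le> norm initial + T * b"
    unfolding x_def set_int using \<open>0 < T\<close>
    by (intro order_trans[OF norm_triangle_ineq] add_mono semigroup_norm_le integral_le p_int p_le) auto
  show "norm y \<le> norm initial + T * b"
    unfolding y_def set_int using \<open>0 < T\<close>
    by (intro order_trans[OF norm_triangle_ineq] add_mono galerkin_semigroup_norm_le V integral_le q_int q_le) auto
  have err: "norm (discrete_semigroup e lam V t (orth_proj V z) - blinfun_apply (S t) z)
      \<le> (28 * C + 4) * (\<eta> / (\<eta> + t)) * norm z" if "0 \<le> t" for t z
    by (rule galerkin_semigroup_error_uniform[OF V ritz \<open>0 \<le> C\<close> \<open>0 < \<eta>\<close> that])
  have k_int: "integrable N (\<lambda>s. \<eta> / (\<eta> + (T - s)))"
    unfolding N_def by (rule logarithmic_kernel_integral[OF \<open>0 < \<eta>\<close> \<open>0 < T\<close>])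
  have "norm (integral\<^sup>L N ?q - integral\<^sup>L N ?p) \<le> (28 * C + 4) * (b * (\<integral>s. \<eta> / (\<eta> + (T - s)) \<partial>N))"
  proof -
    have "integral\<^sup>L N ?q - integral\<^sup>L N ?p = (\<integral>s. ?q s - ?p s \<partial>N)" using p_int q_int by simp
    also have "norm \<dots> \<le> (\<integral>s. norm (?q s - ?p s) \<partial>N)" by (rule integral_norm_bound)
    also have "\<dots> \<le> (\<integral>s. (28 * C + 4) * b * (\<eta> / (\<eta> + (T - s))) \<partial>N)"
    proof (rule integral_mono[OF _ integrable_mult_right[OF k_int]])
      show "integrable N (\<lambda>s. norm (?q s - ?p s))" using p_int q_int by simp
      fix s assume "s \<in> space N"
      then have s: "s \<in> {0..T}" by (simp add: space)
      then have "norm (?q s - ?p s) \<le> (28 * C + 4) * (\<eta> / (\<eta> + (T - s))) * norm (f s)" by (intro err) auto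
      also have "\<dots> \<le> (28 * C + 4) * (\<eta> / (\<eta> + (T - s))) * b"
        using s \<open>0 < \<eta>\<close> \<open>0 \<le> C\<close> by (intro mult_left_mono f(2)) auto
      finally show "norm (?q s - ?p s) \<le> (28 * C + 4) * b * (\<eta> / (\<eta> + (T - s)))" by (simp only: mult_ac)
    qed
    also have "\<dots> = (28 * C + 4) * (b * (\<integral>s. \<eta> / (\<eta> + (T - s)) \<partial>N))" by (simp only: Bochner_Integration.integral_mult_right_zero mult.assoc)
    finally show ?thesis .
  qed
  moreover have "norm (discrete_semigroup e lam V T (orth_proj V initial) - blinfun_apply (S T) initial)
      \<le> (28 * C + 4) * (\<eta> / (\<eta> + T) * norm initial)"
    using err[of T initial] \<open>0 < T\<close> by (simp only: mult.assoc less_imp_le)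
  moreover have "y - x = (discrete_semigroup e lam V T (orth_proj V initial) - blinfun_apply (S T) initial)
      + (integral\<^sup>L N ?q - integral\<^sup>L N ?p)"
    unfolding x_def y_def set_int by simp
  ultimately show "norm (y - x) \<le> (28 * C + 4) * (\<eta> / (\<eta> + T) * norm initial + b * (\<integral>s. \<eta> / (\<eta> + (T - s)) \<partial>N))"
    by (metis (no_types, lifting) norm_triangle_le add_mono distrib_left)
qed

end

theorem theorem3p4:
  fixes T :: real
    and M :: "'w measure" and F :: "real \<Rightarrow> 'w measure"
    and L :: "real \<Rightarrow> 'w \<Rightarrow> 'u::{real_inner, banach, second_countable_topology}"
    and \<nu> :: "'u measure"
    and D :: "'h::{real_inner, banach, second_countable_topology} set"
    and A :: "'h \<Rightarrow> 'h" and S :: "real \<Rightarrow> 'h \<Rightarrow>\<^sub>L 'h"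
    and e :: "nat \<Rightarrow> 'h" and lam :: "nat \<Rightarrow> real"
    and f :: "real \<Rightarrow> 'h" and G :: "real \<Rightarrow> 'u \<Rightarrow>\<^sub>L 'h" and x0 :: 'h
    and V :: "real \<Rightarrow> 'h set"
    and X :: "real \<Rightarrow> 'w \<Rightarrow> 'h" and Xh :: "real \<Rightarrow> real \<Rightarrow> 'w \<Rightarrow> 'h"
    and \<phi> :: "'h \<Rightarrow> real" and \<phi>' :: "'h \<Rightarrow> 'h"
  assumes "0 < T"
    and noise: "pure_jump_levy_noise M T F L \<nu>"
    and A: "self_adjoint_on D A" "positive_definite_on D A" "has_compact_inverse D A"
    and S: "contraction_semigroup_of D A S"
    and basis: "eigenbasis D A e lam"
    and f: "f \<in> borel_measurable (restrict_space borel {0..T})" "bounded (f ` {0..T})"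
    and G: "\<And>u. (\<lambda>s. blinfun_apply (G s) u) \<in> borel_measurable (restrict_space borel {0..T})"
      "bounded (G ` {0..T})"
    and V: "\<And>h. h \<in> {0<..1} \<Longrightarrow> finite_dim_subspace (V h) \<and> V h \<subseteq> hdot e lam 1"
    and ritz: "\<exists>C. \<forall>h\<in>{0<..1}. \<forall>\<beta>\<in>{1, 2}. \<forall>x\<in>hdot e lam \<beta>.
      norm (ritz_proj e lam (V h) x - x) \<le> C * h powr \<beta> * hdot_norm e lam \<beta> x"
    and X: "mild_solution M T L S x0 f G X"
    and Xh: "\<And>h. h \<in> {0<..1} \<Longrightarrow> galerkin_approximation M T L e lam (V h) x0 f G (Xh h)"
    and \<phi>: "\<And>x. (\<phi> has_derivative (\<lambda>v. inner (\<phi>' x) v)) (at x)"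
      "continuous_on UNIV \<phi>'" "\<exists>K. K-lipschitz_on UNIV \<phi>'"
  shows "\<exists>C>0. \<forall>h\<in>{0<..1}.
    integrable M (\<lambda>\<omega>. \<phi> (Xh h T \<omega>) - \<phi> (X T \<omega>)) \<and>
    \<bar>\<integral>\<omega>. (\<phi> (Xh h T \<omega>) - \<phi> (X T \<omega>)) \<partial>M\<bar> \<le> C * (1 + \<bar>ln h\<bar>) * h\<^sup>2"
proof -
  interpret semigroup_with_eigenbasis D A S e lam
    by (rule semigroup_with_eigenbasis.intro[OF S basis])
  let ?\<Phi> = "\<lambda>s u. blinfun_apply (S (T - s)) (blinfun_apply (G s) u)"
  define x where "x = blinfun_apply (S T) x0
    + set_lebesgue_integral lborel {0..T} (\<lambda>s. blinfun_apply (S (T - s)) (f s))"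
  obtain I where I: "stochastic_integral M T L T ?\<Phi> I" "AE \<omega> in M. X T \<omega> = x + I \<omega>"
    using X \<open>0 < T\<close> unfolding mild_solution_def variation_of_constants_def x_def by fastforce
  obtain Q where Q: "covariance_operator M T L Q"
    using I(1) unfolding stochastic_integral_def by blast
  interpret prob_space M using noise by (simp add: pure_jump_levy_noise_def)
  interpret complete_measure M using noise by (simp add: pure_jump_levy_noise_def)
  interpret levy_noise M e T F L Q
    using noise \<open>0 < T\<close> Q
    by (intro levy_noise.intro levy_noise_axioms.intro prob_space_axioms hilbert_basis_axioms)
      (simp_all add: pure_jump_levy_noise_def)
  obtain C\<^sub>0 where C\<^sub>0: "\<And>h \<beta> x. h \<in> {0<..1} \<Longrightarrow> \<beta> \<in> {1, 2} \<Longrightarrow> x \<in> hdot e lam \<beta> \<Longrightarrow>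
      norm (ritz_proj e lam (V h) x - x) \<le> C\<^sub>0 * h powr \<beta> * hdot_norm e lam \<beta> x"
    using ritz by blast
  \<comment> \<open>The constant of the assumption need not be nonnegative.\<close>
  define C where "C = max C\<^sub>0 0"
  have C: "0 \<le> C" by (simp add: C_def)
  have ritz2: "norm (ritz_proj e lam (V h) x - x) \<le> C * h\<^sup>2 * hdot_norm e lam 2 x"
    if "h \<in> {0<..1}" "x \<in> hdot e lam 2" for h x
  proof -
    have "norm (ritz_proj e lam (V h) x - x) \<le> C\<^sub>0 * h powr 2 * hdot_norm e lam 2 x"
      by (rule C\<^sub>0[OF that(1) _ that(2)]) simp
    also have "\<dots> \<le> C * h powr 2 * hdot_norm e lam 2 x"
      unfolding C_def hdot_norm_def by (intro mult_right_mono) auto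
    finally show ?thesis using that(1) by simp
  qed
  obtain K where lip: "K-lipschitz_on UNIV \<phi>'" using \<phi>(3) by blast
  then have K: "0 \<le> K" by (rule lipschitz_on_nonneg)
  obtain b where "\<forall>z\<in>f ` {0..T}. norm z \<le> b"
    using f(2) unfolding bounded_iff by blast
  then have b: "norm (f s) \<le> b" if "s \<in> {0..T}" for s using that by blast
  have b0: "0 \<le> b" using order_trans[OF norm_ge_zero b[of 0]] \<open>0 < T\<close> by simp
  obtain \<gamma>\<^sub>0 where "\<forall>z\<in>G ` {0..T}. norm z \<le> \<gamma>\<^sub>0"
    using G(2) unfolding bounded_iff by blast
  then have \<gamma>\<^sub>0: "norm (G s) \<le> \<gamma>\<^sub>0" if "s \<in> {0..T}" for s using that by blast
  \<comment> \<open>The maximum with 1 keeps the weight \<open>\<theta>\<close> below strictly positive even if \<open>G = 0\<close>.\<close>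
  define \<gamma> where "\<gamma> = max \<gamma>\<^sub>0 1"
  have \<gamma>: "0 < \<gamma>" by (simp add: \<gamma>_def)
  have G_le: "norm (blinfun_apply (G s) u) \<le> \<gamma> * norm u" if "s \<in> {0..T}" for s u
  proof -
    have "norm (G s) \<le> \<gamma>" using \<gamma>\<^sub>0[OF that] by (simp add: \<gamma>_def)
    then show ?thesis by (rule order_trans[OF norm_blinfun mult_right_mono]) simp
  qed
  define \<kappa> where "\<kappa> = 28 * C + 4"
  have \<kappa>: "0 < \<kappa>" using C by (simp add: \<kappa>_def)
  define \<Lambda> where "\<Lambda> = ln (1 + T) + 2"
  have \<Lambda>: "0 \<le> \<Lambda>" using \<open>0 < T\<close> by (simp add: \<Lambda>_def)
  \<comment> \<open>\<open>W\<close> bounds the first moment of the gradient along the segment, uniformly in \<open>h\<close>.\<close>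
  define W where "W = norm (\<phi>' 0) + K * (2 * (norm x0 + T * b) + 1 + (\<gamma>\<^sup>2 + 1) * intensity * ((\<gamma> + 1) * T))"
  have W: "0 \<le> W"
    unfolding W_def using K b0 \<gamma> \<open>0 < T\<close> intensity_nonneg
    by (intro add_nonneg_nonneg mult_nonneg_nonneg) auto
  define E where "E = W * (\<kappa> * (norm x0 / T + b * \<Lambda>)) + K * ((\<gamma>\<^sup>2 + 1) * intensity * (\<gamma> * \<kappa> * \<Lambda>))"
  have E: "0 \<le> E"
    unfolding E_def using W \<kappa> K b0 \<Lambda> \<gamma> \<open>0 < T\<close> intensity_nonneg
    by (intro add_nonneg_nonneg mult_nonneg_nonneg divide_nonneg_pos) auto
  have main: "integrable M (\<lambda>\<omega>. \<phi> (Xh h T \<omega>) - \<phi> (X T \<omega>)) \<and>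
    \<bar>\<integral>\<omega>. (\<phi> (Xh h T \<omega>) - \<phi> (X T \<omega>)) \<partial>M\<bar> \<le> (E + 1) * (1 + \<bar>ln h\<bar>) * h\<^sup>2" if h: "h \<in> {0<..1}" for h
  proof -
    let ?\<eta> = "h\<^sup>2" and ?l = "(1 + \<bar>ln h\<bar>) * h\<^sup>2"
    have \<eta>: "0 < ?\<eta>" using h by simp
    have l: "?\<eta> \<le> ?l" using mult_right_mono[of 1 "1 + \<bar>ln h\<bar>" "h\<^sup>2"] by simp
    note Vh = conjunct1[OF V[OF h]] conjunct2[OF V[OF h]]
    let ?\<Psi> = "\<lambda>s u. discrete_semigroup e lam (V h) (T - s) (orth_proj (V h) (blinfun_apply (G s) u))"
    define y where "y = discrete_semigroup e lam (V h) T (orth_proj (V h) x0)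
      + set_lebesgue_integral lborel {0..T} (\<lambda>s. discrete_semigroup e lam (V h) (T - s) (orth_proj (V h) (f s)))"
    obtain J where J: "stochastic_integral M T L T ?\<Psi> J" "AE \<omega> in M. Xh h T \<omega> = y + J \<omega>"
      using Xh[OF h] \<open>0 < T\<close> unfolding galerkin_approximation_def variation_of_constants_def y_def by fastforce
    note det = deterministic_part_error[OF Vh ritz2[OF h] C \<eta> \<open>0 < T\<close> f(1) b, where initial = x0, folded x_def y_def \<kappa>_def]
    \<comment> \<open>The bound on the error of the semigroup at time \<open>T - s\<close>, up to the factor \<open>\<kappa>\<close>.\<close>
    define k where "k s = ?\<eta> / (?\<eta> + (T - s))" for s
    have k_int: "(\<integral>s. k s \<partial>time_measure) \<le> \<Lambda> * ?l"
      unfolding k_def \<Lambda>_def using h \<open>0 < T\<close> by (intro logarithmic_kernel_integral_le) auto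
    have k_nonneg: "0 \<le> k s" if "s \<in> {0..T}" for s using that \<eta> by (simp add: k_def)
    have yx: "norm (y - x) \<le> \<kappa> * (norm x0 / T + b * \<Lambda>) * ?l"
    proof -
      have "?\<eta> / (?\<eta> + T) * norm x0 \<le> ?\<eta> / T * norm x0"
        using \<eta> \<open>0 < T\<close> by (intro mult_right_mono divide_left_mono mult_pos_pos add_pos_pos) auto
      also have "\<dots> \<le> ?l / T * norm x0" using l \<open>0 < T\<close> by (intro mult_right_mono divide_right_mono) auto
      finally have "?\<eta> / (?\<eta> + T) * norm x0 + b * (\<integral>s. k s \<partial>time_measure) \<le> ?l / T * norm x0 + b * (\<Lambda> * ?l)"
        by (intro add_mono mult_left_mono k_int b0)
      then have "\<kappa> * (?\<eta> / (?\<eta> + T) * norm x0 + b * (\<integral>s. k s \<partial>time_measure)) \<le> \<kappa> * (?l / T * norm x0 + b * (\<Lambda> * ?l))"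
        using \<kappa> by (intro mult_left_mono) auto
      then have "norm (y - x) \<le> \<kappa> * (?l / T * norm x0 + b * (\<Lambda> * ?l))"
        using det(3) unfolding k_def by linarith
      also have "\<dots> = \<kappa> * (norm x0 / T + b * \<Lambda>) * ?l" by (simp add: algebra_simps add_divide_distrib)
      finally show ?thesis .
    qed
    have semigroup_le: "norm (?\<Phi> s u) \<le> \<gamma> * norm u" "norm (?\<Psi> s u) \<le> \<gamma> * norm u" if "s \<in> {0..T}" for s u
      using order_trans[OF semigroup_norm_le G_le[OF that, of u], of "T - s"]
        order_trans[OF galerkin_semigroup_norm_le[OF Vh] G_le[OF that, of u], of "T - s"] that by auto
    have diff: "norm (?\<Psi> s u - ?\<Phi> s u) \<le> (\<gamma> * \<kappa> * k s) * norm u" if "s \<in> {0..T}" for s u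
    proof -
      have "norm (?\<Psi> s u - ?\<Phi> s u) \<le> \<kappa> * k s * norm (blinfun_apply (G s) u)"
        unfolding \<kappa>_def k_def using that
        by (intro galerkin_semigroup_error_uniform[OF Vh ritz2[OF h] C \<eta>]) auto
      also have "\<dots> \<le> \<kappa> * k s * (\<gamma> * norm u)"
        using \<kappa> k_nonneg[OF that] by (intro mult_left_mono G_le that) auto
      finally show ?thesis by (simp add: mult_ac)
    qed
    have k_meas: "(\<lambda>s. \<gamma> * \<kappa> * k s) \<in> borel_measurable time_measure"
      unfolding k_def by (intro measurable_restrict_space1) simp
    have k_bounds: "\<gamma> * \<kappa> * (?\<eta> / (?\<eta> + T)) \<le> \<gamma> * \<kappa> * k s \<and> \<gamma> * \<kappa> * k s \<le> \<gamma> * \<kappa> * 1" if "s \<in> {0..T}" for s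
    proof -
      have pos: "0 < ?\<eta> + (T - s)" using that \<eta> by (intro add_pos_nonneg) auto
      have "?\<eta> / (?\<eta> + T) \<le> k s"
        unfolding k_def using that by (intro divide_left_mono mult_pos_pos pos add_pos_pos[OF \<eta> \<open>0 < T\<close>]) auto
      moreover have "k s \<le> 1" unfolding k_def using that pos by (simp add: pos_divide_le_eq)
      ultimately show ?thesis using \<gamma> \<kappa> by (intro conjI mult_left_mono) auto
    qed
    have k_low: "0 < \<gamma> * \<kappa> * (?\<eta> / (?\<eta> + T))"
      using \<gamma> \<kappa> \<eta> \<open>0 < T\<close> by (intro mult_pos_pos divide_pos_pos add_pos_pos)
    note weak = weak_error_of_stochastic_integrals[OF I(1) J(1) less_imp_le[OF \<gamma>] semigroup_le diff k_meas k_low k_bounds \<phi>(1) lip,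
        of y x]
    have AE_eq: "AE \<omega> in M. \<phi> (Xh h T \<omega>) - \<phi> (X T \<omega>) = \<phi> (y + J \<omega>) - \<phi> (x + I \<omega>)"
      using I(2) J(2) by eventually_elim simp
    have meas: "(\<lambda>\<omega>. \<phi> (Xh h T \<omega>) - \<phi> (X T \<omega>)) \<in> borel_measurable M"
      by (rule borel_measurable_AE_eq[OF borel_measurable_integrable[OF weak(1)] AE_eq])
    have int: "integrable M (\<lambda>\<omega>. \<phi> (Xh h T \<omega>) - \<phi> (X T \<omega>))"
      using integrable_cong_AE[OF meas borel_measurable_integrable[OF weak(1)] AE_eq] weak(1) by blast
    have "(\<integral>\<omega>. (\<phi> (Xh h T \<omega>) - \<phi> (X T \<omega>)) \<partial>M) = (\<integral>\<omega>. \<phi> (y + J \<omega>) - \<phi> (x + I \<omega>) \<partial>M)"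
      by (rule integral_cong_AE[OF meas borel_measurable_integrable[OF weak(1)] AE_eq])
    then have "\<bar>\<integral>\<omega>. (\<phi> (Xh h T \<omega>) - \<phi> (X T \<omega>)) \<partial>M\<bar>
      \<le> (norm (\<phi>' 0) + K * (norm x + norm y + 1 + (\<gamma>\<^sup>2 + 1) * intensity * ((\<gamma> + 1) * T))) * norm (y - x)
        + K * ((\<gamma>\<^sup>2 + 1) * intensity * (\<integral>s. \<gamma> * \<kappa> * k s \<partial>time_measure))"
      using weak(2) by simp
    also have "\<dots> \<le> W * (\<kappa> * (norm x0 / T + b * \<Lambda>) * ?l) + K * ((\<gamma>\<^sup>2 + 1) * intensity * (\<gamma> * \<kappa> * (\<Lambda> * ?l)))"
    proof (rule add_mono)
      have "norm x + norm y \<le> 2 * (norm x0 + T * b)"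
        unfolding mult_2 by (rule add_mono[OF det(1,2)])
      then have "norm (\<phi>' 0) + K * (norm x + norm y + 1 + (\<gamma>\<^sup>2 + 1) * intensity * ((\<gamma> + 1) * T)) \<le> W"
        unfolding W_def using K by (intro add_left_mono mult_left_mono add_right_mono)
      then show "(norm (\<phi>' 0) + K * (norm x + norm y + 1 + (\<gamma>\<^sup>2 + 1) * intensity * ((\<gamma> + 1) * T))) * norm (y - x)
          \<le> W * (\<kappa> * (norm x0 / T + b * \<Lambda>) * ?l)"
        by (rule mult_mono[OF _ yx W norm_ge_zero])
      have "(\<integral>s. \<gamma> * \<kappa> * k s \<partial>time_measure) \<le> \<gamma> * \<kappa> * (\<Lambda> * ?l)"
        using k_int \<gamma> \<kappa> by simp
      moreover have "0 \<le> (\<gamma>\<^sup>2 + 1) * intensity" using intensity_nonneg by simp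
      ultimately show "K * ((\<gamma>\<^sup>2 + 1) * intensity * (\<integral>s. \<gamma> * \<kappa> * k s \<partial>time_measure))
          \<le> K * ((\<gamma>\<^sup>2 + 1) * intensity * (\<gamma> * \<kappa> * (\<Lambda> * ?l)))"
        using K by (intro mult_left_mono)
    qed
    also have "\<dots> = E * ?l" unfolding E_def by (simp add: algebra_simps)
    also have "\<dots> \<le> (E + 1) * ?l" by (intro mult_right_mono) auto
    finally show ?thesis using int by (simp add: mult.assoc)
  qed
  \<comment> \<open>The summand 1 makes the constant strictly positive.\<close>
  show ?thesis using main E by (intro exI[of _ "E + 1"]) auto
qed

end
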